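(* Let $m\ge 1$ and $n>2m$, let $L$ be a uniformly elliptic operator on $\mathbb{R}^n$ of order $2m$ with constant coefficients involving only the highest order derivatives, and consider its $(2m-n)$-homogeneous fundamental solution $K_L$ (John's fundamental solution). Then there exists $y\in\mathbb{R}^n\setminus\{0\}$ such that $$K_L(0,y)>0.$$
   Context: Operators: $L=(-1)^m Q\left(\frac{\partial}{\partial x_1},\dots,\frac{\partial}{\partial x_n}\right)$, where $Q(\xi)=\sum_{i_1,\dots,i_{2m}=1}^n A_{i_1,\dots,i_{2m}}\xi_{i_1}\cdots\xi_{i_{2m}}$ is a real $2m$-homogeneous polynomial on $\mathbb{R}^n$, called the symbol of $L$. Uniform ellipticity: there is $\lambda>0$ with $Q(\xi)\ge\lambda|\xi|^{2m}$ for all $\xi\in\mathbb{R}^n$. For $n>2m$, John's fundamental solution $K_L$ is, for $x\ne y$, $$K_L(x,y)=-\frac{1}{4(2\pi)^{n-1}}(-\Delta_y)^{\frac{n+1-2m}{2}}\int_{|\xi|=1}\frac{|(x-y)\cdot\xi|}{Q(\xi)}\,d\mathcal{H}^{n-1}(\xi)\quad (n\text{ odd}),$$ $$K_L(x,y)=-\frac{1}{(2\pi)^{n}}(-\Delta_y)^{\frac{n-2m}{2}}\int_{|\xi|=1}\frac{\log|(x-y)\cdot\xi|}{Q(\xi)}\,d\mathcal{H}^{n-1}(\xi)\quad (n\text{ even}).$$ It satisfies $\int_{\mathbb{R}^n}K_L(x,y)L\psi(y)\,dy=\psi(x)$ for all $\psi\in C_0^\infty(\mathbb{R}^n)$, and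 $K_L(x,y)=K_L(0,x-y)=K_L(0,y-x)$. $\mathcal{H}^k$ is the $k$-dimensional Hausdorff measure. *)

theory Defs
  imports "HOL-Analysis.Analysis"
begin

text \<open>
  The Hausdorff measure, normalised so that in dimension \<open>k\<close> it agrees with Lebesgue measure
  on Euclidean \<open>k\<close>-space. Covering sets are required to be bounded because \<^const>\<open>diameter\<close>
  is an unspecified real number on unbounded sets; the empty set is singled out
  because \<open>0 ^ 0 = 1\<close>.
\<close>

definition hausdorff_content :: "nat \<Rightarrow> 'a::metric_space set \<Rightarrow> ennreal" where
  "hausdorff_content k U =
     (if U = {} then 0 else ennreal (unit_ball_vol (real k) * (diameter U / 2) ^ k))"

definition hausdorff_premeasure :: "nat \<Rightarrow> real \<Rightarrow> 'a::metric_space set \<Rightarrow> ennreal" where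
  "hausdorff_premeasure k \<delta> S =
     Inf {(\<Sum>i. hausdorff_content k (U i)) | U :: nat \<Rightarrow> 'a set.
            S \<subseteq> (\<Union>i. U i) \<and> (\<forall>i. bounded (U i) \<and> diameter (U i) \<le> \<delta>)}"

definition hausdorff_outer :: "nat \<Rightarrow> 'a::metric_space set \<Rightarrow> ennreal" where
  "hausdorff_outer k S = (SUP \<delta>\<in>{0<..}. hausdorff_premeasure k \<delta> S)"

definition hausdorff_measure :: "nat \<Rightarrow> 'a::metric_space measure" where
  "hausdorff_measure k = measure_of UNIV (sets borel) (hausdorff_outer k)"

definition partial :: "'n::finite \<Rightarrow> (real^'n \<Rightarrow> real) \<Rightarrow> real^'n \<Rightarrow> real" where
  "partial i u x = deriv (\<lambda>t. u (x + t *\<^sub>R axis i 1)) 0"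

definition laplacian :: "(real^'n::finite \<Rightarrow> real) \<Rightarrow> real^'n \<Rightarrow> real" where
  "laplacian u x = (\<Sum>i\<in>UNIV. partial i (partial i u) x)"

text \<open>
  The coefficients form a function on lists of indices, of which only the
  values on lists of length \<open>k = 2m\<close> are used. No symmetry of the coefficients is assumed.
\<close>

definition symbol :: "nat \<Rightarrow> ('n::finite list \<Rightarrow> real) \<Rightarrow> real^'n \<Rightarrow> real" where
  "symbol m A \<xi> = (\<Sum>is | length is = 2 * m. A is * (\<Prod>i\<leftarrow>is. \<xi> $ i))"

definition homogeneous_operator ::
  "nat \<Rightarrow> ('n::finite list \<Rightarrow> real) \<Rightarrow> (real^'n \<Rightarrow> real) \<Rightarrow> real^'n \<Rightarrow> real" where
  "homogeneous_operator m A u x =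
     (- 1) ^ m * (\<Sum>is | length is = 2 * m. A is * foldr partial is u x)"

definition uniformly_elliptic :: "nat \<Rightarrow> (real^'n::finite \<Rightarrow> real) \<Rightarrow> bool" where
  "uniformly_elliptic m Q \<longleftrightarrow> (\<exists>c>0. \<forall>\<xi>. Q \<xi> \<ge> c * norm \<xi> ^ (2 * m))"

text \<open>
  John's fundamental solution of the operator of order \<open>2m\<close> with symbol \<open>Q\<close>. It is meaningful for
  \<open>x \<noteq> y\<close> and \<open>2m < n\<close>; both powers of \<open>-\<Delta>\<^sub>y\<close> are then positive integers. The convention
  \<open>ln 0 = 0\<close> only affects a null set of the sphere.
\<close>

definition john_fundamental_solution ::
  "nat \<Rightarrow> (real^'n::finite \<Rightarrow> real) \<Rightarrow> real^'n \<Rightarrow> real^'n \<Rightarrow> real" where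
  "john_fundamental_solution m Q x y =
     (let n = CARD('n);
          \<sigma> = hausdorff_measure (n - 1) :: (real^'n) measure;
          neg_laplacian = (\<lambda>u z. - laplacian u z)
      in if odd n
         then - 1 / (4 * (2 * pi) ^ (n - 1)) *
              (neg_laplacian ^^ ((n + 1 - 2 * m) div 2))
                (\<lambda>z. LINT \<xi>:sphere 0 1|\<sigma>. \<bar>(x - z) \<bullet> \<xi>\<bar> / Q \<xi>) y
         else - 1 / (2 * pi) ^ n *
              (neg_laplacian ^^ ((n - 2 * m) div 2))
                (\<lambda>z. LINT \<xi>:sphere 0 1|\<sigma>. ln \<bar>(x - z) \<bullet> \<xi>\<bar> / Q \<xi>) y)"

end

theory Submission
  imports Defs "HOL-Computational_Algebra.Polynomial"
begin

text \<open>
  On \<open>x \<noteq> 0\<close>, \<open>K\<^sub>L(0, \<cdot>)\<close> is a negative multiple of \<open>(-\<Delta>)\<^sup>k F\<close>, where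
  \<open>F(z) = \<integral> u(z \<bullet> \<xi>) / Q(\<xi>) d\<sigma>(\<xi>)\<close> over the unit sphere and \<open>u\<close> is \<open>\<bar>t\<bar>\<close> or \<open>ln \<bar>t\<bar>\<close>. Pair it
  with a nonnegative radial function \<open>\<phi>\<close> supported in an annulus: by Green's identity the pairing is
  \<open>\<integral> F (-\<Delta>)\<^sup>k \<phi>\<close>, and as \<open>(-\<Delta>)\<^sup>k \<phi>\<close> is again radial, Fubini and rotation invariance show that it
  is the mean of \<open>1 / Q\<close> times the same pairing for \<open>Q = 1\<close>. In that case \<open>F\<close> is an explicit radial
  function, \<open>(-\<Delta>)\<^sup>k F\<close> is a negative multiple of \<open>\<bar>z\<bar>\<close> to the power \<open>2m - n\<close>, and the pairing is negative.
  Hence \<open>(-\<Delta>)\<^sup>k F < 0\<close> somewhere.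
\<close>

section \<open>Hausdorff measure as a Borel measure\<close>

text \<open>Only an average can be computed. The sign of (-\<Delta>)^k F at a given point depends on
  how \<open>1 / Q\<close> is distributed over the sphere, whereas a radial weight retains just the
  total mass of \<open>1 / Q\<close>; hence a conclusion that is existential. For
  \<open>Q = 1\<close> the computation starts from \<open>mean\<close> times |z|, or from
  \<open>mean\<close> plus \<open>total\<close> times ln |z|. On the power p of z . z the operator
  -\<Delta> acts by the factor (-2p)(2p - 2 + n): its first application makes the coefficient
  negative, later ones keep it so, and the last value of 2p - 2 + n that occurs is 2m > 0. Two
  obstacles shape the proof. \<open>partial\<close> is \<open>deriv\<close>, which says nothing
  where no derivative exists, so F must be shown to be smooth off the origin although u is singular
  where z . \<xi> = 0. And the surface measure is the bare Hausdorff measure, without polar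
  coordinates: its finiteness, positivity and rotation invariance are proved from coverings, and all
  else about it comes from invariance and Fubini.\<close>

lemma metric_outer_measure_separated_sum:
  fixes f :: "'a::metric_space set \<Rightarrow> ennreal" and n :: nat
  assumes pos: "f {} = 0"
    and metric: "\<And>A B d. 0 < d \<Longrightarrow> (\<And>a b. a \<in> A \<Longrightarrow> b \<in> B \<Longrightarrow> d \<le> dist a b) \<Longrightarrow> f A + f B \<le> f (A \<union> B)"
    and sep: "\<And>n. \<exists>d>0. \<forall>i<n. \<forall>a\<in>R i. \<forall>b\<in>R n. d \<le> dist a b"
  shows "(\<Sum>i<n. f (R i)) \<le> f (\<Union>i<n. R i)"
proof (induction n)
  case 0
  then show ?case by (simp add: pos)
next
  case (Suc n)
  obtain d where d: "d > 0" "\<forall>i<n. \<forall>a\<in>R i. \<forall>b\<in>R n. d \<le> dist a b"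
    using sep by blast
  have "(\<Sum>i<Suc n. f (R i)) \<le> f (\<Union>i<n. R i) + f (R n)"
    using Suc by (simp add: add_right_mono)
  also have "\<dots> \<le> f ((\<Union>i<n. R i) \<union> R n)"
    by (rule metric[of d]) (use d in auto)
  also have "(\<Union>i<n. R i) \<union> R n = (\<Union>i<Suc n. R i)"
    by (auto simp: less_Suc_eq)
  finally show ?case .
qed

text \<open>Caratheodory's criterion for metric outer measures. T - C is exhausted by sets at
  positive distance from C; what is missing is a tail of shells whose measures form a convergent
  series, because every second shell is separated from the next.\<close>

lemma closed_in_lambda_system:
  fixes f :: "'a::metric_space set \<Rightarrow> ennreal"
  assumes oms: "outer_measure_space (Pow UNIV) f"
    and metric: "\<And>A B d. 0 < d \<Longrightarrow> (\<And>a b. a \<in> A \<Longrightarrow> b \<in> B \<Longrightarrow> d \<le> dist a b) \<Longrightarrow> f A + f B \<le> f (A \<union> B)"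
    and C: "closed C"
  shows "C \<in> lambda_system UNIV (Pow UNIV) f"
proof -
  have pos: "f {} = 0"
    using oms by (auto simp: outer_measure_space_def positive_def)
  have mono: "f A \<le> f B" if "A \<subseteq> B" for A B
    using oms that by (auto simp: outer_measure_space_def increasing_def)
  have csub: "f (\<Union>i. A i) \<le> (\<Sum>i. f (A i))" for A :: "nat \<Rightarrow> 'a set"
  proof -
    have "f (\<Union>i. disjointed A i) \<le> (\<Sum>i. f (disjointed A i))"
      using oms disjoint_family_disjointed[of A] by (auto simp: outer_measure_space_def countably_subadditive_def)
    also have "\<dots> \<le> (\<Sum>i. f (A i))"
      by (intro suminf_le mono disjointed_subset) auto
    finally show ?thesis by (simp add: UN_disjointed_eq)
  qed
  have sub: "f (A \<union> B) \<le> f A + f B" for A B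
  proof -
    have "subadditive (Pow UNIV) f"
      using oms sigma_algebra.axioms(1) unfolding outer_measure_space_def
      by (meson algebra_Pow algebra.axioms(1) ring_of_sets.countably_subadditive_subadditive)
    then have "f (x \<union> y) \<le> f x + f y" if "x \<inter> y = {}" for x y
      using that by (simp add: subadditive_def)
    from this[of A "B - A"] have "f (A \<union> B) \<le> f A + f (B - A)" by simp
    also have "\<dots> \<le> f A + f B" by (intro add_left_mono mono) auto
    finally show ?thesis .
  qed
  have main: "f (T \<inter> C) + f (T - C) \<le> f T" if ne: "C \<noteq> {}" and fin: "f T < top" for T
  proof -
    \<comment> \<open>\<open>A j\<close> keeps distance 1/(j+1) from C, so metric additivity applies
      to it and T \<inter> C; the shells \<open>R j\<close> fill the gap between \<open>A j\<close>
      and T - C.\<close>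
    define A where "A j = {x\<in>T. 1 / real (j+1) \<le> infdist x C}" for j :: nat
    define R where "R j = {x\<in>T. 1 / real (j+2) \<le> infdist x C \<and> infdist x C < 1 / real (j+1)}" for j :: nat
    have RT: "R j \<subseteq> T" for j by (auto simp: R_def)
    \<comment> \<open>p is the parity. Distinct indices of one parity differ by at least 2, so a
      whole shell lies between them, and its width is d.\<close>
    have sep: "\<exists>d>0. \<forall>i<n. \<forall>a\<in>R (2*i+p). \<forall>b\<in>R (2*n+p). d \<le> dist a b" for n p
    proof (cases "n = 0")
      case False
      define d where "d = 1 / real (2*n+p) - 1 / real (2*n+p+1)"
      have "d > 0" using False by (simp add: d_def frac_less2)
      moreover have "d \<le> dist a b" if "i < n" "a \<in> R (2*i+p)" "b \<in> R (2*n+p)" for i a b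
      proof -
        have "1 / real (2*n+p) \<le> 1 / real (2*i+p+2)"
          using that(1) False by (intro divide_left_mono) auto
        also have "\<dots> \<le> infdist a C" using that(2) by (auto simp: R_def)
        also have "\<dots> \<le> infdist b C + dist a b" by (rule infdist_triangle)
        also have "infdist b C < 1 / real (2*n+p+1)" using that(3) by (simp add: R_def)
        finally show ?thesis by (simp add: d_def)
      qed
      ultimately show ?thesis by blast
    qed (auto intro: exI[of _ 1])
    have half: "(\<Sum>i<n. f (R (2*i+p))) \<le> f T" for n p
      by (rule order_trans[OF metric_outer_measure_separated_sum[OF pos metric sep] mono])
        (use RT in auto)
    have "(\<Sum>i<n. f (R i)) \<le> 2 * f T" for n
    proof -
      have "(\<Sum>i<n. f (R i)) \<le> (\<Sum>i<2*n. f (R i))"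
        by (rule sum_mono2) auto
      also have "\<dots> = (\<Sum>i<n. f (R (2*i))) + (\<Sum>i<n. f (R (2*i+1)))"
        by (induction n) (auto simp: algebra_simps)
      also have "\<dots> \<le> f T + f T"
        using half[where p=0] half[where p=1] by (intro add_mono) auto
      finally show ?thesis by (simp add: mult_2)
    qed
    then have "(\<Sum>i. f (R i)) \<le> 2 * f T"
      by (intro suminf_le_const) auto
    also have "\<dots> < top" using fin by (simp add: ennreal_mult_less_top)
    finally have sfin: "(\<Sum>i. f (R i)) < top" .
    define h where "h i = enn2real (f (R i))" for i
    have fh: "f (R i) = ennreal (h i)" for i
      using order_le_less_trans[OF mono[OF RT] fin] by (simp add: h_def)
    have h0: "h i \<ge> 0" for i by (simp add: h_def)
    have sh: "summable h"
      using sfin by (intro summable_suminf_not_top) (auto simp: fh h0)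
    have bd: "f (T \<inter> C) + f (T - C) \<le> f T + ennreal (\<Sum>i. h (i + j))" for j
    proof -
      \<comment> \<open>A point of T - C has positive distance to the closed set C. If l is least
        with 1/(l+1) at most that distance, the point lies in \<open>A j\<close> for l \<le> j and
        in the shell \<open>R (l - 1)\<close> otherwise.\<close>
      have "T - C \<subseteq> A j \<union> (\<Union>i. R (i + j))"
      proof
        fix x assume x: "x \<in> T - C"
        then have "infdist x C > 0"
          using C ne by (metis DiffD2 in_closed_iff_infdist_zero infdist_nonneg less_eq_real_def)
        then obtain N where N: "1 / real (Suc N) < infdist x C"
          using nat_approx_posE by metis
        show "x \<in> A j \<union> (\<Union>i. R (i + j))"
        proof (cases "x \<in> A j")
          case False
          define l where "l = (LEAST l. 1 / real (l+1) \<le> infdist x C)"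
          have l: "1 / real (l+1) \<le> infdist x C"
            unfolding l_def by (rule LeastI[of _ N]) (use N in simp)
          have lm: "\<not> 1 / real (i+1) \<le> infdist x C" if "i < l" for i
            using that not_less_Least unfolding l_def by blast
          have "l > j"
          proof (rule ccontr)
            assume "\<not> l > j"
            then have "1 / real (j+1) \<le> 1 / real (l+1)" by (intro divide_left_mono) auto
            then show False using l x False by (auto simp: A_def)
          qed
          then have "x \<in> R (l - 1)"
            using l lm[of "l-1"] x by (auto simp: R_def not_le)
          moreover have "l - 1 = (l - 1 - j) + j" using \<open>l > j\<close> by simp
          ultimately show ?thesis by (metis UN_I UNIV_I UnCI)
        qed auto
      qed
      then have "f (T - C) \<le> f (A j \<union> (\<Union>i. R (i + j)))" by (rule mono)
      also have "\<dots> \<le> f (A j) + f (\<Union>i. R (i + j))" by (rule sub)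
      also have "f (\<Union>i. R (i + j)) \<le> (\<Sum>i. f (R (i + j)))" by (rule csub)
      also have "\<dots> = ennreal (\<Sum>i. h (i + j))"
        unfolding fh by (rule suminf_ennreal2) (use sh h0 in \<open>auto simp: summable_iff_shift\<close>)
      finally have "f (T \<inter> C) + f (T - C) \<le> f (T \<inter> C) + (f (A j) + ennreal (\<Sum>i. h (i + j)))"
        by (simp add: add_left_mono)
      also have "\<dots> = (f (T \<inter> C) + f (A j)) + ennreal (\<Sum>i. h (i + j))"
        by (simp add: add.assoc)
      also have "f (T \<inter> C) + f (A j) \<le> f ((T \<inter> C) \<union> A j)"
      proof (rule metric[of "1 / real (j+1)"])
        fix a b assume "a \<in> T \<inter> C" "b \<in> A j"
        then have "1 / real (j+1) \<le> infdist b C" "infdist b C \<le> dist b a"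
          by (auto simp: A_def infdist_le)
        then show "1 / real (j+1) \<le> dist a b" by (simp add: dist_commute)
      qed auto
      also have "\<dots> \<le> f T" by (rule mono) (auto simp: A_def)
      finally show ?thesis by (simp add: add_right_mono)
    qed
    show ?thesis
    proof (rule ennreal_le_epsilon)
      fix e :: real assume "e > 0"
      then obtain N where "norm (\<Sum>i. h (i + N)) < e"
        using suminf_exist_split[OF _ sh] by blast
      then have "ennreal (\<Sum>i. h (i + N)) \<le> ennreal e" by (intro ennreal_leI) auto
      then show "f (T \<inter> C) + f (T - C) \<le> f T + ennreal e"
        using bd[of N] by (meson add_left_mono order_trans)
    qed
  qed
  have "f (C \<inter> T) + f ((UNIV - C) \<inter> T) = f T" for T
  proof (rule antisym)
    show "f (C \<inter> T) + f ((UNIV - C) \<inter> T) \<le> f T"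
    proof (cases "C = {} \<or> f T = top")
      case True
      then show ?thesis by (auto simp: pos)
    next
      case False
      then have "f (T \<inter> C) + f (T - C) \<le> f T" by (intro main) (auto simp: less_top)
      then show ?thesis by (metis Int_Diff Int_commute inf_top.right_neutral)
    qed
    have "T = (C \<inter> T) \<union> ((UNIV - C) \<inter> T)" by auto
    then show "f T \<le> f (C \<inter> T) + f ((UNIV - C) \<inter> T)"
      by (metis sub)
  qed
  then show ?thesis by (auto simp: lambda_system_def)
qed

text \<open>Closed sets generate the Borel sets, so these all lie in the lambda-system, on which
  \<open>caratheodory_lemma\<close> makes f a measure.\<close>

lemma measure_space_borel_of_metric_outer_measure:
  fixes f :: "'a::metric_space set \<Rightarrow> ennreal"
  assumes oms: "outer_measure_space (Pow UNIV) f"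
    and metric: "\<And>A B d. 0 < d \<Longrightarrow> (\<And>a b. a \<in> A \<Longrightarrow> b \<in> B \<Longrightarrow> d \<le> dist a b) \<Longrightarrow> f A + f B \<le> f (A \<union> B)"
  shows "measure_space UNIV (sets borel) f"
proof -
  interpret P: sigma_algebra UNIV "Pow (UNIV :: 'a set)" by (rule sigma_algebra_Pow)
  have ms: "measure_space UNIV (lambda_system UNIV (Pow UNIV) f) f"
    by (rule P.caratheodory_lemma[OF oms])
  then interpret L: sigma_algebra UNIV "lambda_system UNIV (Pow UNIV) f"
    by (simp add: measure_space_def)
  have "sets borel = sigma_sets UNIV {S :: 'a set. closed S}"
    by (simp add: borel_eq_closed)
  also have "\<dots> \<subseteq> lambda_system UNIV (Pow UNIV) f"
    by (rule L.sigma_sets_subset) (use closed_in_lambda_system[OF oms metric] in auto)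
  finally have sub: "sets borel \<subseteq> lambda_system UNIV (Pow UNIV) f" .
  show ?thesis
    using ms sub sets.sigma_algebra_axioms[of borel] unfolding measure_space_def
    by (auto simp: countably_additive_def positive_def)
qed

section \<open>Countable subadditivity and metric additivity of the Hausdorff outer measure\<close>

lemma hausdorff_premeasure_le:
  assumes "S \<subseteq> (\<Union>i. U i)" "\<And>i. bounded (U i)" "\<And>i. diameter (U i) \<le> \<delta>"
  shows "hausdorff_premeasure k \<delta> S \<le> (\<Sum>i. hausdorff_content k (U i))"
  unfolding hausdorff_premeasure_def
  by (intro Inf_lower CollectI exI[of _ U] conjI allI refl assms)

lemma hausdorff_premeasure_antimono:
  assumes "\<delta> \<le> \<delta>'"
  shows "hausdorff_premeasure k \<delta>' S \<le> hausdorff_premeasure k \<delta> S"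
  unfolding hausdorff_premeasure_def[of k \<delta>]
proof (rule Inf_greatest, elim CollectE exE conjE, hypsubst)
  fix U :: "nat \<Rightarrow> 'a set"
  assume "S \<subseteq> (\<Union>i. U i)" "\<forall>i. bounded (U i) \<and> diameter (U i) \<le> \<delta>"
  then show "hausdorff_premeasure k \<delta>' S \<le> (\<Sum>i. hausdorff_content k (U i))"
    using assms by (intro hausdorff_premeasure_le) (auto intro: order_trans)
qed

lemma hausdorff_premeasure_le_outer:
  "\<delta> > 0 \<Longrightarrow> hausdorff_premeasure k \<delta> S \<le> hausdorff_outer k S"
  unfolding hausdorff_outer_def by (rule SUP_upper) auto

lemma hausdorff_premeasure_mono:
  assumes "S \<subseteq> T"
  shows "hausdorff_premeasure k \<delta> S \<le> hausdorff_premeasure k \<delta> T"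
  unfolding hausdorff_premeasure_def[of k \<delta> T]
proof (rule Inf_greatest, elim CollectE exE conjE, hypsubst)
  fix U :: "nat \<Rightarrow> 'a set"
  assume "T \<subseteq> (\<Union>i. U i)" "\<forall>i. bounded (U i) \<and> diameter (U i) \<le> \<delta>"
  then show "hausdorff_premeasure k \<delta> S \<le> (\<Sum>i. hausdorff_content k (U i))"
    using assms by (intro hausdorff_premeasure_le) auto
qed

text \<open>Covers of the \<open>A n\<close> that are optimal up to e/2^(n+1) are merged into one
  sequence along \<open>prod_decode\<close>.\<close>

lemma hausdorff_premeasure_subadditive:
  fixes A :: "nat \<Rightarrow> 'a::metric_space set"
  shows "hausdorff_premeasure k \<delta> (\<Union>i. A i) \<le> (\<Sum>i. hausdorff_premeasure k \<delta> (A i))"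
proof (rule ennreal_le_epsilon)
  fix e :: real assume e: "0 < e" and fin: "(\<Sum>i. hausdorff_premeasure k \<delta> (A i)) < top"
  let ?P = "hausdorff_premeasure k \<delta>"
  have "\<exists>U. A n \<subseteq> (\<Union>i. U i) \<and> (\<forall>i. bounded (U i) \<and> diameter (U i) \<le> \<delta>) \<and>
        (\<Sum>i. hausdorff_content k (U i)) \<le> ?P (A n) + e * (1/2)^Suc n" for n
  proof -
    have "?P (A n) < ?P (A n) + e * (1/2)^Suc n"
      using e fin by (auto simp add: less_top dest!: ennreal_suminf_lessD)
    then obtain y where y: "y < ?P (A n) + e * (1/2)^Suc n"
        "y \<in> {(\<Sum>i. hausdorff_content k (U i)) | U :: nat \<Rightarrow> 'a set.
            A n \<subseteq> (\<Union>i. U i) \<and> (\<forall>i. bounded (U i) \<and> diameter (U i) \<le> \<delta>)}"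
      unfolding hausdorff_premeasure_def[of k \<delta> "A n"] Inf_less_iff by blast
    from y(2) obtain U where "y = (\<Sum>i. hausdorff_content k (U i))" "A n \<subseteq> (\<Union>i. U i)"
        "\<forall>i. bounded (U i) \<and> diameter (U i) \<le> \<delta>"
      by (elim CollectE exE conjE)
    with y(1) show ?thesis by (intro exI[of _ U] conjI) (auto intro: less_imp_le)
  qed
  then obtain B where B: "\<And>n. A n \<subseteq> (\<Union>i. B n i)" "\<And>n i. bounded (B n i)"
      "\<And>n i. diameter (B n i) \<le> \<delta>"
      "\<And>n. (\<Sum>i. hausdorff_content k (B n i)) \<le> ?P (A n) + e * (1/2)^Suc n"
    by metis
  define C where "C = case_prod B o prod_decode"
  have AC: "(\<Union>i. A i) \<subseteq> (\<Union>i. C i)"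
    using B(1) by (auto simp add: C_def subset_eq) (metis prod.case prod_encode_inverse)
  have "?P (\<Union>i. A i) \<le> (\<Sum>i. hausdorff_content k (C i))"
    by (rule hausdorff_premeasure_le[OF AC]) (auto simp: C_def split: prod.split intro: B)
  also have "\<dots> = (\<Sum>n. \<Sum>i. hausdorff_content k (B n i))"
    unfolding C_def comp_def
    by (rule suminf_ennreal_2dimen[of _ "\<lambda>p. hausdorff_content k (case_prod B p)"]) auto
  also have "\<dots> \<le> (\<Sum>n. ?P (A n) + e * (1/2) ^ Suc n)"
    by (intro suminf_le allI B) auto
  also have "... = (\<Sum>n. ?P (A n)) + (\<Sum>n. ennreal e * ennreal ((1/2) ^ Suc n))"
    using e by (subst suminf_add[symmetric])
               (auto simp del: ennreal_suminf_cmult simp add: ennreal_mult[symmetric])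
  also have "\<dots> = (\<Sum>n. ?P (A n)) + e"
    unfolding ennreal_suminf_cmult
    by (subst suminf_ennreal_eq[OF zero_le_power power_half_series]) auto
  finally show "?P (\<Union>i. A i) \<le> (\<Sum>n. ?P (A n)) + e" .
qed

lemma hausdorff_outer_empty: "hausdorff_outer k {} = 0"
proof -
  have "hausdorff_premeasure k \<delta> {} = 0" if "\<delta> > 0" for \<delta>
    using hausdorff_premeasure_le[of "{}" "\<lambda>_. {}" \<delta> k] that by (simp add: hausdorff_content_def)
  then have "hausdorff_outer k {} \<le> 0"
    unfolding hausdorff_outer_def by (intro SUP_least) simp
  then show ?thesis by simp
qed

lemma outer_measure_space_hausdorff: "outer_measure_space (Pow UNIV) (hausdorff_outer k)"
proof -
  have "hausdorff_outer k (\<Union>i. A i) \<le> (\<Sum>i. hausdorff_outer k (A i))" for A :: "nat \<Rightarrow> 'a set"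
    unfolding hausdorff_outer_def[of k "\<Union>i. A i"]
    by (intro SUP_least order_trans[OF hausdorff_premeasure_subadditive] suminf_le
        hausdorff_premeasure_le_outer) auto
  moreover have "hausdorff_outer k A \<le> hausdorff_outer k B" if "A \<subseteq> B" for A B :: "'a set"
    unfolding hausdorff_outer_def using that by (intro SUP_mono' hausdorff_premeasure_mono)
  ultimately show ?thesis
    by (auto simp: outer_measure_space_def positive_def hausdorff_outer_empty increasing_def
        countably_subadditive_def)
qed

text \<open>A set of diameter at most \<delta> < d cannot meet both A and B, so a cover of the union
  splits into a cover of each. Discarded sets are replaced by the empty set, of content 0, which
  keeps the index set.\<close>

lemma hausdorff_premeasure_separated:
  fixes A B :: "'a::metric_space set"
  assumes "0 < \<delta>" "\<delta> < d" and sep: "\<And>a b. a \<in> A \<Longrightarrow> b \<in> B \<Longrightarrow> d \<le> dist a b"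
  shows "hausdorff_premeasure k \<delta> A + hausdorff_premeasure k \<delta> B \<le> hausdorff_premeasure k \<delta> (A \<union> B)"
  unfolding hausdorff_premeasure_def[of k \<delta> "A \<union> B"]
proof (rule Inf_greatest, safe)
  fix U :: "nat \<Rightarrow> 'a set"
  assume U: "A \<union> B \<subseteq> (\<Union>i. U i)" "\<forall>i. bounded (U i) \<and> diameter (U i) \<le> \<delta>"
  define V where "V S i = (if U i \<inter> S = {} then {} else U i)" for S i
  have le: "hausdorff_premeasure k \<delta> S \<le> (\<Sum>i. hausdorff_content k (V S i))" if "S \<subseteq> A \<union> B" for S
  proof (rule hausdorff_premeasure_le)
    show "S \<subseteq> (\<Union>i. V S i)"
    proof
      fix x assume "x \<in> S"
      then have "x \<in> (\<Union>i. U i)" using that U(1) by blast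
      then obtain i where "x \<in> U i" by blast
      then have "x \<in> V S i" using \<open>x \<in> S\<close> by (auto simp: V_def)
      then show "x \<in> (\<Union>i. V S i)" by blast
    qed
  qed (use U(2) assms in \<open>auto simp: V_def\<close>)
  have "hausdorff_premeasure k \<delta> A + hausdorff_premeasure k \<delta> B
      \<le> (\<Sum>i. hausdorff_content k (V A i)) + (\<Sum>i. hausdorff_content k (V B i))"
    by (intro add_mono le) auto
  also have "\<dots> = (\<Sum>i. hausdorff_content k (V A i) + hausdorff_content k (V B i))"
    by (rule suminf_add) auto
  also have "\<dots> \<le> (\<Sum>i. hausdorff_content k (U i))"
  proof (intro suminf_le allI)
    fix i
    have "U i \<inter> A = {} \<or> U i \<inter> B = {}"
    proof (rule ccontr)
      assume "\<not> ?thesis"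
      then obtain a b where ab: "a \<in> U i" "a \<in> A" "b \<in> U i" "b \<in> B" by blast
      then have "dist a b \<le> diameter (U i)" using U(2) by (intro diameter_bounded_bound) auto
      moreover have "diameter (U i) \<le> \<delta>" using U(2) by simp
      ultimately show False using sep[OF ab(2) ab(4)] assms(2) by linarith
    qed
    then show "hausdorff_content k (V A i) + hausdorff_content k (V B i) \<le> hausdorff_content k (U i)"
      by (auto simp: V_def hausdorff_content_def)
  qed auto
  finally show "hausdorff_premeasure k \<delta> A + hausdorff_premeasure k \<delta> B
      \<le> (\<Sum>i. hausdorff_content k (U i))" .
qed

text \<open>The two suprema run over independent scales \<delta> and \<delta>'; since premeasures
  grow as the scale shrinks, both can be compared at one common scale below d.\<close>

lemma hausdorff_outer_separated:
  fixes A B :: "'a::metric_space set"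
  assumes d: "0 < d" and sep: "\<And>a b. a \<in> A \<Longrightarrow> b \<in> B \<Longrightarrow> d \<le> dist a b"
  shows "hausdorff_outer k A + hausdorff_outer k B \<le> hausdorff_outer k (A \<union> B)"
proof -
  let ?P = "hausdorff_premeasure k"
  have *: "?P \<delta> A + ?P \<delta>' B \<le> hausdorff_outer k (A \<union> B)" if "\<delta> > 0" "\<delta>' > 0" for \<delta> \<delta>'
  proof -
    define \<epsilon> where "\<epsilon> = min (min \<delta> \<delta>') (d/2)"
    have e: "\<epsilon> > 0" "\<epsilon> < d" "\<epsilon> \<le> \<delta>" "\<epsilon> \<le> \<delta>'" using that d by (auto simp: \<epsilon>_def)
    have "?P \<delta> A + ?P \<delta>' B \<le> ?P \<epsilon> A + ?P \<epsilon> B"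
      by (intro add_mono hausdorff_premeasure_antimono e)
    also have "\<dots> \<le> ?P \<epsilon> (A \<union> B)"
      by (rule hausdorff_premeasure_separated[OF e(1,2) sep])
    also have "\<dots> \<le> hausdorff_outer k (A \<union> B)" by (rule hausdorff_premeasure_le_outer[OF e(1)])
    finally show ?thesis .
  qed
  have "hausdorff_outer k A + ?P \<delta>' B \<le> hausdorff_outer k (A \<union> B)" if "\<delta>' > 0" for \<delta>'
    unfolding hausdorff_outer_def[of k A]
    by (subst ennreal_SUP_add_left[symmetric]) (use that * in \<open>auto intro!: SUP_least\<close>)
  then show ?thesis
    unfolding hausdorff_outer_def[of k B]
    by (subst ennreal_SUP_add_right) (auto intro!: SUP_least)
qed

lemma sets_hausdorff_measure [simp, measurable_cong]: "sets (hausdorff_measure k) = sets borel"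
  by (simp add: hausdorff_measure_def sets.sigma_sets_eq[of borel, simplified])

lemma space_hausdorff_measure [simp]: "space (hausdorff_measure k) = UNIV"
  by (simp add: hausdorff_measure_def)

text \<open>\<open>measure_of\<close> returns the zero measure unless the set function is known to
  be a measure on the generated sigma-algebra; that is what the criterion for metric outer measures
  is needed for.\<close>

lemma emeasure_hausdorff_measure:
  fixes A :: "'a::metric_space set"
  assumes "A \<in> sets borel"
  shows "emeasure (hausdorff_measure k) A = hausdorff_outer k A"
proof -
  have "measure_space UNIV (sets borel) (hausdorff_outer k :: 'a set \<Rightarrow> ennreal)"
    by (intro measure_space_borel_of_metric_outer_measure outer_measure_space_hausdorff
        hausdorff_outer_separated) blast
  then show ?thesis
    unfolding hausdorff_measure_def using assms
    by (subst emeasure_measure_of_sigma) (auto simp: measure_space_def)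
qed

section \<open>Hausdorff measure on the unit sphere\<close>

lemma diameter_isometry_image:
  fixes f :: "'a::metric_space \<Rightarrow> 'b::metric_space"
  assumes "\<And>x y. dist (f x) (f y) = dist x y"
  shows "diameter (f ` S) = diameter S"
proof -
  have "(\<lambda>(x, y). dist x y) ` (f ` S \<times> f ` S) = (\<lambda>(x, y). dist x y) ` (S \<times> S)"
    by (force simp: assms)
  then show ?thesis by (simp add: diameter_def)
qed

lemma hausdorff_outer_isometry_le:
  fixes f :: "'a::metric_space \<Rightarrow> 'b::metric_space"
  assumes iso: "\<And>x y. dist (f x) (f y) = dist x y"
  shows "hausdorff_outer k (f ` S) \<le> hausdorff_outer k S"
proof -
  have "hausdorff_premeasure k \<delta> (f ` S) \<le> hausdorff_premeasure k \<delta> S" for \<delta>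
    unfolding hausdorff_premeasure_def[of k \<delta> S]
  proof (rule Inf_greatest, elim CollectE exE conjE, hypsubst)
    fix U :: "nat \<Rightarrow> 'a set"
    assume U: "S \<subseteq> (\<Union>i. U i)" "\<forall>i. bounded (U i) \<and> diameter (U i) \<le> \<delta>"
    have "bounded (f ` U i)" for i
    proof -
      obtain x e where "\<forall>y\<in>U i. dist x y \<le> e" using U(2) unfolding bounded_def by blast
      then have "\<forall>y\<in>f ` U i. dist (f x) y \<le> e" by (auto simp: iso)
      then show ?thesis unfolding bounded_def by blast
    qed
    then have "hausdorff_premeasure k \<delta> (f ` S) \<le> (\<Sum>i. hausdorff_content k (f ` U i))"
      using U by (intro hausdorff_premeasure_le) (auto simp: diameter_isometry_image[OF iso] image_UN[symmetric])
    also have "\<dots> = (\<Sum>i. hausdorff_content k (U i))"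
      by (simp add: hausdorff_content_def diameter_isometry_image[OF iso] cong: if_cong)
    finally show "hausdorff_premeasure k \<delta> (f ` S) \<le> (\<Sum>i. hausdorff_content k (U i))" .
  qed
  then show ?thesis unfolding hausdorff_outer_def by (intro SUP_mono')
qed

lemma hausdorff_outer_orthogonal_image:
  fixes T :: "'a::euclidean_space \<Rightarrow> 'a"
  assumes T: "orthogonal_transformation T"
  shows "hausdorff_outer k (T ` S) = hausdorff_outer k S"
proof (rule antisym)
  have iso: "dist (f x) (f y) = dist x y" if "orthogonal_transformation f" for f :: "'a \<Rightarrow> 'a" and x y
    using that by (simp add: orthogonal_transformation_isometry)
  show "hausdorff_outer k (T ` S) \<le> hausdorff_outer k S"
    by (rule hausdorff_outer_isometry_le[OF iso[OF T]])
  have "hausdorff_outer k (inv T ` (T ` S)) \<le> hausdorff_outer k (T ` S)"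
    by (rule hausdorff_outer_isometry_le[OF iso[OF orthogonal_transformation_inv[OF T]]])
  then show "hausdorff_outer k S \<le> hausdorff_outer k (T ` S)"
    using orthogonal_transformation_inj[OF T] by (simp add: image_inv_f_f)
qed

text \<open>Along a coordinate axis k the sphere has the same shadow as the ball. Each set of a
  cover of the sphere is thickened to a box that spans [-1, 1] in direction k and has side twice the
  diameter in the other directions. These boxes cover the ball, so the sum of the contents is
  bounded below by its volume.\<close>

lemma hausdorff_outer_sphere_pos:
  assumes n: "CARD('n::finite) \<ge> 2"
  shows "0 < hausdorff_outer (CARD('n) - 1) (sphere 0 1 :: (real^'n) set)"
proof -
  define N where "N = CARD('n) - 1"
  define \<omega> where "\<omega> = unit_ball_vol (real N)"
  have \<omega>: "\<omega> > 0" by (simp add: \<omega>_def)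
  \<comment> \<open>The ratio of the box volume 2(2d)^N to the content \<omega>(d/2)^N of a set of
    diameter d.\<close>
  define K where "K = 2 * 4 ^ N / \<omega>"
  have K: "K > 0" using \<omega> by (simp add: K_def)
  obtain k :: 'n where True by auto
  have le: "emeasure lborel (ball 0 1 :: (real^'n) set)
      \<le> ennreal K * (\<Sum>i. hausdorff_content N (U i))"
    if U: "(sphere 0 1 :: (real^'n) set) \<subseteq> (\<Union>i. U i)" "\<forall>i. bounded (U i) \<and> diameter (U i) \<le> 1" for U
  proof -
    define c where "c i = (SOME x. x \<in> U i)" for i
    define d where "d i = diameter (U i)" for i
    have d0: "d i \<ge> 0" for i using U(2) by (simp add: d_def diameter_ge_0)
    have c: "dist (c i) x \<le> d i" if "x \<in> U i" for x i
      unfolding d_def using U(2) that by (intro diameter_bounded_bound) (auto simp: c_def intro: someI)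
    define B :: "nat \<Rightarrow> (real^'n) set" where
      "B i = (if U i = {} then {} else cbox (\<chi> j. if j = k then -1 else c i $ j - d i) (\<chi> j. if j = k then 1 else c i $ j + d i))" for i
    have "ball 0 1 \<subseteq> (\<Union>i. B i)"
    proof
      fix x :: "real^'n" assume x: "x \<in> ball 0 1"
      define r where "r = (\<Sum>j\<in>UNIV - {k}. (x $ j)\<^sup>2)"
      have nx: "(norm x)\<^sup>2 = (x $ k)\<^sup>2 + r"
        unfolding norm_vec_def L2_set_def r_def
        by (subst real_sqrt_pow2) (auto simp: sum_nonneg sum.remove[of UNIV k])
      have "(norm x)\<^sup>2 < 1" using x by (simp add: abs_square_less_1)
      then have r1: "r < 1" using nx zero_le_power2[of "x $ k"] by linarith
      \<comment> \<open>The point of the upper hemisphere above x; it differs from x in coordinate k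
        only, where the boxes impose nothing beyond [-1, 1].\<close>
      define s :: "real^'n" where "s = (\<chi> j. if j = k then sqrt (1 - r) else x $ j)"
      have "(norm s)\<^sup>2 = 1"
        unfolding norm_vec_def L2_set_def
        by (subst real_sqrt_pow2) (use r1 in \<open>auto simp: sum_nonneg sum.remove[of UNIV k] s_def r_def\<close>)
      then have "norm s = 1" using norm_ge_zero[of s] by (metis power2_eq_1_iff neg_0_le_iff_le not_one_le_zero)
      then have "s \<in> sphere 0 1" by simp
      then obtain i where i: "s \<in> U i" using U(1) by blast
      have "\<bar>c i $ j - s $ j\<bar> \<le> d i" for j
        using c[OF i] component_le_norm_cart[of "c i - s" j] by (simp add: dist_norm)
      moreover have "\<bar>x $ k\<bar> \<le> 1" using component_le_norm_cart[of x k] x by simp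
      ultimately have "x \<in> B i"
        using i by (auto simp: B_def mem_box_cart s_def abs_le_iff) (smt (verit))+
      then show "x \<in> (\<Union>i. B i)" by blast
    qed
    then have "emeasure lborel (ball 0 1 :: (real^'n) set) \<le> emeasure lborel (\<Union>i. B i)"
      by (intro emeasure_mono) (auto simp: B_def)
    also have "\<dots> \<le> (\<Sum>i. emeasure lborel (B i))"
      by (intro emeasure_subadditive_countably) (auto simp: B_def)
    also have "\<dots> \<le> (\<Sum>i. ennreal K * hausdorff_content N (U i))"
    proof (intro suminf_le allI)
      fix i
      show "emeasure lborel (B i) \<le> ennreal K * hausdorff_content N (U i)"
      proof (cases "U i = {}")
        case False
        let ?a = "(\<chi> j. if j = k then -1 else c i $ j - d i) :: real^'n"
        let ?b = "(\<chi> j. if j = k then 1 else c i $ j + d i) :: real^'n"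
        have ne: "cbox ?a ?b \<noteq> {}" using d0[of i] by (auto simp: interval_ne_empty_cart)
        have "measure lborel (cbox ?a ?b) = (\<Prod>j\<in>UNIV. ?b $ j - ?a $ j)"
          by (rule content_cbox_cart[OF ne])
        also have "\<dots> = 2 * (\<Prod>j\<in>UNIV - {k}. 2 * d i)"
          by (subst prod.remove[of UNIV k]) auto
        also have "\<dots> = 2 * (2 * d i) ^ N" by (simp add: N_def card_Diff_singleton)
        finally have "emeasure lborel (B i) = ennreal (2 * (2 * d i) ^ N)"
          using False emeasure_lborel_cbox_finite[of ?a ?b]
          by (simp add: B_def emeasure_eq_ennreal_measure less_top)
        also have "2 * (2 * d i) ^ N = K * (\<omega> * (d i / 2) ^ N)"
        proof -
          have *: "(2 * d i) ^ N = 4 ^ N * (d i / 2) ^ N"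
            unfolding power_mult_distrib[symmetric] by simp
          show ?thesis unfolding * K_def using \<omega> by simp
        qed
        also have "ennreal \<dots> = ennreal K * hausdorff_content N (U i)"
          using False \<omega> K d0[of i] by (subst ennreal_mult) (auto simp: hausdorff_content_def \<omega>_def d_def)
        finally show ?thesis by simp
      qed (simp add: B_def)
    qed auto
    finally show ?thesis by simp
  qed
  have "emeasure lborel (ball 0 1 :: (real^'n) set) / ennreal K
      \<le> hausdorff_premeasure N 1 (sphere 0 1 :: (real^'n) set)"
    unfolding hausdorff_premeasure_def
  proof (rule Inf_greatest, elim CollectE exE conjE, hypsubst)
    fix U :: "nat \<Rightarrow> (real^'n) set"
    assume "sphere 0 1 \<subseteq> (\<Union>i. U i)" "\<forall>i. bounded (U i) \<and> diameter (U i) \<le> 1"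
    from le[OF this] show "emeasure lborel (ball 0 1 :: (real^'n) set) / ennreal K
        \<le> (\<Sum>i. hausdorff_content N (U i))"
      using K by (intro divide_le_posI_ennreal) simp_all
  qed
  also have "\<dots> \<le> hausdorff_outer N (sphere 0 1 :: (real^'n) set)"
    by (rule hausdorff_premeasure_le_outer) simp
  finally have le': "emeasure lborel (ball 0 1 :: (real^'n) set) / ennreal K
      \<le> hausdorff_outer N (sphere 0 1 :: (real^'n) set)" .
  have "emeasure lborel (ball 0 1 :: (real^'n) set) = ennreal (unit_ball_vol (CARD('n)))"
    using emeasure_ball[of 1 "0::real^'n"] by simp
  then have "emeasure lborel (ball 0 1 :: (real^'n) set) > 0"
    by simp
  then have "0 < emeasure lborel (ball 0 1 :: (real^'n) set) / ennreal K"
    unfolding ennreal_zero_less_divide by simp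
  with le' show ?thesis unfolding N_def by simp
qed

text \<open>Serves to bound the volume of a thin spherical shell linearly in its thickness a -
  b.\<close>

lemma power_diff_le_mult:
  fixes a b :: real
  assumes "0 \<le> b" "b \<le> a" "a \<le> 2"
  shows "a ^ n - b ^ n \<le> n * (a - b) * 2 ^ n"
proof (induction n)
  case (Suc n)
  have "a ^ Suc n - b ^ Suc n = a * (a ^ n - b ^ n) + b ^ n * (a - b)" by (simp add: algebra_simps)
  also have "\<dots> \<le> 2 * (n * (a - b) * 2 ^ n) + 2 ^ n * (a - b)"
  proof (intro add_mono mult_right_mono)
    have "a * (a ^ n - b ^ n) \<le> 2 * (a ^ n - b ^ n)"
      using assms by (intro mult_right_mono) (auto intro: power_mono)
    also have "\<dots> \<le> 2 * (n * (a - b) * 2 ^ n)" using Suc by simp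
    finally show "a * (a ^ n - b ^ n) \<le> 2 * (n * (a - b) * 2 ^ n)" .
  qed (use assms in \<open>auto intro: power_mono\<close>)
  also have "\<dots> \<le> 2 * (n * (a - b) * 2 ^ n) + 2 * 2 ^ n * (a - b)"
    using assms by simp
  also have "\<dots> = Suc n * (a - b) * 2 ^ Suc n" by (simp add: algebra_simps)
  finally show ?case .
qed simp

text \<open>Packing by volume: the balls of radius e/2 about the points of T are disjoint and lie in
  a shell of thickness e around the sphere. The shell has volume O(e) and each ball a multiple of
  e^n, which leaves the exponent n - 1.\<close>

lemma card_separated_sphere_le:
  fixes T :: "'a::euclidean_space set"
  assumes e: "0 < e" "e \<le> 1" and T: "finite T" "T \<subseteq> sphere 0 1"
    and sep: "\<And>x y. x \<in> T \<Longrightarrow> y \<in> T \<Longrightarrow> x \<noteq> y \<Longrightarrow> e \<le> dist x y"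
  shows "real (card T) * e ^ (DIM('a) - 1) \<le> DIM('a) * 4 ^ DIM('a)"
proof -
  have fin: "emeasure lborel (ball (x::'a) r) < top" for x r
    using emeasure_lborel_ball_finite[of x r] by (simp only: infinity_ennreal_def)
  let ?n = "DIM('a)" and ?\<omega> = "unit_ball_vol (real DIM('a))"
  have "(\<Union>t\<in>T. ball t (e/2)) \<inter> ball 0 (1 - e/2) = {}"
  proof -
    have False if "t \<in> T" "dist t x < e/2" "dist 0 x < 1 - e/2" for t x
    proof -
      have "dist 0 t = 1" using that(1) T(2) by auto
      with that show False using dist_triangle[of 0 t x] by (simp add: dist_commute)
    qed
    then show ?thesis by auto
  qed
  moreover have "(\<Union>t\<in>T. ball t (e/2)) \<subseteq> ball 0 (1 + e/2)"
  proof -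
    have "dist 0 x < 1 + e/2" if "t \<in> T" "dist t x < e/2" for t x
    proof -
      have "dist 0 t = 1" using that(1) T(2) by auto
      with that show ?thesis using dist_triangle[of 0 x t] by (simp add: dist_commute)
    qed
    then show ?thesis by auto
  qed
  moreover have "ball (0::'a) (1 - e/2) \<subseteq> ball 0 (1 + e/2)" using e by (intro subset_ball) simp
  ultimately have "(\<Union>t\<in>T. ball t (e/2)) \<subseteq> ball 0 (1 + e/2) - ball 0 (1 - e/2)" by blast
  then have "measure lborel (\<Union>t\<in>T. ball t (e/2)) \<le> measure lborel (ball (0::'a) (1 + e/2) - ball 0 (1 - e/2))"
    by (intro measure_mono_fmeasurable fmeasurable.Diff) (auto simp: fmeasurable_def fin intro!: sets.finite_UN T)
  also have "\<dots> = measure lborel (ball (0::'a) (1 + e/2)) - measure lborel (ball (0::'a) (1 - e/2))"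
    using e by (intro measure_Diff) (auto simp: less_imp_neq[OF fin] intro!: subset_ball)
  also have "\<dots> = ?\<omega> * ((1 + e/2) ^ ?n - (1 - e/2) ^ ?n)"
    using e by (simp add: content_ball algebra_simps)
  also have "\<dots> \<le> ?\<omega> * (?n * e * 2 ^ ?n)"
    using power_diff_le_mult[of "1 - e/2" "1 + e/2" ?n] e by (intro mult_left_mono) auto
  finally have "measure lborel (\<Union>t\<in>T. ball t (e/2)) \<le> ?\<omega> * (?n * e * 2 ^ ?n)" .
  moreover have "measure lborel (\<Union>t\<in>T. ball t (e/2)) = (\<Sum>t\<in>T. measure lborel (ball t (e/2)))"
  proof (rule measure_finite_Union[OF T(1)])
    show "disjoint_family_on (\<lambda>t. ball t (e/2)) T"
    proof -
      have False if "x \<in> T" "y \<in> T" "x \<noteq> y" "dist x z < e/2" "dist y z < e/2" for x y z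
        using sep[OF that(1-3)] that(4,5) dist_triangle[of x y z] by (simp add: dist_commute)
      then show ?thesis by (auto simp: disjoint_family_on_def)
    qed
  qed (auto simp: less_imp_neq[OF fin])
  moreover have "\<dots> = card T * (?\<omega> * (e/2) ^ ?n)"
    using e by (simp add: content_ball)
  ultimately have "?\<omega> * (card T * (e/2) ^ ?n) \<le> ?\<omega> * (?n * e * 2 ^ ?n)"
    by (simp add: algebra_simps)
  then have "card T * (e/2) ^ ?n \<le> ?n * e * 2 ^ ?n" by simp
  then have "card T * e ^ ?n \<le> ?n * e * (2 ^ ?n * 2 ^ ?n)"
    by (simp add: power_divide field_simps)
  moreover have "e ^ ?n = e * e ^ (?n - 1)" by (simp add: power_eq_if)
  ultimately have "e * (card T * e ^ (?n - 1)) \<le> e * (?n * (2 ^ ?n * 2 ^ ?n))"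
    by (simp add: algebra_simps)
  then show ?thesis using e by (simp flip: power_mult_distrib)
qed

text \<open>An e-separated subset of the sphere with the most points is an e-net, so closed balls of
  radius e about it cover the sphere; the packing bound makes the sum of their contents bounded
  independently of the scale.\<close>

lemma hausdorff_outer_sphere_finite:
  "hausdorff_outer (DIM('a) - 1) (sphere 0 1 :: 'a::euclidean_space set) < top"
proof -
  define N where "N = DIM('a) - 1"
  define C where "C = unit_ball_vol (real N) * (DIM('a) * 4 ^ DIM('a))"
  have "hausdorff_premeasure N \<delta> (sphere 0 1 :: 'a set) \<le> ennreal C" if \<delta>: "\<delta> > 0" for \<delta>
  proof -
    \<comment> \<open>A ball of radius e must have diameter at most \<delta>, and the packing bound
      asks for e \<le> 1.\<close>
    define e where "e = min 1 (\<delta>/2)"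
    have e: "0 < e" "e \<le> 1" "2 * e \<le> \<delta>" using \<delta> by (auto simp: e_def)
    define sep where "sep T \<longleftrightarrow> finite T \<and> T \<subseteq> sphere 0 1 \<and> (\<forall>x\<in>T. \<forall>y\<in>T. x \<noteq> y \<longrightarrow> e \<le> dist x y)"
      for T :: "'a set"
    have bd: "real (card T) * e ^ N \<le> DIM('a) * 4 ^ DIM('a)" if "sep T" for T
      unfolding N_def by (rule card_separated_sphere_le) (use that e in \<open>auto simp: sep_def\<close>)
    have "sep {}" by (simp add: sep_def)
    moreover have "\<forall>T. sep T \<longrightarrow> card T < nat \<lceil>DIM('a) * 4 ^ DIM('a) / e ^ N\<rceil> + 1"
    proof (intro allI impI)
      fix T assume "sep T"
      then have "real (card T) \<le> DIM('a) * 4 ^ DIM('a) / e ^ N"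
        using bd[of T] e by (simp add: pos_le_divide_eq)
      then show "card T < nat \<lceil>DIM('a) * 4 ^ DIM('a) / e ^ N\<rceil> + 1" by linarith
    qed
    ultimately obtain T where T: "sep T" and max: "\<And>T'. sep T' \<Longrightarrow> card T' \<le> card T"
      using ex_has_greatest_nat[of sep "{}" card] by blast
    have cover: "\<exists>t\<in>T. dist t x < e" if x: "x \<in> sphere 0 1" for x
    proof (rule ccontr)
      assume *: "\<not> ?thesis"
      then have "x \<notin> T" using e by force
      moreover have "sep (insert x T)"
        using T x * by (auto simp: sep_def dist_commute not_less)
      ultimately show False using max[of "insert x T"] T by (simp add: sep_def)
    qed
    have fT: "finite T" using T by (simp add: sep_def)
    obtain h where h: "bij_betw h {..<card T} T" using fT ex_bij_betw_nat_finite[of T] by (auto simp: atLeast0LessThan)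
    define U where "U i = (if i < card T then cball (h i) e else {})" for i
    have "hausdorff_premeasure N \<delta> (sphere 0 1 :: 'a set) \<le> (\<Sum>i. hausdorff_content N (U i))"
    proof (rule hausdorff_premeasure_le)
      show "sphere 0 1 \<subseteq> (\<Union>i. U i)"
      proof
        fix x :: 'a assume "x \<in> sphere 0 1"
        then obtain t where t: "t \<in> T" "dist t x < e" using cover by blast
        then obtain i where "i < card T" "h i = t" using h unfolding bij_betw_def by (metis imageE lessThan_iff)
        then have "x \<in> U i" using t by (simp add: U_def)
        then show "x \<in> (\<Union>i. U i)" by blast
      qed
    qed (use e in \<open>auto simp: U_def\<close>)
    also have "\<dots> = (\<Sum>i<card T. hausdorff_content N (U i))"
      by (rule suminf_finite) (auto simp: U_def hausdorff_content_def)
    also have "\<dots> = (\<Sum>i<card T. ennreal (unit_ball_vol (real N) * e ^ N))"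
      using e by (intro sum.cong) (auto simp: U_def hausdorff_content_def)
    also have "\<dots> = ennreal (unit_ball_vol (real N) * (card T * e ^ N))"
      using e by (subst sum_ennreal) (auto simp: algebra_simps)
    also have "\<dots> \<le> ennreal C"
      unfolding C_def by (intro ennreal_leI mult_left_mono bd T) auto
    finally show ?thesis .
  qed
  then have "hausdorff_outer N (sphere 0 1 :: 'a set) \<le> ennreal C"
    unfolding hausdorff_outer_def by (intro SUP_least) auto
  then show ?thesis unfolding N_def using ennreal_less_top le_less_trans by blast
qed

text \<open>As a measure on the sphere alone it is finite, hence eligible for Fubini, and the set
  integrals of \<open>john_fundamental_solution\<close> become plain integrals against it.\<close>

definition sphere_measure :: "(real^'n::finite) measure" where
  "sphere_measure = restrict_space (hausdorff_measure (CARD('n) - 1)) (sphere 0 1)"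

lemma space_sphere_measure [simp]: "space sphere_measure = sphere 0 1"
  by (simp add: sphere_measure_def space_restrict_space)

lemma sets_sphere_measure [measurable_cong]:
  "sets sphere_measure = sets (restrict_space borel (sphere 0 1))"
  unfolding sphere_measure_def by (rule sets_restrict_space_cong) simp

lemma emeasure_sphere_measure:
  fixes A :: "(real^'n::finite) set"
  assumes "A \<in> sets sphere_measure"
  shows "emeasure sphere_measure A = hausdorff_outer (CARD('n) - 1) A"
proof -
  have "A \<in> sets borel" "A \<subseteq> sphere 0 1"
    using assms by (auto simp: sets_sphere_measure sets_restrict_space_iff)
  then show ?thesis
    by (simp add: sphere_measure_def emeasure_restrict_space emeasure_hausdorff_measure)
qed

lemma emeasure_sphere_measure_pos:
  assumes "CARD('n::finite) \<ge> 2"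
  shows "0 < emeasure sphere_measure (space (sphere_measure :: (real^'n) measure))"
proof -
  have *: "emeasure sphere_measure (space (sphere_measure :: (real^'n) measure)) =
      hausdorff_outer (CARD('n) - 1) (sphere 0 1 :: (real^'n) set)"
    using emeasure_sphere_measure[OF sets.top, where 'n='n] by simp
  show "0 < emeasure sphere_measure (space (sphere_measure :: (real^'n) measure))"
    unfolding * by (rule hausdorff_outer_sphere_pos[OF assms])
qed

lemma finite_measure_sphere_measure:
  "finite_measure (sphere_measure :: (real^'n::finite) measure)"
proof (rule finite_measureI)
  have "emeasure sphere_measure (space (sphere_measure :: (real^'n) measure)) =
      hausdorff_outer (CARD('n) - 1) (sphere 0 1 :: (real^'n) set)"
    using emeasure_sphere_measure[OF sets.top, where 'n='n] by simp
  also have "\<dots> < top"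
    using hausdorff_outer_sphere_finite[where 'a="real^'n"] by simp
  finally show "emeasure sphere_measure (space (sphere_measure :: (real^'n) measure)) \<noteq> \<infinity>"
    by simp
qed

lemma measurable_orthogonal_sphere_measure:
  fixes T :: "real^'n::finite \<Rightarrow> real^'n"
  assumes T: "orthogonal_transformation T"
  shows "T \<in> sphere_measure \<rightarrow>\<^sub>M sphere_measure"
proof -
  have "T \<in> borel \<rightarrow>\<^sub>M borel"
    using orthogonal_transformation_linear[OF T]
    by (intro borel_measurable_continuous_onI linear_continuous_on) (simp add: linear_conv_bounded_linear)
  then have "T \<in> restrict_space borel (sphere 0 1) \<rightarrow>\<^sub>M restrict_space borel (sphere 0 1)"
    using T by (intro measurable_restrict_space3) (auto simp: orthogonal_transformation_norm)
  then show ?thesis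
    using measurable_cong_sets[OF sets_sphere_measure sets_sphere_measure] by blast
qed

lemma distr_orthogonal_sphere_measure:
  fixes T :: "real^'n::finite \<Rightarrow> real^'n"
  assumes T: "orthogonal_transformation T"
  shows "distr sphere_measure sphere_measure T = sphere_measure"
proof (rule measure_eqI)
  fix A assume "A \<in> sets (distr sphere_measure sphere_measure T)"
  then have A: "A \<in> sets sphere_measure" by simp
  then have As: "A \<subseteq> sphere 0 1" using sets.sets_into_space by fastforce
  have eq: "T ` (T -` A \<inter> sphere 0 1) = A"
  proof -
    have "\<exists>x. x \<in> sphere 0 1 \<and> y = T x" if "y \<in> A" for y
    proof -
      obtain x where x: "y = T x" using orthogonal_transformation_surj[OF T] by (metis surjD)
      then have "norm x = 1" using that As orthogonal_transformation_norm[OF T, of x] by auto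
      then show ?thesis using x by auto
    qed
    then show ?thesis by blast
  qed
  have m: "T -` A \<inter> space sphere_measure \<in> sets sphere_measure"
    by (rule measurable_sets[OF measurable_orthogonal_sphere_measure[OF T] A])
  have "emeasure (distr sphere_measure sphere_measure T) A = emeasure sphere_measure (T -` A \<inter> space sphere_measure)"
    by (rule emeasure_distr[OF measurable_orthogonal_sphere_measure[OF T] A])
  also have "\<dots> = hausdorff_outer (CARD('n) - 1) (T -` A \<inter> space sphere_measure)"
    by (rule emeasure_sphere_measure[OF m])
  also have "\<dots> = hausdorff_outer (CARD('n) - 1) (T ` (T -` A \<inter> space sphere_measure))"
    by (rule hausdorff_outer_orthogonal_image[OF T, symmetric])
  also have "\<dots> = emeasure sphere_measure A"
    using eq by (simp add: emeasure_sphere_measure[OF A])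
  finally show "emeasure (distr sphere_measure sphere_measure T) A = emeasure sphere_measure A" .
qed simp

section \<open>Smoothness with a parameter\<close>

text \<open>C^k in z with all derivatives jointly continuous in z and the parameter. Joint
  continuity yields bounds that are uniform over a compact parameter set. Existence of the line
  derivatives is demanded explicitly, as \<open>partial\<close> has a value even where there is
  none.\<close>

primrec param_smooth ::
  "nat \<Rightarrow> (real^'n::finite) set \<Rightarrow> 'p::metric_space set \<Rightarrow> (real^'n \<Rightarrow> 'p \<Rightarrow> real) \<Rightarrow> bool" where
  "param_smooth 0 U P g \<longleftrightarrow> continuous_on (U \<times> P) (\<lambda>(z, p). g z p)"
| "param_smooth (Suc k) U P g \<longleftrightarrow> continuous_on (U \<times> P) (\<lambda>(z, p). g z p) \<and>
     (\<forall>i. (\<forall>z\<in>U. \<forall>p\<in>P. ((\<lambda>t. g (z + t *\<^sub>R axis i 1) p) has_real_derivative partial i (\<lambda>z. g z p) z) (at 0)) \<and>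
          param_smooth k U P (\<lambda>z p. partial i (\<lambda>z. g z p) z))"

lemma param_smooth_continuous: "param_smooth k U P g \<Longrightarrow> continuous_on (U \<times> P) (\<lambda>(z, p). g z p)"
  by (cases k) auto

lemma eventually_line_in_open:
  assumes "open U" "(z::real^'n) \<in> U"
  shows "\<forall>\<^sub>F t in nhds 0. z + t *\<^sub>R axis i 1 \<in> U"
proof -
  have "((\<lambda>t. z + t *\<^sub>R axis i 1) \<longlongrightarrow> z + 0 *\<^sub>R axis i 1) (nhds (0::real))"
    by (intro tendsto_intros filterlim_ident)
  then show ?thesis using topological_tendstoD[of _ z "nhds 0" U] assms by simp
qed

lemma partial_eqI:
  "((\<lambda>t. f (z + t *\<^sub>R axis i 1)) has_real_derivative D) (at 0) \<Longrightarrow> partial i f z = D"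
  by (simp add: partial_def DERIV_imp_deriv)

lemma line_derivative_cong:
  assumes "open U" "(z::real^'n) \<in> U" "\<And>z. z \<in> U \<Longrightarrow> f z = g z"
  shows "((\<lambda>t. f (z + t *\<^sub>R axis i 1)) has_real_derivative D) (at 0) \<longleftrightarrow>
         ((\<lambda>t. g (z + t *\<^sub>R axis i 1)) has_real_derivative D) (at 0)"
  by (rule DERIV_cong_ev[OF refl _ refl])
    (rule eventually_mono[OF eventually_line_in_open[OF assms(1,2)]], use assms(3) in auto)

lemma partial_cong:
  assumes "open U" "z \<in> U" "\<And>z. z \<in> U \<Longrightarrow> f z = g z"
  shows "partial i f z = partial i g z"
  unfolding partial_def
  by (rule deriv_cong_ev[OF _ refl])
    (rule eventually_mono[OF eventually_line_in_open[OF assms(1,2)]], use assms(3) in auto)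

lemma param_smooth_cong_imp:
  assumes "open U" "\<And>z p. z \<in> U \<Longrightarrow> p \<in> P \<Longrightarrow> f z p = g z p" "param_smooth k U P f"
  shows "param_smooth k U P g"
  using assms(2,3)
proof (induction k arbitrary: f g)
  case 0
  then show ?case
    by simp (subst continuous_on_cong[of "U \<times> P" "U \<times> P" _ "\<lambda>(z, p). f z p"], auto)
next
  case (Suc k)
  have eq: "partial i (\<lambda>z. f z p) z = partial i (\<lambda>z. g z p) z" if "z \<in> U" "p \<in> P" for i z p
    using that Suc.prems(1) by (intro partial_cong[OF assms(1)]) auto
  have "continuous_on (U \<times> P) (\<lambda>(z, p). g z p)"
    using Suc.prems by (subst continuous_on_cong[of "U \<times> P" "U \<times> P" _ "\<lambda>(z, p). f z p"]) auto
  moreover have "((\<lambda>t. g (z + t *\<^sub>R axis i 1) p) has_real_derivative partial i (\<lambda>z. g z p) z) (at 0)"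
    if "z \<in> U" "p \<in> P" for i z p
  proof -
    have "((\<lambda>t. f (z + t *\<^sub>R axis i 1) p) has_real_derivative partial i (\<lambda>z. f z p) z) (at 0)"
      using Suc.prems(2) that by auto
    then show ?thesis
      using line_derivative_cong[OF assms(1) that(1), of "\<lambda>z. f z p" "\<lambda>z. g z p"] Suc.prems(1) that
      by (simp add: eq)
  qed
  moreover have "param_smooth k U P (\<lambda>z p. partial i (\<lambda>z. g z p) z)" for i
    by (rule Suc.IH[OF eq]) (use Suc.prems in auto)
  ultimately show ?case by simp
qed

text \<open>Allows the derivative to be given by a formula g' in place of \<open>partial\<close>;
  the two agree on U, and openness of U carries this over to higher derivatives.\<close>

lemma param_smooth_SucI:
  assumes "open U" "continuous_on (U \<times> P) (\<lambda>(z, p). g z p)"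
    and D: "\<And>i z p. z \<in> U \<Longrightarrow> p \<in> P \<Longrightarrow> ((\<lambda>t. g (z + t *\<^sub>R axis i 1) p) has_real_derivative g' i z p) (at 0)"
    and "\<And>i. param_smooth k U P (g' i)"
  shows "param_smooth (Suc k) U P g"
proof -
  have eq: "g' i z p = partial i (\<lambda>z. g z p) z" if "z \<in> U" "p \<in> P" for i z p
    using partial_eqI[OF D[OF that]] by simp
  have "param_smooth k U P (\<lambda>z p. partial i (\<lambda>z. g z p) z)" for i
    by (rule param_smooth_cong_imp[OF assms(1) eq assms(4)])
  then show ?thesis using assms(2) D eq by simp
qed

lemma param_smooth_SucD: "param_smooth (Suc k) U P g \<Longrightarrow> param_smooth k U P g"
  by (induction k arbitrary: g) auto

lemma param_smooth_mono: "param_smooth k U P g \<Longrightarrow> j \<le> k \<Longrightarrow> param_smooth j U P g"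
proof (induction k)
  case (Suc k)
  show ?case
  proof (cases "j = Suc k")
    case False
    then show ?thesis using Suc.IH[OF param_smooth_SucD[OF Suc.prems(1)]] Suc.prems(2) by simp
  qed (use Suc.prems in simp)
qed simp

lemma param_smooth_subset:
  "param_smooth k U P g \<Longrightarrow> V \<subseteq> U \<Longrightarrow> R \<subseteq> P \<Longrightarrow> param_smooth k V R g"
proof (induction k arbitrary: g)
  case 0
  then show ?case using continuous_on_subset[of "U \<times> P" _ "V \<times> R"] by (auto simp: Sigma_mono)
next
  case (Suc k)
  then have "continuous_on (V \<times> R) (\<lambda>(z, p). g z p)"
    using continuous_on_subset[of "U \<times> P" _ "V \<times> R"] by (auto simp: Sigma_mono)
  moreover have "((\<lambda>t. g (z + t *\<^sub>R axis i 1) p) has_real_derivative partial i (\<lambda>z. g z p) z) (at 0)"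
    if "z \<in> V" "p \<in> R" for i z p
    using Suc.prems that by (simp add: subset_iff)
  moreover have "param_smooth k V R (\<lambda>z p. partial i (\<lambda>z. g z p) z)" for i
    using Suc by simp
  ultimately show ?case by simp
qed

lemma param_smooth_param:
  fixes h :: "'p::metric_space \<Rightarrow> real"
  assumes "open U" "continuous_on P h"
  shows "param_smooth k U P (\<lambda>z. h)"
proof -
  have c: "continuous_on (U \<times> P) (\<lambda>(z, p). h p)" if "continuous_on P h" for h
    using continuous_on_compose2[OF that continuous_on_snd[OF continuous_on_id], of "U \<times> P"]
    by (auto simp: split_def)
  have "param_smooth k U P (\<lambda>z p. h p)" using assms(2)
  proof (induction k arbitrary: h)
    case (Suc k)
    show ?case
      by (rule param_smooth_SucI[OF assms(1) c, where g'="\<lambda>i z p. 0"])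
        (use Suc in auto)
  qed (simp add: c)
  then show ?thesis by simp
qed

lemma param_smooth_const: "open U \<Longrightarrow> param_smooth k U P (\<lambda>z p. c)"
  by (rule param_smooth_param) auto

lemma param_smooth_component:
  assumes "open U"
  shows "param_smooth k U P (\<lambda>z p. z $ j)"
proof (cases k)
  case (Suc l)
  have "((\<lambda>t. (z + t *\<^sub>R axis i 1) $ j) has_real_derivative (if i = j then 1 else 0)) (at 0)"
    for i and z :: "real^'a"
    by (auto simp: axis_def intro!: derivative_eq_intros)
  then show ?thesis unfolding Suc
    by (intro param_smooth_SucI[OF assms, where g'="\<lambda>i z p. if i = j then 1 else 0"]
        param_smooth_const assms)
      (auto simp: split_def intro!: continuous_intros)
qed (auto simp: split_def intro!: continuous_intros)

lemma param_smooth_add: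
  assumes U: "open U"
  shows "param_smooth k U P f \<Longrightarrow> param_smooth k U P g \<Longrightarrow> param_smooth k U P (\<lambda>z p. f z p + g z p)"
proof (induction k arbitrary: f g)
  case 0
  then show ?case by (auto simp: split_def intro!: continuous_intros)
next
  case (Suc k)
  show ?case
  proof (rule param_smooth_SucI[OF U, where g'="\<lambda>i z p. partial i (\<lambda>z. f z p) z + partial i (\<lambda>z. g z p) z"])
    show "continuous_on (U \<times> P) (\<lambda>(z, p). f z p + g z p)"
      using Suc.prems by (auto simp: split_def intro!: continuous_intros)
  qed (use Suc in \<open>auto intro!: DERIV_add\<close>)
qed

lemma param_smooth_mult:
  assumes U: "open U"
  shows "param_smooth k U P f \<Longrightarrow> param_smooth k U P g \<Longrightarrow> param_smooth k U P (\<lambda>z p. f z p * g z p)"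
proof (induction k arbitrary: f g)
  case 0
  then show ?case by (auto simp: split_def intro!: continuous_intros)
next
  case (Suc k)
  show ?case
  proof (rule param_smooth_SucI[OF U, where g'="\<lambda>i z p. partial i (\<lambda>z. f z p) z * g z p + partial i (\<lambda>z. g z p) z * f z p"])
    show "continuous_on (U \<times> P) (\<lambda>(z, p). f z p * g z p)"
      using Suc.prems by (auto simp: split_def intro!: continuous_intros)
    show "((\<lambda>t. f (z + t *\<^sub>R axis i 1) p * g (z + t *\<^sub>R axis i 1) p) has_real_derivative
        partial i (\<lambda>z. f z p) z * g z p + partial i (\<lambda>z. g z p) z * f z p) (at 0)"
      if "z \<in> U" "p \<in> P" for i z p
      using DERIV_mult[of "\<lambda>t. f (z + t *\<^sub>R axis i 1) p" _ 0 UNIV "\<lambda>t. g (z + t *\<^sub>R axis i 1) p"] Suc.prems that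
      by simp
    show "param_smooth k U P (\<lambda>z p. partial i (\<lambda>z. f z p) z * g z p + partial i (\<lambda>z. g z p) z * f z p)" for i
      using Suc.prems param_smooth_SucD[OF Suc.prems(1)] param_smooth_SucD[OF Suc.prems(2)]
      by (intro param_smooth_add[OF U] Suc.IH) auto
  qed
qed

lemma param_smooth_cmult:
  "open U \<Longrightarrow> param_smooth k U P f \<Longrightarrow> param_smooth k U P (\<lambda>z p. c * f z p)"
  by (intro param_smooth_mult param_smooth_const)

lemma param_smooth_uminus:
  "open U \<Longrightarrow> param_smooth k U P f \<Longrightarrow> param_smooth k U P (\<lambda>z p. - f z p)"
  using param_smooth_cmult[of U k P f "-1"] by simp

lemma param_smooth_diff:
  "open U \<Longrightarrow> param_smooth k U P f \<Longrightarrow> param_smooth k U P g \<Longrightarrow> param_smooth k U P (\<lambda>z p. f z p - g z p)"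
  using param_smooth_add[of U k P f "\<lambda>z p. - g z p"] param_smooth_uminus[of U k P g] by simp

lemma param_smooth_sum:
  "open U \<Longrightarrow> (\<And>a. a \<in> A \<Longrightarrow> param_smooth k U P (f a)) \<Longrightarrow> param_smooth k U P (\<lambda>z p. \<Sum>a\<in>A. f a z p)"
  by (induction A rule: infinite_finite_induct) (simp_all add: param_smooth_const param_smooth_add)

lemma param_smooth_prod_list:
  "open U \<Longrightarrow> (\<And>a. param_smooth k U P (f a)) \<Longrightarrow> param_smooth k U P (\<lambda>z p. \<Prod>a\<leftarrow>as. f a z p)"
  by (induction as) (simp_all add: param_smooth_const param_smooth_mult)

text \<open>The sequence q lists q 0 and its successive derivatives on I. By the chain rule one
  derivative leads to the composition with q 1, to which the induction hypothesis applies for the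
  shifted sequence.\<close>

lemma param_smooth_compose:
  assumes U: "open U" and I: "\<And>z p. z \<in> U \<Longrightarrow> p \<in> P \<Longrightarrow> f z p \<in> I"
  shows "param_smooth k U P f \<Longrightarrow>
    (\<And>j x. j < k \<Longrightarrow> x \<in> I \<Longrightarrow> (q j has_real_derivative q (Suc j) x) (at x)) \<Longrightarrow>
    (\<And>j. j \<le> k \<Longrightarrow> continuous_on I (q j)) \<Longrightarrow>
    param_smooth k U P (\<lambda>z p. q 0 (f z p))"
proof (induction k arbitrary: q)
  case 0
  then have "continuous_on I (q 0)" "continuous_on (U \<times> P) (\<lambda>(z, p). f z p)" by auto
  then have "continuous_on (U \<times> P) (\<lambda>zp. q 0 (case zp of (z, p) \<Rightarrow> f z p))"
    by (rule continuous_on_compose2) (use I in auto)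
  then show ?case by (simp add: split_def)
next
  case (Suc k)
  have c: "continuous_on I (q 0)" "continuous_on (U \<times> P) (\<lambda>(z, p). f z p)"
    using Suc.prems(1,3) by auto
  show ?case
  proof (rule param_smooth_SucI[OF U, where g'="\<lambda>i z p. q (Suc 0) (f z p) * partial i (\<lambda>z. f z p) z"])
    have "continuous_on (U \<times> P) (\<lambda>zp. q 0 (case zp of (z, p) \<Rightarrow> f z p))"
      using c by (rule continuous_on_compose2) (use I in auto)
    then show "continuous_on (U \<times> P) (\<lambda>(z, p). q 0 (f z p))" by (simp add: split_def)
    show "((\<lambda>t. q 0 (f (z + t *\<^sub>R axis i 1) p)) has_real_derivative
        q (Suc 0) (f z p) * partial i (\<lambda>z. f z p) z) (at 0)" if "z \<in> U" "p \<in> P" for i z p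
      by (rule DERIV_chain2[of "q 0" _ "\<lambda>t. f (z + t *\<^sub>R axis i 1) p"])
        (use that Suc.prems(1,2) I in auto)
    have "param_smooth k U P (\<lambda>z p. (\<lambda>j. q (Suc j)) 0 (f z p))"
      by (rule Suc.IH) (use param_smooth_SucD[OF Suc.prems(1)] Suc.prems(2,3) in auto)
    then show "param_smooth k U P (\<lambda>z p. q (Suc 0) (f z p) * partial i (\<lambda>z. f z p) z)" for i
      using Suc.prems(1) by (intro param_smooth_mult[OF U]) auto
  qed
qed

lemma has_real_derivative_powr_iter:
  fixes x a :: real
  assumes "x > 0"
  shows "((\<lambda>x. (\<Prod>i<j. a - real i) * x powr (a - real j)) has_real_derivative
    (\<Prod>i<Suc j. a - real i) * x powr (a - real (Suc j))) (at x)"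
proof -
  have "((\<lambda>x. (\<Prod>i<j. a - real i) * x powr (a - real j)) has_real_derivative
      (\<Prod>i<j. a - real i) * ((a - real j) * x powr (a - real j - 1))) (at x)"
    using assms by (intro DERIV_cmult has_real_derivative_powr)
  then show ?thesis by (simp add: algebra_simps)
qed

lemma param_smooth_powr:
  assumes U: "open U" and f: "param_smooth k U P f" and pos: "\<And>z p. z \<in> U \<Longrightarrow> p \<in> P \<Longrightarrow> f z p > 0"
  shows "param_smooth k U P (\<lambda>z p. f z p powr a)"
proof -
  let ?q = "\<lambda>j x. (\<Prod>i<j. a - real i) * x powr (a - real j)"
  have "param_smooth k U P (\<lambda>z p. ?q 0 (f z p))"
  proof (rule param_smooth_compose[OF U _ f, where I="{0<..}"])
    show "(?q j has_real_derivative ?q (Suc j) x) (at x)" if "x \<in> {0<..}" for j x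
      using that by (intro has_real_derivative_powr_iter) auto
  qed (use pos in \<open>auto intro!: continuous_intros\<close>)
  then show ?thesis by simp
qed

lemma param_smooth_ln:
  assumes U: "open U" and f: "param_smooth k U P f" and pos: "\<And>z p. z \<in> U \<Longrightarrow> p \<in> P \<Longrightarrow> f z p > 0"
  shows "param_smooth k U P (\<lambda>z p. ln (f z p))"
proof -
  \<comment> \<open>From order 1 on, the derivatives of ln are those of x powr (-1).\<close>
  let ?q = "\<lambda>j x. case j of 0 \<Rightarrow> ln x | Suc l \<Rightarrow> (\<Prod>i<l. (-1::real) - real i) * x powr (-1 - real l)"
  have "param_smooth k U P (\<lambda>z p. ?q 0 (f z p))"
  proof (rule param_smooth_compose[OF U _ f, where I="{0<..}"])
    show "(?q j has_real_derivative ?q (Suc j) x) (at x)" if "x \<in> {0<..}" for j x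
    proof (cases j)
      case 0
      then show ?thesis using that by (auto intro!: derivative_eq_intros simp: powr_minus_divide)
    next
      case (Suc l)
      then show ?thesis using that has_real_derivative_powr_iter[of x "-1" l] by simp
    qed
    show "continuous_on {0<..} (?q j)" for j
      by (cases j) (auto intro!: continuous_intros)
  qed (use pos in auto)
  then show ?thesis by simp
qed

text \<open>A one-point parameter set, so that the closure properties of \<open>param_smooth\<close>
  need no second proof.\<close>

abbreviation smooth_on :: "nat \<Rightarrow> (real^'n::finite) set \<Rightarrow> (real^'n \<Rightarrow> real) \<Rightarrow> bool" where
  "smooth_on k U f \<equiv> param_smooth k U {0::real} (\<lambda>z _. f z)"

lemma continuous_on_Times_single_iff:
  "continuous_on (U \<times> {0::real}) (\<lambda>(z, p). f z) \<longleftrightarrow> continuous_on U f"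
proof
  assume *: "continuous_on (U \<times> {0::real}) (\<lambda>(z, p). f z)"
  have "continuous_on U (\<lambda>z. (\<lambda>(z, p). f z) (z, 0::real))"
    by (rule continuous_on_compose2[OF *]) (auto intro!: continuous_intros)
  then show "continuous_on U f" by simp
next
  assume *: "continuous_on U f"
  have "continuous_on (U \<times> {0::real}) (\<lambda>zp. f (fst zp))"
    by (rule continuous_on_compose2[OF *]) (auto intro!: continuous_intros)
  then show "continuous_on (U \<times> {0::real}) (\<lambda>(z, p). f z)" by (simp add: split_def)
qed

lemma smooth_on_0: "smooth_on 0 U f \<longleftrightarrow> continuous_on U f"
  by (simp add: continuous_on_Times_single_iff)

lemma smooth_on_Suc: "smooth_on (Suc k) U f \<longleftrightarrow> continuous_on U f \<and>
    (\<forall>i. (\<forall>z\<in>U. ((\<lambda>t. f (z + t *\<^sub>R axis i 1)) has_real_derivative partial i f z) (at 0)) \<and>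
      smooth_on k U (partial i f))"
  by (simp add: continuous_on_Times_single_iff)

lemma param_smooth_of_smooth_on:
  "smooth_on k U f \<Longrightarrow> param_smooth k U P (\<lambda>z p. f z)"
proof (induction k arbitrary: f)
  case 0
  then have *: "continuous_on U f" by (simp add: continuous_on_Times_single_iff)
  have "continuous_on (U \<times> P) (\<lambda>zp. f (fst zp))"
    by (rule continuous_on_compose2[OF *]) (auto intro!: continuous_intros)
  then show ?case by (simp add: split_def)
next
  case (Suc k)
  then have *: "continuous_on U f" by (simp add: continuous_on_Times_single_iff)
  have "continuous_on (U \<times> P) (\<lambda>zp. f (fst zp))"
    by (rule continuous_on_compose2[OF *]) (auto intro!: continuous_intros)
  then show ?case using Suc by (simp add: split_def)
qed

text \<open>Needed because the reflections that move z to a fixed axis depend smoothly on z only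
  near a given point.\<close>

lemma smooth_on_local:
  assumes "\<And>z. z \<in> W \<Longrightarrow> \<exists>V. open V \<and> z \<in> V \<and> smooth_on k V f"
  shows "smooth_on k W f"
  using assms
proof (induction k arbitrary: f)
  case 0
  have "isCont f z" if "z \<in> W" for z
    using 0[OF that] by (auto simp: continuous_on_Times_single_iff continuous_on_eq_continuous_at)
  then show ?case by (auto simp: continuous_on_Times_single_iff intro: continuous_at_imp_continuous_on)
next
  case (Suc k)
  have "isCont f z" if "z \<in> W" for z
    using Suc.prems[OF that] unfolding smooth_on_Suc by (auto simp: continuous_on_eq_continuous_at)
  then have "continuous_on W f" by (auto intro: continuous_at_imp_continuous_on)
  moreover have "((\<lambda>t. f (z + t *\<^sub>R axis i 1)) has_real_derivative partial i f z) (at 0)" if "z \<in> W" for i z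
    using Suc.prems[OF that] unfolding smooth_on_Suc by blast
  moreover have "smooth_on k W (partial i f)" for i
    by (rule Suc.IH) (use Suc.prems in \<open>unfold smooth_on_Suc, blast\<close>)
  ultimately show ?case unfolding smooth_on_Suc by blast
qed

lemma smooth_on_cong_imp:
  assumes "open U" "\<And>z. z \<in> U \<Longrightarrow> f z = g z" "smooth_on k U f"
  shows "smooth_on k U g"
  by (rule param_smooth_cong_imp[OF assms(1) _ assms(3)]) (rule assms(2))

lemma smooth_on_laplacian:
  assumes "open U" "smooth_on (Suc (Suc k)) U f"
  shows "smooth_on k U (laplacian f)"
proof -
  have "smooth_on k U (\<lambda>z. \<Sum>i\<in>UNIV. partial i (partial i f) z)"
    using assms(2) by (intro param_smooth_sum[OF assms(1)]) simp
  then show ?thesis by (simp add: laplacian_def[abs_def])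
qed

lemma smooth_on_neg_laplacian_iter:
  assumes "open U" "smooth_on (l + 2 * k) U f"
  shows "smooth_on l U (((\<lambda>u z. - laplacian u z) ^^ k) f)"
  using assms(2)
proof (induction k arbitrary: l)
  case (Suc k)
  have "smooth_on (Suc (Suc l)) U (((\<lambda>u z. - laplacian u z) ^^ k) f)"
    by (rule Suc.IH) (use Suc.prems in simp)
  then show ?case
    using param_smooth_uminus[OF assms(1) smooth_on_laplacian[OF assms(1)]] by simp
qed simp

lemma laplacian_cong:
  assumes "open U" "z \<in> U" "\<And>z. z \<in> U \<Longrightarrow> f z = g z"
  shows "laplacian f z = laplacian g z"
  unfolding laplacian_def
  by (intro sum.cong refl partial_cong[OF assms(1,2)] partial_cong[OF assms(1)] assms(3))

section \<open>Differentiation under the integral\<close>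

text \<open>Mean value inequality along a coordinate line; it provides the dominating functions for
  difference quotients.\<close>

lemma line_quotient_bound:
  fixes f :: "real^'n::finite \<Rightarrow> real"
  assumes "\<And>s. \<bar>s\<bar> \<le> \<bar>h\<bar> \<Longrightarrow>
      ((\<lambda>t. f (z + s *\<^sub>R axis i 1 + t *\<^sub>R axis i 1)) has_real_derivative g (z + s *\<^sub>R axis i 1)) (at 0)"
    and "\<And>s. \<bar>s\<bar> \<le> \<bar>h\<bar> \<Longrightarrow> \<bar>g (z + s *\<^sub>R axis i 1)\<bar> \<le> B"
  shows "\<bar>f (z + h *\<^sub>R axis i 1) - f z\<bar> \<le> B * \<bar>h\<bar>"
proof -
  have "((\<lambda>s. f (z + s *\<^sub>R axis i 1)) has_field_derivative g (z + s *\<^sub>R axis i 1)) (at s within {-\<bar>h\<bar>..\<bar>h\<bar>})"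
    if "s \<in> {-\<bar>h\<bar>..\<bar>h\<bar>}" for s
  proof -
    have "((\<lambda>t. f (z + (t + s) *\<^sub>R axis i 1)) has_real_derivative g (z + s *\<^sub>R axis i 1)) (at 0)"
      using assms(1)[of s] that by (simp add: algebra_simps abs_le_iff)
    then show ?thesis
      using DERIV_shift[of "\<lambda>s. f (z + s *\<^sub>R axis i 1)" "g (z + s *\<^sub>R axis i 1)" 0 s]
      by (auto intro: has_field_derivative_at_within)
  qed
  then have "norm (f (z + h *\<^sub>R axis i 1) - f (z + 0 *\<^sub>R axis i 1)) \<le> B * norm (h - 0)"
    by (rule field_differentiable_bound[rotated]) (use assms(2) in \<open>auto simp: abs_le_iff\<close>)
  then show ?thesis by simp
qed

lemma param_smooth_borel_measurable:
  assumes "param_smooth k U P g" "z \<in> U" "sets \<nu> = sets (restrict_space borel P)"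
  shows "g z \<in> borel_measurable \<nu>"
proof -
  have "continuous_on P (\<lambda>p. (\<lambda>(z, p). g z p) (z, p))"
    by (rule continuous_on_compose2[OF param_smooth_continuous[OF assms(1)]])
      (use assms(2) in \<open>auto intro!: continuous_intros\<close>)
  then have "g z \<in> borel_measurable (restrict_space borel P)"
    by (simp add: borel_measurable_continuous_on_restrict)
  then show ?thesis using measurable_cong_sets[OF assms(3) refl] by blast
qed

lemma param_smooth_bounded:
  assumes "param_smooth k U P g" "K \<subseteq> U" "compact K" "compact P"
  obtains B where "B \<ge> 0" "\<And>z p. z \<in> K \<Longrightarrow> p \<in> P \<Longrightarrow> \<bar>g z p\<bar> \<le> B"
proof -
  have "continuous_on (K \<times> P) (\<lambda>(z, p). g z p)"
    by (rule continuous_on_subset[OF param_smooth_continuous[OF assms(1)]]) (use assms(2) in auto)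
  then have "bounded ((\<lambda>(z, p). g z p) ` (K \<times> P))"
    using assms(3,4) by (intro compact_imp_bounded compact_continuous_image compact_Times)
  then obtain B where "\<forall>x \<in> (\<lambda>(z, p). g z p) ` (K \<times> P). norm x \<le> B"
    unfolding bounded_iff by blast
  then have "\<bar>g z p\<bar> \<le> max B 0" if "z \<in> K" "p \<in> P" for z p
    using that by fastforce
  then show thesis by (intro that[of "max B 0"]) auto
qed

lemma param_smooth_integrable:
  assumes "param_smooth k U P g" "z \<in> U" "compact P"
    and \<nu>: "sets \<nu> = sets (restrict_space borel P)" and w: "integrable \<nu> w"
  shows "integrable \<nu> (\<lambda>p. w p * g z p)"
proof -
  obtain B where B: "B \<ge> 0" "\<And>z' p. z' \<in> {z} \<Longrightarrow> p \<in> P \<Longrightarrow> \<bar>g z' p\<bar> \<le> B"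
    by (rule param_smooth_bounded[OF assms(1) _ _ assms(3), of "{z}"]) (use assms(2) in auto)
  have sp: "space \<nu> = P" using sets_eq_imp_space_eq[OF \<nu>] by (simp add: space_restrict_space)
  have [measurable]: "g z \<in> borel_measurable \<nu>" by (rule param_smooth_borel_measurable[OF assms(1,2) \<nu>])
  have [measurable]: "w \<in> borel_measurable \<nu>" using w by simp
  show ?thesis
  proof (rule Bochner_Integration.integrable_bound[of \<nu> "\<lambda>p. B * w p"])
    show "AE p in \<nu>. norm (w p * g z p) \<le> norm (B * w p)"
    proof (rule AE_I2)
      fix p assume "p \<in> space \<nu>"
      then have "\<bar>g z p\<bar> * \<bar>w p\<bar> \<le> B * \<bar>w p\<bar>" using B sp by (intro mult_right_mono) auto
      then show "norm (w p * g z p) \<le> norm (B * w p)" using B(1) by (simp add: abs_mult mult.commute)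
    qed
  qed (use w in auto)
qed

text \<open>The weight w carries the singularity and is merely integrable, while g carries the
  dependence on z. On compact sets the derivatives of g are bounded, so a multiple of |w| dominates
  and dominated convergence applies.\<close>

lemma smooth_on_integral:
  fixes g :: "real^'n::finite \<Rightarrow> 'p::metric_space \<Rightarrow> real"
  assumes U: "open U" and P: "compact P"
    and \<nu>: "sets \<nu> = sets (restrict_space borel P)" and w: "integrable \<nu> w"
  shows "param_smooth k U P g \<Longrightarrow> smooth_on k U (\<lambda>z. \<integral>p. w p * g z p \<partial>\<nu>)"
proof (induction k arbitrary: g)
  have sp: "space \<nu> = P" using sets_eq_imp_space_eq[OF \<nu>] by (simp add: space_restrict_space)
  have [measurable]: "w \<in> borel_measurable \<nu>" using w by simp
  have cont: "continuous_on U (\<lambda>z. \<integral>p. w p * g z p \<partial>\<nu>)" if g: "param_smooth k U P g" for k g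
    unfolding continuous_on_sequentially
  proof (intro allI ballI impI, elim conjE)
    fix u and z assume z: "z \<in> U" and u: "\<forall>n. u n \<in> U" "u \<longlonglongrightarrow> z"
    \<comment> \<open>A convergent sequence together with its limit is compact, so g is bounded
      along it, uniformly in the parameter.\<close>
    have "compact (insert z (range u))" by (rule compact_sequence_with_limit[OF u(2)])
    then obtain B where B: "B \<ge> 0" "\<And>y p. y \<in> insert z (range u) \<Longrightarrow> p \<in> P \<Longrightarrow> \<bar>g y p\<bar> \<le> B"
      by (rule param_smooth_bounded[OF g _ _ P, of "insert z (range u)", rotated]) (use z u in auto)
    have meas: "(\<lambda>p. w p * g y p) \<in> borel_measurable \<nu>" if "y \<in> U" for y
      using param_smooth_borel_measurable[OF g that \<nu>] by measurable
    have "(\<lambda>n. \<integral>p. w p * g (u n) p \<partial>\<nu>) \<longlonglongrightarrow> (\<integral>p. w p * g z p \<partial>\<nu>)"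
    proof (rule integral_dominated_convergence[where w="\<lambda>p. B * \<bar>w p\<bar>"])
      show "AE p in \<nu>. (\<lambda>n. w p * g (u n) p) \<longlonglongrightarrow> w p * g z p"
      proof (rule AE_I2)
        fix p assume p: "p \<in> space \<nu>"
        have "continuous_on U (\<lambda>y. (\<lambda>(z, p). g z p) (y, p))"
          by (rule continuous_on_compose2[OF param_smooth_continuous[OF g]])
            (use p sp in \<open>auto intro!: continuous_intros\<close>)
        then have "(\<lambda>n. g (u n) p) \<longlonglongrightarrow> g z p"
          using z u unfolding continuous_on_sequentially by (auto simp: comp_def)
        then show "(\<lambda>n. w p * g (u n) p) \<longlonglongrightarrow> w p * g z p" by (intro tendsto_intros)
      qed
      show "AE p in \<nu>. norm (w p * g (u n) p) \<le> B * \<bar>w p\<bar>" for n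
      proof (rule AE_I2)
        fix p assume "p \<in> space \<nu>"
        then have "\<bar>g (u n) p\<bar> * \<bar>w p\<bar> \<le> B * \<bar>w p\<bar>" using B(2) sp by (intro mult_right_mono) auto
        then show "norm (w p * g (u n) p) \<le> B * \<bar>w p\<bar>" by (simp add: abs_mult mult.commute)
      qed
      show "(\<lambda>p. w p * g z p) \<in> borel_measurable \<nu>" by (rule meas[OF z])
      show "(\<lambda>p. w p * g (u n) p) \<in> borel_measurable \<nu>" for n by (rule meas) (use u in auto)
      show "integrable \<nu> (\<lambda>p. B * \<bar>w p\<bar>)" using w by simp
    qed
    then show "((\<lambda>z. \<integral>p. w p * g z p \<partial>\<nu>) \<circ> u) \<longlonglongrightarrow> (\<integral>p. w p * g z p \<partial>\<nu>)" by (simp add: comp_def)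
  qed
  {
    case 0
    then show ?case using cont unfolding smooth_on_0 by blast
  next
    case (Suc k)
    let ?F = "\<lambda>z. \<integral>p. w p * g z p \<partial>\<nu>"
    let ?d = "\<lambda>i z p. partial i (\<lambda>z. g z p) z"
    have d: "param_smooth k U P (?d i)" for i using Suc.prems by simp
    have "((\<lambda>t. ?F (z + t *\<^sub>R axis i 1)) has_real_derivative (\<integral>p. w p * ?d i z p \<partial>\<nu>)) (at 0)"
      if z: "z \<in> U" for i z
    proof -
      obtain r where r: "r > 0" "cball z r \<subseteq> U" using U z open_contains_cball by blast
      obtain B where B: "B \<ge> 0" "\<And>y p. y \<in> cball z r \<Longrightarrow> p \<in> P \<Longrightarrow> \<bar>?d i y p\<bar> \<le> B"
        by (rule param_smooth_bounded[OF d r(2) _ P]) auto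
      have inr: "z + s *\<^sub>R axis i 1 \<in> cball z r" if "\<bar>s\<bar> \<le> r" for s
        using that by (simp add: dist_norm norm_axis_1)
      \<comment> \<open>The difference quotient, cut off to 0 for |h| > r, where the shifted point
        could leave U. Thus measurability and domination hold along every null sequence, and the
        cut-off is eventually invisible.\<close>
      define Q where "Q h p = (if \<bar>h\<bar> \<le> r then w p * ((g (z + h *\<^sub>R axis i 1) p - g z p) / h) else 0)" for h p
      have Qm: "Q h \<in> borel_measurable \<nu>" for h
      proof (cases "\<bar>h\<bar> \<le> r")
        case True
        then have [measurable]: "g (z + h *\<^sub>R axis i 1) \<in> borel_measurable \<nu>" "g z \<in> borel_measurable \<nu>"
          using inr[of h] r(2) z by (auto intro!: param_smooth_borel_measurable[OF Suc.prems _ \<nu>])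
        show ?thesis unfolding Q_def using True by simp
      qed (simp add: Q_def[abs_def])
      have Qb: "\<bar>Q h p\<bar> \<le> B * \<bar>w p\<bar>" if p: "p \<in> P" for h p
      proof (cases "\<bar>h\<bar> \<le> r \<and> h \<noteq> 0")
        case True
        have "\<bar>g (z + h *\<^sub>R axis i 1) p - g z p\<bar> \<le> B * \<bar>h\<bar>"
        proof (rule line_quotient_bound[where g="\<lambda>z. ?d i z p"])
          fix s assume "\<bar>s\<bar> \<le> \<bar>h\<bar>"
          then have s: "z + s *\<^sub>R axis i 1 \<in> cball z r" using True by (intro inr) simp
          then show "((\<lambda>t. g (z + s *\<^sub>R axis i 1 + t *\<^sub>R axis i 1) p) has_real_derivative ?d i (z + s *\<^sub>R axis i 1) p) (at 0)"
            using Suc.prems p r(2) by auto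
          show "\<bar>?d i (z + s *\<^sub>R axis i 1) p\<bar> \<le> B" by (rule B(2)[OF s p])
        qed
        then have "\<bar>(g (z + h *\<^sub>R axis i 1) p - g z p) / h\<bar> \<le> B"
          using True by (simp add: abs_divide pos_divide_le_eq)
        then have "\<bar>w p\<bar> * \<bar>(g (z + h *\<^sub>R axis i 1) p - g z p) / h\<bar> \<le> \<bar>w p\<bar> * B"
          by (intro mult_left_mono) auto
        then show ?thesis using True by (simp add: Q_def abs_mult mult.commute)
      qed (use B(1) in \<open>auto simp: Q_def\<close>)
      have "((\<lambda>h. \<integral>p. Q h p \<partial>\<nu>) \<longlongrightarrow> (\<integral>p. w p * ?d i z p \<partial>\<nu>)) (at 0)"
        unfolding tendsto_at_iff_sequentially
      proof (intro allI impI)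
        fix X :: "nat \<Rightarrow> real" assume X: "\<forall>n. X n \<in> UNIV - {0}" "X \<longlonglongrightarrow> 0"
        have "(\<lambda>n. \<integral>p. Q (X n) p \<partial>\<nu>) \<longlonglongrightarrow> (\<integral>p. w p * ?d i z p \<partial>\<nu>)"
        proof (rule integral_dominated_convergence[where w="\<lambda>p. B * \<bar>w p\<bar>"])
          show "AE p in \<nu>. (\<lambda>n. Q (X n) p) \<longlonglongrightarrow> w p * ?d i z p"
          proof (rule AE_I2)
            fix p assume p: "p \<in> space \<nu>"
            then have "((\<lambda>t. g (z + t *\<^sub>R axis i 1) p) has_real_derivative ?d i z p) (at 0)"
              using Suc.prems z sp by auto
            then have "((\<lambda>h. (g (z + h *\<^sub>R axis i 1) p - g z p) / h) \<longlongrightarrow> ?d i z p) (at 0)"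
              by (simp add: has_field_derivative_iff)
            then have "(\<lambda>n. (g (z + X n *\<^sub>R axis i 1) p - g z p) / X n) \<longlonglongrightarrow> ?d i z p"
              using X unfolding tendsto_at_iff_sequentially by (auto simp: comp_def)
            then have *: "(\<lambda>n. w p * ((g (z + X n *\<^sub>R axis i 1) p - g z p) / X n)) \<longlonglongrightarrow> w p * ?d i z p"
              by (intro tendsto_intros)
            have "\<forall>\<^sub>F n in sequentially. \<bar>X n\<bar> < r"
              using X(2) r(1) by (auto simp: tendsto_iff dist_real_def)
            then have "\<forall>\<^sub>F n in sequentially. w p * ((g (z + X n *\<^sub>R axis i 1) p - g z p) / X n) = Q (X n) p"
              by (rule eventually_mono) (simp add: Q_def)
            with * show "(\<lambda>n. Q (X n) p) \<longlonglongrightarrow> w p * ?d i z p"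
              by (rule Lim_transform_eventually)
          qed
          show "AE p in \<nu>. norm (Q (X n) p) \<le> B * \<bar>w p\<bar>" for n
            using Qb sp by (intro AE_I2) auto
          have "?d i z \<in> borel_measurable \<nu>" by (rule param_smooth_borel_measurable[OF d z \<nu>])
          then show "(\<lambda>p. w p * ?d i z p) \<in> borel_measurable \<nu>" by measurable
          show "integrable \<nu> (\<lambda>p. B * \<bar>w p\<bar>)" using w by simp
          show "Q (X n) \<in> borel_measurable \<nu>" for n by (rule Qm)
        qed
        then show "((\<lambda>h. \<integral>p. Q h p \<partial>\<nu>) \<circ> X) \<longlonglongrightarrow> (\<integral>p. w p * ?d i z p \<partial>\<nu>)" by (simp add: comp_def)
      qed
      moreover have "\<forall>\<^sub>F h in at 0. (\<integral>p. Q h p \<partial>\<nu>) = (?F (z + h *\<^sub>R axis i 1) - ?F z) / h"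
        unfolding eventually_at
      proof (intro exI[of _ r] conjI ballI impI)
        fix h :: real assume h: "h \<noteq> 0 \<and> dist h 0 < r"
        then have hr: "\<bar>h\<bar> \<le> r" by simp
        have "z + h *\<^sub>R axis i 1 \<in> U" using inr[OF hr] r(2) by auto
        then have "integrable \<nu> (\<lambda>p. w p * g (z + h *\<^sub>R axis i 1) p)" "integrable \<nu> (\<lambda>p. w p * g z p)"
          using z by (auto intro!: param_smooth_integrable[OF Suc.prems _ P \<nu> w])
        then have "(?F (z + h *\<^sub>R axis i 1) - ?F z) / h =
            (\<integral>p. (w p * g (z + h *\<^sub>R axis i 1) p - w p * g z p) / h \<partial>\<nu>)" by simp
        also have "\<dots> = (\<integral>p. Q h p \<partial>\<nu>)"
          using hr by (intro Bochner_Integration.integral_cong) (auto simp: Q_def algebra_simps)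
        finally show "(\<integral>p. Q h p \<partial>\<nu>) = (?F (z + h *\<^sub>R axis i 1) - ?F z) / h" by simp
      qed (use r in auto)
      ultimately have "((\<lambda>h. (?F (z + h *\<^sub>R axis i 1) - ?F z) / h) \<longlongrightarrow> (\<integral>p. w p * ?d i z p \<partial>\<nu>)) (at 0)"
        by (rule Lim_transform_eventually)
      then show ?thesis by (simp add: has_field_derivative_iff)
    qed
    then show ?case
      using Suc.IH[OF d] cont[OF Suc.prems]
      by (intro param_smooth_SucI[OF U, where g'="\<lambda>i z _. \<integral>p. w p * ?d i z p \<partial>\<nu>"])
        (auto simp: continuous_on_Times_single_iff)
  }
qed

section \<open>Orthogonal invariance of Lebesgue measure and Green's identity\<close>

declare param_smooth.simps [simp del]

lemma nn_integral_lborel_translate: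
  fixes f :: "'a::euclidean_space \<Rightarrow> ennreal"
  assumes [measurable]: "f \<in> borel_measurable borel"
  shows "(\<integral>\<^sup>+x. f (a + x) \<partial>lborel) = (\<integral>\<^sup>+x. f x \<partial>lborel)"
proof -
  have "(\<integral>\<^sup>+x. f x \<partial>lborel) = (\<integral>\<^sup>+x. f x \<partial>distr lborel borel ((+) a))"
    by (simp add: lborel_distr_plus)
  also have "\<dots> = (\<integral>\<^sup>+x. f (a + x) \<partial>lborel)" by (rule nn_integral_distr) auto
  finally show ?thesis by simp
qed

lemma borel_measurable_orthogonal:
  "orthogonal_transformation T \<Longrightarrow> (T :: 'a::euclidean_space \<Rightarrow> 'a) \<in> borel_measurable borel"
  using orthogonal_transformation_linear[of T]
  by (intro borel_measurable_continuous_onI linear_continuous_on) (simp add: linear_conv_bounded_linear)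

text \<open>Integrating against the indicator of a ball, which orthogonal maps preserve, reduces orthogonal
  invariance to translation invariance.\<close>

lemma nn_integral_lborel_orthogonal:
  fixes f :: "'a::euclidean_space \<Rightarrow> ennreal" and T :: "'a \<Rightarrow> 'a"
  assumes T: "orthogonal_transformation T" and f[measurable]: "f \<in> borel_measurable borel"
  shows "(\<integral>\<^sup>+x. f (T x) \<partial>lborel) = (\<integral>\<^sup>+x. f x \<partial>lborel)"
proof -
  have [measurable]: "T \<in> borel_measurable borel" by (rule borel_measurable_orthogonal[OF T])
  define g :: "'a \<Rightarrow> ennreal" where "g = indicator (ball 0 1)"
  have [measurable]: "g \<in> borel_measurable borel" unfolding g_def by (intro borel_measurable_indicator) auto
  define c where "c = emeasure lborel (ball (0::'a) 1)"
  have c: "c = ennreal (unit_ball_vol DIM('a))"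
    using emeasure_ball[of 1 "0::'a"] by (simp add: c_def)
  have c0: "c \<noteq> 0" "c \<noteq> top" by (simp_all add: c less_imp_neq[OF unit_ball_vol_pos, symmetric])
  have sub1: "(\<integral>\<^sup>+x. f (T x + y) \<partial>lborel) = (\<integral>\<^sup>+x. f (T x) \<partial>lborel)" for y
  proof -
    obtain z where z: "T z = y" using orthogonal_transformation_surj[OF T] by (metis surjD)
    have "(\<integral>\<^sup>+x. f (T x) \<partial>lborel) = (\<integral>\<^sup>+x. f (T (z + x)) \<partial>lborel)"
      by (rule nn_integral_lborel_translate[symmetric]) measurable
    then show ?thesis using linear_add[OF orthogonal_transformation_linear[OF T]] z by (simp add: add.commute)
  qed
  have sub2: "(\<integral>\<^sup>+y. f (T x + y) * g y \<partial>lborel) = (\<integral>\<^sup>+y. f y * g (y - T x) \<partial>lborel)" for x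
  proof -
    have "(\<integral>\<^sup>+y. f (T x + y) * g (T x + y - T x) \<partial>lborel) = (\<integral>\<^sup>+y. f y * g (y - T x) \<partial>lborel)"
      by (rule nn_integral_lborel_translate[of "\<lambda>y. f y * g (y - T x)"]) measurable
    then show ?thesis by simp
  qed
  have sub3: "(\<integral>\<^sup>+x. g (y - T x) \<partial>lborel) = c" for y
  proof -
    obtain z where z: "T z = y" using orthogonal_transformation_surj[OF T] by (metis surjD)
    have "norm (y - T x) = norm (z - x)" for x
      using orthogonal_transformation_isometry[THEN iffD1, OF T] z by (metis dist_norm)
    then have "g (y - T x) = indicator (ball z 1) x" for x
      by (simp add: g_def indicator_def mem_ball dist_norm norm_minus_commute[of "T x" y])
    then have "(\<integral>\<^sup>+x. g (y - T x) \<partial>lborel) = emeasure lborel (ball z 1)" by simp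
    then show ?thesis using emeasure_ball[of 1 z] by (simp add: c)
  qed
  have "(\<integral>\<^sup>+x. f (T x) \<partial>lborel) * c = (\<integral>\<^sup>+y. (\<integral>\<^sup>+x. f (T x + y) \<partial>lborel) * g y \<partial>lborel)"
  proof -
    have "(\<integral>\<^sup>+y. g y \<partial>lborel) = c" unfolding g_def c_def by (rule nn_integral_indicator) simp
    then show ?thesis by (simp add: sub1 nn_integral_cmult)
  qed
  also have "\<dots> = (\<integral>\<^sup>+y. (\<integral>\<^sup>+x. f (T x + y) * g y \<partial>lborel) \<partial>lborel)"
    by (intro nn_integral_cong nn_integral_multc[symmetric]) measurable
  also have "\<dots> = (\<integral>\<^sup>+x. (\<integral>\<^sup>+y. f (T x + y) * g y \<partial>lborel) \<partial>lborel)"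
    by (rule lborel_pair.Fubini'[symmetric]) measurable
  also have "\<dots> = (\<integral>\<^sup>+x. (\<integral>\<^sup>+y. f y * g (y - T x) \<partial>lborel) \<partial>lborel)"
    by (simp add: sub2)
  also have "\<dots> = (\<integral>\<^sup>+y. (\<integral>\<^sup>+x. f y * g (y - T x) \<partial>lborel) \<partial>lborel)"
    by (rule lborel_pair.Fubini'[symmetric]) measurable
  also have "\<dots> = (\<integral>\<^sup>+y. f y * c \<partial>lborel)"
    by (simp add: nn_integral_cmult sub3)
  also have "\<dots> = (\<integral>\<^sup>+y. f y \<partial>lborel) * c" by (rule nn_integral_multc) measurable
  finally show ?thesis using c0 by (simp add: mult.commute[of _ c] ennreal_mult_cancel_left)
qed

lemma lborel_distr_orthogonal:
  fixes T :: "'a::euclidean_space \<Rightarrow> 'a"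
  assumes T: "orthogonal_transformation T"
  shows "distr lborel borel T = lborel"
proof (rule measure_eqI)
  have [measurable]: "T \<in> borel_measurable borel" by (rule borel_measurable_orthogonal[OF T])
  fix A assume "A \<in> sets (distr lborel borel T)"
  then have A[measurable]: "A \<in> sets borel" by simp
  have "emeasure (distr lborel borel T) A = (\<integral>\<^sup>+x. indicator A x \<partial>distr lborel borel T)"
    by simp
  also have "\<dots> = (\<integral>\<^sup>+x. indicator A (T x) \<partial>lborel)" by (rule nn_integral_distr) measurable
  also have "\<dots> = (\<integral>\<^sup>+x. indicator A x \<partial>lborel)"
    by (rule nn_integral_lborel_orthogonal[OF T]) measurable
  finally show "emeasure (distr lborel borel T) A = emeasure lborel A" by simp
qed simp

section \<open>Integration by parts with compact support\<close>

lemma integrable_compact_support: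
  fixes h :: "real^'n::finite \<Rightarrow> real"
  assumes "continuous_on UNIV h" "\<And>z. R \<le> norm z \<Longrightarrow> h z = 0"
  shows "integrable lborel h"
proof -
  have "integrable lborel (\<lambda>x. indicator (cball 0 R) x *\<^sub>R h x)"
    by (intro borel_integrable_compact continuous_on_subset[OF assms(1)]) auto
  moreover have "indicator (cball 0 R) x *\<^sub>R h x = h x" for x
    using assms(2)[of x] by (cases "norm x \<le> R") (auto simp: indicator_def)
  ultimately show ?thesis by (simp only:)
qed

lemma partial_eq_0:
  fixes h :: "real^'n::finite \<Rightarrow> real"
  assumes "open U" "z \<in> U" "\<And>z. z \<in> U \<Longrightarrow> h z = 0"
  shows "partial i h z = 0"
  using partial_cong[OF assms(1,2), of h "\<lambda>_. 0" i] assms(3) by (simp add: partial_def)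

text \<open>By translation invariance every difference quotient has integral 0, and dominated
  convergence passes to the derivative.\<close>

lemma integral_partial_eq_0:
  fixes h :: "real^'n::finite \<Rightarrow> real"
  assumes h: "smooth_on (Suc 0) UNIV h" and supp: "\<And>z. R \<le> norm z \<Longrightarrow> h z = 0"
  shows "(\<integral>z. partial i h z \<partial>lborel) = 0"
proof -
  have hc: "continuous_on UNIV h" and d: "smooth_on 0 UNIV (partial i h)"
    and D: "((\<lambda>t. h (z + t *\<^sub>R axis i 1)) has_real_derivative partial i h z) (at 0)" for z
    using h unfolding smooth_on_Suc by blast+
  have dc: "continuous_on UNIV (partial i h)" using d by (simp add: smooth_on_0)
  have int: "integrable lborel h" by (rule integrable_compact_support[OF hc supp])
  have [measurable]: "h \<in> borel_measurable borel" "partial i h \<in> borel_measurable borel"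
    using hc dc by (auto intro: borel_measurable_continuous_onI)
  have supp': "partial i h z = 0" if "R < norm z" for z
    by (rule partial_eq_0[of "- cball 0 R"]) (use that supp in \<open>auto simp: open_Compl\<close>)
  obtain B where B: "B \<ge> 0" "\<And>z p. z \<in> cball 0 R \<Longrightarrow> p \<in> {0::real} \<Longrightarrow> \<bar>partial i h z\<bar> \<le> B"
    by (rule param_smooth_bounded[OF d, of "cball 0 R"]) auto
  have B': "\<bar>partial i h z\<bar> \<le> B" for z
    using B supp'[of z] by (cases "norm z \<le> R") auto
  define e where "e n = 1 / real (Suc n)" for n
  have e: "e n > 0" "e n \<le> 1" for n by (auto simp: e_def)
  define q where "q n z = (h (z + e n *\<^sub>R axis i 1) - h z) / e n" for n z
  have q0: "(\<integral>z. q n z \<partial>lborel) = 0" for n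
  proof -
    have "(\<integral>z. h z \<partial>lborel) = (\<integral>z. h z \<partial>distr lborel borel ((+) (e n *\<^sub>R axis i 1)))"
      by (simp add: lborel_distr_plus)
    also have "\<dots> = (\<integral>z. h (e n *\<^sub>R axis i 1 + z) \<partial>lborel)" by (rule integral_distr) auto
    finally have eq: "(\<integral>z. h (z + e n *\<^sub>R axis i 1) \<partial>lborel) = (\<integral>z. h z \<partial>lborel)"
      by (simp add: add.commute)
    have "integrable (distr lborel borel ((+) (e n *\<^sub>R axis i 1))) h"
      using int by (simp add: lborel_distr_plus)
    then have "integrable lborel (\<lambda>z. h (e n *\<^sub>R axis i 1 + z))"
      by (subst (asm) integrable_distr_eq) auto
    then have "integrable lborel (\<lambda>z. h (z + e n *\<^sub>R axis i 1))" by (simp add: add.commute)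
    then show ?thesis unfolding q_def using int eq by simp
  qed
  have "(\<lambda>n. \<integral>z. q n z \<partial>lborel) \<longlonglongrightarrow> (\<integral>z. partial i h z \<partial>lborel)"
  \<comment> \<open>The radius R + 1 allows for the shifts, which have length at most 1.\<close>
  proof (rule integral_dominated_convergence[where w="\<lambda>z. B * indicator (cball 0 (R + 1)) z"])
    show "integrable lborel (\<lambda>z::real^'n. B * indicator (cball 0 (R + 1)) z)"
      using emeasure_lborel_cball_finite[of "0::real^'n" "R+1"] by auto
    show "AE z in lborel. (\<lambda>n. q n z) \<longlonglongrightarrow> partial i h z"
    proof (rule AE_I2)
      fix z
      have "((\<lambda>t. (h (z + t *\<^sub>R axis i 1) - h z) / t) \<longlongrightarrow> partial i h z) (at 0)"
        using D[of z] by (simp add: has_field_derivative_iff)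
      moreover have "e \<longlonglongrightarrow> 0" unfolding e_def by (rule LIMSEQ_Suc[OF lim_1_over_n])
      moreover have "\<forall>n. e n \<in> UNIV - {0}" using e(1) by (simp add: less_imp_neq[symmetric])
      ultimately have "((\<lambda>t. (h (z + t *\<^sub>R axis i 1) - h z) / t) \<circ> e) \<longlonglongrightarrow> partial i h z"
        unfolding tendsto_at_iff_sequentially by blast
      then show "(\<lambda>n. q n z) \<longlonglongrightarrow> partial i h z" by (simp add: comp_def q_def)
    qed
    show "AE z in lborel. norm (q n z) \<le> B * indicator (cball 0 (R + 1)) z" for n
    proof (rule AE_I2)
      fix z
      show "norm (q n z) \<le> B * indicator (cball 0 (R + 1)) z"
      proof (cases "norm z \<le> R + 1")
        case True
        have "\<bar>h (z + e n *\<^sub>R axis i 1) - h z\<bar> \<le> B * \<bar>e n\<bar>"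
          by (rule line_quotient_bound[OF D B'])
        then show ?thesis using True e(1)[of n] by (simp add: q_def abs_divide pos_divide_le_eq)
      next
        case False
        have "norm z \<le> norm (z + e n *\<^sub>R axis i 1) + norm (e n *\<^sub>R axis i (1::real))"
          by (metis add_diff_cancel norm_triangle_ineq4)
        then have "norm (z + e n *\<^sub>R axis i 1) \<ge> R" using False e[of n] by (simp add: norm_axis_1)
        then show ?thesis using False supp by (simp add: q_def)
      qed
    qed
    show "q n \<in> borel_measurable lborel" for n unfolding q_def by measurable
  qed simp
  then show ?thesis by (simp add: q0 LIMSEQ_const_iff)
qed

text \<open>Near the origin the product is identically 0, whatever f does there; elsewhere it is a
  product of smooth functions.\<close>

lemma smooth_on_mult_extend:
  assumes f: "smooth_on k (-{0}) f" and g: "smooth_on k UNIV g" and 0: "\<And>z. norm z < 1 \<Longrightarrow> g z = 0"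
  shows "smooth_on k UNIV (\<lambda>z. f z * g z)"
proof (rule smooth_on_local)
  fix z :: "real^'a"
  show "\<exists>V. open V \<and> z \<in> V \<and> smooth_on k V (\<lambda>z. f z * g z)"
  proof (cases "z = 0")
    case True
    have "smooth_on k (ball 0 1) (\<lambda>z. f z * g z)"
      by (rule smooth_on_cong_imp[OF open_ball _ param_smooth_const[of _ k "{0::real}" 0]]) (auto simp: 0)
    then show ?thesis using True by (intro exI[of _ "ball 0 1"]) auto
  next
    case False
    have "smooth_on k (-{0}) (\<lambda>z. f z * g z)"
      using param_smooth_subset[OF g] by (intro param_smooth_mult f) auto
    then show ?thesis using False by (intro exI[of _ "-{0}"]) auto
  qed
qed

text \<open>For each i, the function f * \<open>partial i g\<close> - \<open>partial i f\<close> * g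
  is smooth with compact support, and its i-th partial derivative is the difference of the two
  integrands belonging to i. The singularity of f at 0 lies where g vanishes.\<close>

lemma Green_identity:
  fixes f g :: "real^'n::finite \<Rightarrow> real"
  assumes f: "smooth_on 2 (-{0}) f" and g: "smooth_on 2 UNIV g"
    and 0: "\<And>z. norm z < 1 \<Longrightarrow> g z = 0" and R: "\<And>z. R \<le> norm z \<Longrightarrow> g z = 0"
  shows "(\<integral>z. laplacian f z * g z \<partial>lborel) = (\<integral>z. f z * laplacian g z \<partial>lborel)"
proof -
  have f': "smooth_on (Suc (Suc 0)) (-{0}) f" using f by (simp add: numeral_2_eq_2)
  have f1: "smooth_on (Suc 0) (-{0}) f" "smooth_on (Suc 0) (-{0}) (partial i f)"
    and fD: "z \<noteq> 0 \<Longrightarrow> ((\<lambda>t. f (z + t *\<^sub>R axis i 1)) has_real_derivative partial i f z) (at 0)"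
            "z \<noteq> 0 \<Longrightarrow> ((\<lambda>t. partial i f (z + t *\<^sub>R axis i 1)) has_real_derivative partial i (partial i f) z) (at 0)"
    and f0: "smooth_on 0 (-{0}) (partial i (partial i f))" for i z
    using param_smooth_SucD[OF f'] f' unfolding smooth_on_Suc by blast+
  have g': "smooth_on (Suc (Suc 0)) UNIV g" using g by (simp add: numeral_2_eq_2)
  have g1: "smooth_on (Suc 0) UNIV g" "smooth_on (Suc 0) UNIV (partial i g)"
    and gD: "((\<lambda>t. g (z + t *\<^sub>R axis i 1)) has_real_derivative partial i g z) (at 0)"
            "((\<lambda>t. partial i g (z + t *\<^sub>R axis i 1)) has_real_derivative partial i (partial i g) z) (at 0)"
    and g0: "smooth_on 0 UNIV (partial i (partial i g))" for i z
    using param_smooth_SucD[OF g'] g' unfolding smooth_on_Suc by blast+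
  have 01: "partial i g z = 0" if "norm z < 1" for i z
    by (rule partial_eq_0[of "ball 0 1"]) (use that 0 in auto)
  have 02: "partial i (partial i g) z = 0" if "norm z < 1" for i z
    by (rule partial_eq_0[of "ball 0 1"]) (use that 01 in auto)
  have R1: "partial i g z = 0" if "R < norm z" for i z
    by (rule partial_eq_0[of "- cball 0 R"]) (use that R in \<open>auto simp: open_Compl\<close>)
  have R2: "partial i (partial i g) z = 0" if "R < norm z" for i z
    by (rule partial_eq_0[of "- cball 0 R"]) (use that R1 in \<open>auto simp: open_Compl\<close>)
  have ints: "integrable lborel (\<lambda>z. f z * partial i (partial i g) z)"
    "integrable lborel (\<lambda>z. partial i (partial i f) z * g z)" for i
  proof -
    have "smooth_on 0 UNIV (\<lambda>z. f z * partial i (partial i g) z)"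
      by (rule smooth_on_mult_extend[OF param_smooth_SucD[OF f1(1)] g0 02])
    then show "integrable lborel (\<lambda>z. f z * partial i (partial i g) z)"
      by (intro integrable_compact_support[where R="R+1"]) (auto simp: smooth_on_0 R2)
    have "smooth_on 0 UNIV (\<lambda>z. partial i (partial i f) z * g z)"
      by (rule smooth_on_mult_extend[OF f0 param_smooth_SucD[OF g1(1)] 0])
    then show "integrable lborel (\<lambda>z. partial i (partial i f) z * g z)"
      by (intro integrable_compact_support[where R="R+1"]) (auto simp: smooth_on_0 R)
  qed
  have eq: "(\<integral>z. partial i (partial i f) z * g z \<partial>lborel) = (\<integral>z. f z * partial i (partial i g) z \<partial>lborel)" for i
  proof -
    define h where "h z = f z * partial i g z - partial i f z * g z" for z
    have "smooth_on (Suc 0) UNIV h"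
      unfolding h_def
      by (intro param_smooth_diff smooth_on_mult_extend f1 g1 0 01) auto
    moreover have "h z = 0" if "R + 1 \<le> norm z" for z
      using that R R1 by (simp add: h_def)
    ultimately have "(\<integral>z. partial i h z \<partial>lborel) = 0" by (rule integral_partial_eq_0)
    moreover have "partial i h z = f z * partial i (partial i g) z - partial i (partial i f) z * g z" for z
    proof (cases "z = 0")
      case True
      have "partial i h z = 0"
        by (rule partial_eq_0[of "ball 0 1"]) (use True 0 01 in \<open>auto simp: h_def\<close>)
      then show ?thesis using True 0 02 by simp
    next
      case False
      have "((\<lambda>t. h (z + t *\<^sub>R axis i 1)) has_real_derivative
          f z * partial i (partial i g) z - partial i (partial i f) z * g z) (at 0)"
        unfolding h_def using fD[OF False] gD
        by (auto intro!: derivative_eq_intros simp: algebra_simps)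
      then show ?thesis by (rule partial_eqI)
    qed
    ultimately show ?thesis using ints by simp
  qed
  have "(\<integral>z. laplacian f z * g z \<partial>lborel) = (\<Sum>i\<in>UNIV. \<integral>z. partial i (partial i f) z * g z \<partial>lborel)"
    unfolding laplacian_def sum_distrib_right using ints by (intro Bochner_Integration.integral_sum) auto
  also have "\<dots> = (\<Sum>i\<in>UNIV. \<integral>z. f z * partial i (partial i g) z \<partial>lborel)" by (simp add: eq)
  also have "\<dots> = (\<integral>z. f z * laplacian g z \<partial>lborel)"
    unfolding laplacian_def sum_distrib_left using ints by (intro Bochner_Integration.integral_sum[symmetric]) auto
  finally show ?thesis .
qed

section \<open>Radial functions\<close>

lemma line_derivative_radial:
  fixes z :: "real^'n::finite"
  assumes "(q has_real_derivative D) (at (z \<bullet> z))"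
  shows "((\<lambda>t. q ((z + t *\<^sub>R axis i 1) \<bullet> (z + t *\<^sub>R axis i 1))) has_real_derivative D * (2 * z $ i)) (at 0)"
proof (rule DERIV_chain2[of q D "\<lambda>t. (z + t *\<^sub>R axis i 1) \<bullet> (z + t *\<^sub>R axis i 1)"])
  have "(z + t *\<^sub>R axis i 1) \<bullet> (z + t *\<^sub>R axis i 1) = z \<bullet> z + t * (2 * z $ i) + t * t" for t
    by (simp add: inner_add_left inner_add_right inner_axis inner_axis' inner_axis_axis algebra_simps)
  then show "((\<lambda>t. (z + t *\<^sub>R axis i 1) \<bullet> (z + t *\<^sub>R axis i 1)) has_real_derivative 2 * z $ i) (at 0)"
    by (auto intro!: derivative_eq_intros)
qed (use assms in simp)

text \<open>The profile is taken as a function of z . z rather than of the norm: the argument is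
  then polynomial in the coordinates, with partial derivatives 2 z_i and 2.\<close>

lemma laplacian_radial:
  fixes z :: "real^'n::finite" and q q' q'' :: "real \<Rightarrow> real"
  assumes I: "open I" "z \<bullet> z \<in> I"
    and q: "\<And>s. s \<in> I \<Longrightarrow> (q has_real_derivative q' s) (at s)"
    and q': "\<And>s. s \<in> I \<Longrightarrow> (q' has_real_derivative q'' s) (at s)"
  shows "laplacian (\<lambda>z. q (z \<bullet> z)) z = 4 * (z \<bullet> z) * q'' (z \<bullet> z) + 2 * CARD('n) * q' (z \<bullet> z)"
proof -
  define U where "U = {z :: real^'n. z \<bullet> z \<in> I}"
  have U: "open U" unfolding U_def
    using continuous_open_vimage[OF I(1), of "\<lambda>z::real^'n. z \<bullet> z"] by (auto simp: vimage_def intro!: continuous_intros)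
  have z: "z \<in> U" using I by (simp add: U_def)
  have p1: "partial i (\<lambda>z. q (z \<bullet> z)) z = q' (z \<bullet> z) * (2 * z $ i)" if "z \<in> U" for i z
    by (rule partial_eqI[OF line_derivative_radial[OF q]]) (use that in \<open>simp add: U_def\<close>)
  have "partial i (partial i (\<lambda>z. q (z \<bullet> z))) z = 4 * (z $ i)\<^sup>2 * q'' (z \<bullet> z) + 2 * q' (z \<bullet> z)" for i
  proof -
    have "partial i (partial i (\<lambda>z. q (z \<bullet> z))) z = partial i (\<lambda>z. q' (z \<bullet> z) * (2 * z $ i)) z"
      by (rule partial_cong[OF U z p1])
    also have "\<dots> = 4 * (z $ i)\<^sup>2 * q'' (z \<bullet> z) + 2 * q' (z \<bullet> z)"
    proof (rule partial_eqI)
      have D1: "((\<lambda>t. q' ((z + t *\<^sub>R axis i 1) \<bullet> (z + t *\<^sub>R axis i 1))) has_real_derivative q'' (z \<bullet> z) * (2 * z $ i)) (at 0)"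
        by (rule line_derivative_radial[OF q'[OF I(2)]])
      have D2: "((\<lambda>t. 2 * (z + t *\<^sub>R axis i 1) $ i) has_real_derivative 2) (at 0)"
        by (auto simp: axis_def intro!: derivative_eq_intros)
      show "((\<lambda>t. q' ((z + t *\<^sub>R axis i 1) \<bullet> (z + t *\<^sub>R axis i 1)) * (2 * (z + t *\<^sub>R axis i 1) $ i)) has_real_derivative
          4 * (z $ i)\<^sup>2 * q'' (z \<bullet> z) + 2 * q' (z \<bullet> z)) (at 0)"
        using DERIV_mult[OF D1 D2] by (simp add: power2_eq_square algebra_simps)
    qed
    finally show ?thesis .
  qed
  then have "laplacian (\<lambda>z. q (z \<bullet> z)) z = (\<Sum>i\<in>UNIV. 4 * (z $ i)\<^sup>2 * q'' (z \<bullet> z) + 2 * q' (z \<bullet> z))"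
    by (simp add: laplacian_def)
  also have "\<dots> = 4 * (\<Sum>i\<in>UNIV. (z $ i)\<^sup>2) * q'' (z \<bullet> z) + 2 * CARD('n) * q' (z \<bullet> z)"
    by (simp add: sum.distrib sum_distrib_left sum_distrib_right)
  also have "(\<Sum>i\<in>UNIV. (z $ i)\<^sup>2) = z \<bullet> z" by (simp add: inner_vec_def power2_eq_square)
  finally show ?thesis .
qed

lemma smooth_on_inner_self: "open U \<Longrightarrow> smooth_on k U (\<lambda>z. z \<bullet> z)"
  unfolding inner_vec_def
  using param_smooth_sum[of U UNIV k "{0::real}" "\<lambda>i z p. z $ i * z $ i"]
  by (simp add: param_smooth_mult param_smooth_component)

text \<open>A family of compactly supported radial profiles closed under the radial Laplacian, up to
  lowering the exponent \<open>N\<close>.\<close>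

definition bump :: "real poly \<Rightarrow> nat \<Rightarrow> real \<Rightarrow> real" where
  "bump q N s = poly q s * max 0 ((s - 1) * (4 - s)) ^ N"

text \<open>With exponent at least 2 the difference quotient at the kink 0 is bounded by |h|^(N+1)
  and tends to 0.\<close>

lemma has_real_derivative_max_0_power:
  "((\<lambda>x::real. max 0 x ^ (N + 2)) has_real_derivative real (N + 2) * max 0 x ^ (N + 1)) (at x)"
proof -
  consider "x > 0" | "x < 0" | "x = 0" by linarith
  then show ?thesis
  proof cases
    case 1
    have "((\<lambda>x::real. x ^ (N + 2)) has_real_derivative real (N + 2) * x ^ (N + 1)) (at x)"
      using DERIV_pow[of "N + 2" x] by simp
    then have "((\<lambda>x::real. max 0 x ^ (N + 2)) has_real_derivative real (N + 2) * x ^ (N + 1)) (at x)"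
      by (rule has_field_derivative_transform_within_open[where S="{0<..}"]) (use 1 in auto)
    then show ?thesis using 1 by simp
  next
    case 2
    have "((\<lambda>x::real. 0) has_real_derivative 0) (at x)" by simp
    then have "((\<lambda>x::real. max 0 x ^ (N + 2)) has_real_derivative 0) (at x)"
      by (rule has_field_derivative_transform_within_open[where S="{..<0}"]) (use 2 in auto)
    then show ?thesis using 2 by simp
  next
    case 3
    have "((\<lambda>h::real. max 0 h ^ (N + 2) / h) \<longlongrightarrow> 0) (at 0)"
    proof (rule Lim_null_comparison[where g="\<lambda>h. \<bar>h\<bar> ^ (N + 1)"])
      have "norm (max 0 h ^ (N + 2) / h) \<le> \<bar>h\<bar> ^ (N + 1)" for h :: real
      proof (cases "h > 0")
        case False
        then have "norm (max 0 h ^ (N + 2) / h) = 0" by simp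
        also have "0 \<le> \<bar>h\<bar> ^ (N + 1)" by (rule zero_le_power_abs)
        finally show ?thesis .
      qed simp
      then show "\<forall>\<^sub>F h::real in at 0. norm (max 0 h ^ (N + 2) / h) \<le> \<bar>h\<bar> ^ (N + 1)" by simp
      show "((\<lambda>h::real. \<bar>h\<bar> ^ (N + 1)) \<longlongrightarrow> 0) (at 0)"
        by (auto intro!: tendsto_eq_intros)
    qed
    then show ?thesis using 3 by (simp add: has_field_derivative_iff)
  qed
qed

text \<open>With m = max 0 ((s-1)(4-s)) one has m * m = (s-1)(4-s) * m for every s. So one power of
  m can be traded for a polynomial factor, which brings both terms of the product rule to the
  exponent N + 1.\<close>

lemma bump_derivative:
  "\<exists>r. \<forall>s. (bump q (N + 2) has_real_derivative bump r (N + 1) s) (at s)"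
proof (intro exI allI)
  fix s :: real
  \<comment> \<open>\<open>?\<beta>\<close> is (s-1)(4-s) multiplied out, and [:5, -2:] is its
    derivative.\<close>
  let ?m = "\<lambda>s. max 0 ((s - 1) * (4 - s))" and ?\<beta> = "[:-4, 5, -1:] :: real poly"
  let ?r = "pderiv q * ?\<beta> + smult (N + 2) (q * [:5, -2:])"
  have "((\<lambda>s. (s - 1) * (4 - s)) has_real_derivative 5 - 2 * s) (at s)"
    by (auto intro!: derivative_eq_intros)
  then have D1: "((\<lambda>s. ?m s ^ (N + 2)) has_real_derivative real (N + 2) * ?m s ^ (N + 1) * (5 - 2 * s)) (at s)"
    by (rule DERIV_chain2[OF has_real_derivative_max_0_power])
  have D: "((\<lambda>s. poly q s * ?m s ^ (N + 2)) has_real_derivative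
      poly (pderiv q) s * ?m s ^ (N + 2) + real (N + 2) * ?m s ^ (N + 1) * (5 - 2 * s) * poly q s) (at s)"
    by (rule DERIV_mult[OF poly_DERIV D1])
  have "?m s * ?m s = poly ?\<beta> s * ?m s" by (auto simp: max_def algebra_simps)
  then have "?m s ^ (N + 2) = poly ?\<beta> s * ?m s ^ (N + 1)" by (simp add: mult.assoc[symmetric])
  then have "poly (pderiv q) s * ?m s ^ (N + 2) + real (N + 2) * ?m s ^ (N + 1) * (5 - 2 * s) * poly q s
      = bump ?r (N + 1) s"
    by (simp only: bump_def) (simp add: algebra_simps)
  with D show "(bump q (N + 2) has_real_derivative bump ?r (N + 1) s) (at s)"
    by (simp add: bump_def[abs_def])
qed

lemma bump_Suc: "bump q (Suc (Suc N)) s = bump (q * [:-4, 5, -1:]) (Suc N) s"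
proof -
  define m where "m = max 0 ((s - 1) * (4 - s))"
  have m: "m * m = poly [:-4, 5, -1:] s * m"
    by (auto simp: m_def max_def algebra_simps)
  have "bump q (Suc (Suc N)) s = poly q s * (m * m) * m ^ N"
    by (simp add: bump_def m_def mult.assoc)
  also have "\<dots> = bump (q * [:-4, 5, -1:]) (Suc N) s"
    unfolding m bump_def poly_mult m_def[symmetric] by (simp only: power_Suc mult.assoc)
  finally show ?thesis .
qed

text \<open>Two derivatives cost two powers of the truncated factor. At least one power remains, so
  the result is continuous and still supported in the annulus.\<close>

lemma bump_laplacian:
  "\<exists>r. smooth_on 2 UNIV (\<lambda>z::real^'n::finite. bump q (N + 3) (z \<bullet> z)) \<and>
    (\<forall>z::real^'n. - laplacian (\<lambda>z. bump q (N + 3) (z \<bullet> z)) z = bump r (N + 1) (z \<bullet> z))"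
proof -
  obtain q1 where q1: "\<And>s. (bump q (N + 3) has_real_derivative bump q1 (N + 2) s) (at s)"
    using bump_derivative[of q "N + 1"] by (auto simp: numeral_3_eq_3)
  obtain q2 where q2: "\<And>s. (bump q1 (N + 2) has_real_derivative bump q2 (N + 1) s) (at s)"
    using bump_derivative[of q1 N] by auto
  \<comment> \<open>The derivatives in the form that \<open>param_smooth_compose\<close> expects;
    entries beyond order 2 are padding.\<close>
  define D where "D j = (case j of 0 \<Rightarrow> bump q (N + 3) | Suc 0 \<Rightarrow> bump q1 (N + 2) | Suc (Suc _) \<Rightarrow> bump q2 (N + 1))" for j :: nat
  have cont: "continuous_on UNIV (bump p M)" for p M
    unfolding bump_def by (intro continuous_intros)
  have "smooth_on 2 UNIV (\<lambda>z::real^'n. D 0 (z \<bullet> z))"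
  proof (rule param_smooth_compose[of UNIV "{0::real}" "\<lambda>z _. z \<bullet> z" UNIV 2 D])
    show "smooth_on 2 UNIV (\<lambda>z::real^'n. z \<bullet> z)" by (rule smooth_on_inner_self) simp
    show "(D j has_real_derivative D (Suc j) x) (at x)" if "j < 2" for j x
      using that q1 q2 by (auto simp: D_def less_2_cases_iff)
    show "continuous_on UNIV (D j)" for j by (simp add: D_def cont split: nat.split)
  qed auto
  then have sm: "smooth_on 2 UNIV (\<lambda>z::real^'n. bump q (N + 3) (z \<bullet> z))" by (simp add: D_def)
  \<comment> \<open>From -(4 s q'' + 2 n q'), where the term with q' is first lowered from exponent
    N + 2 to N + 1 by \<open>bump_Suc\<close>.\<close>
  let ?r = "- (q2 * [:0, 4:] + smult (2 * CARD('n)) (q1 * [:-4, 5, -1:]))"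
  have "- laplacian (\<lambda>z. bump q (N + 3) (z \<bullet> z)) z = bump ?r (N + 1) (z \<bullet> z)" for z :: "real^'n"
  proof -
    have "laplacian (\<lambda>z. bump q (N + 3) (z \<bullet> z)) z =
        4 * (z \<bullet> z) * bump q2 (N + 1) (z \<bullet> z) + 2 * CARD('n) * bump q1 (N + 2) (z \<bullet> z)"
      by (rule laplacian_radial[where I=UNIV and q'="bump q1 (N + 2)"]) (use q1 q2 in auto)
    also have "bump q1 (N + 2) (z \<bullet> z) = bump (q1 * [:-4, 5, -1:]) (N + 1) (z \<bullet> z)"
      using bump_Suc[of q1 N] by simp
    finally show ?thesis by (simp add: bump_def algebra_simps)
  qed
  with sm show ?thesis by blast
qed

lemma bump_eq_0: "N > 0 \<Longrightarrow> norm z < 1 \<or> 2 \<le> norm z \<Longrightarrow> bump q N (z \<bullet> z) = 0"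
proof -
  assume N: "N > 0" and z: "norm z < 1 \<or> 2 \<le> norm z"
  have "(z \<bullet> z - 1) * (4 - z \<bullet> z) \<le> 0"
  proof (cases "norm z < 1")
    case True
    then have "z \<bullet> z < 1" by (simp add: dot_square_norm abs_square_less_1)
    then show ?thesis by (intro mult_nonpos_nonneg) auto
  next
    case False
    then have "2\<^sup>2 \<le> (norm z)\<^sup>2" using z by (intro power_mono) auto
    then have "4 \<le> z \<bullet> z" by (simp add: dot_square_norm)
    then show ?thesis by (intro mult_nonneg_nonpos) auto
  qed
  then show ?thesis using N by (simp add: bump_def max_def)
qed

text \<open>The profile r is chosen before f: it depends on k and q only, so the same radial weight
  serves both F and its counterpart for \<open>Q = 1\<close>. Each Laplacian moved over costs two
  powers, which is why 2k + 1 ends at 1.\<close>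

lemma integral_neg_laplacian_iter_bump:
  "\<exists>r. \<forall>f :: real^'n::finite \<Rightarrow> real. smooth_on (2 * k) (-{0}) f \<longrightarrow>
    (\<integral>z. ((\<lambda>u z. - laplacian u z) ^^ k) f z * bump q (2 * k + 1) (z \<bullet> z) \<partial>lborel) =
    (\<integral>z. f z * bump r 1 (z \<bullet> z) \<partial>lborel)"
proof (induction k arbitrary: q)
  case 0
  then show ?case by auto
next
  case (Suc k)
  obtain q' where q': "smooth_on 2 UNIV (\<lambda>z::real^'n. bump q (2 * k + 3) (z \<bullet> z))"
    "\<And>z::real^'n. - laplacian (\<lambda>z. bump q (2 * k + 3) (z \<bullet> z)) z = bump q' (2 * k + 1) (z \<bullet> z)"
    using bump_laplacian[of q "2 * k"] by blast
  obtain r where r: "\<And>f :: real^'n::finite \<Rightarrow> real. smooth_on (2 * k) (-{0}) f \<Longrightarrow>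
    (\<integral>z. ((\<lambda>u z. - laplacian u z) ^^ k) f z * bump q' (2 * k + 1) (z \<bullet> z) \<partial>lborel) =
    (\<integral>z. f z * bump r 1 (z \<bullet> z) \<partial>lborel)"
    using Suc.IH[of q'] by blast
  have "(\<integral>z. ((\<lambda>u z. - laplacian u z) ^^ Suc k) f z * bump q (2 * Suc k + 1) (z \<bullet> z) \<partial>lborel) =
      (\<integral>z. f z * bump r 1 (z \<bullet> z) \<partial>lborel)"
    if f: "smooth_on (2 * Suc k) (-{0}) f" for f :: "real^'n \<Rightarrow> real"
  proof -
    let ?g = "((\<lambda>u z. - laplacian u z) ^^ k) f"
    have g: "smooth_on 2 (-{0}) ?g"
      by (rule smooth_on_neg_laplacian_iter) (use f in \<open>auto simp: add.commute\<close>)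
    have f': "smooth_on (2 * k) (-{0}) f" by (rule param_smooth_mono[OF f]) simp
    have "(\<integral>z. ((\<lambda>u z. - laplacian u z) ^^ Suc k) f z * bump q (2 * Suc k + 1) (z \<bullet> z) \<partial>lborel)
        = - (\<integral>z. laplacian ?g z * bump q (2 * k + 3) (z \<bullet> z) \<partial>lborel)"
      by (simp add: numeral_3_eq_3)
    also have "(\<integral>z. laplacian ?g z * bump q (2 * k + 3) (z \<bullet> z) \<partial>lborel) =
        (\<integral>z. ?g z * laplacian (\<lambda>z. bump q (2 * k + 3) (z \<bullet> z)) z \<partial>lborel)"
      by (rule Green_identity[OF g q'(1), where R=2]) (auto intro: bump_eq_0)
    also have "- \<dots> = (\<integral>z. ?g z * - laplacian (\<lambda>z. bump q (2 * k + 3) (z \<bullet> z)) z \<partial>lborel)"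
      by simp
    also have "\<dots> = (\<integral>z. f z * bump r 1 (z \<bullet> z) \<partial>lborel)"
      unfolding q'(2) by (rule r[OF f'])
    finally show ?thesis .
  qed
  then show ?case by blast
qed

section \<open>Distribution of the inner product on the sphere\<close>

lemma measurable_ident_sphere_measure [measurable]:
  "(\<lambda>\<xi>. \<xi>) \<in> sphere_measure \<rightarrow>\<^sub>M borel"
proof -
  have "(\<lambda>\<xi>. \<xi>) \<in> restrict_space borel (sphere 0 1) \<rightarrow>\<^sub>M borel"
    by (rule measurable_restrict_space1) simp
  then show ?thesis using measurable_cong_sets[OF sets_sphere_measure refl] by blast
qed

interpretation sphere: finite_measure sphere_measure
  by (rule finite_measure_sphere_measure)

interpretation lborel_sphere: pair_sigma_finite lborel sphere_measure ..

lemma nn_integral_sphere_orthogonal: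
  fixes T :: "real^'n::finite \<Rightarrow> real^'n"
  assumes "orthogonal_transformation T" "f \<in> borel_measurable sphere_measure"
  shows "(\<integral>\<^sup>+\<xi>. f (T \<xi>) \<partial>sphere_measure) = (\<integral>\<^sup>+\<xi>. f \<xi> \<partial>sphere_measure)"
  using nn_integral_distr[OF measurable_orthogonal_sphere_measure[OF assms(1)], of f] assms
  by (simp add: distr_orthogonal_sphere_measure)

lemma integral_sphere_orthogonal:
  fixes T :: "real^'n::finite \<Rightarrow> real^'n" and f :: "real^'n \<Rightarrow> real"
  assumes "orthogonal_transformation T" "f \<in> borel_measurable sphere_measure"
  shows "(\<integral>\<xi>. f (T \<xi>) \<partial>sphere_measure) = (\<integral>\<xi>. f \<xi> \<partial>sphere_measure)"
  using integral_distr[OF measurable_orthogonal_sphere_measure[OF assms(1)], of f] assms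
  by (simp add: distr_orthogonal_sphere_measure)

lemma orthogonal_transformation_inner:
  "orthogonal_transformation T \<Longrightarrow> T x \<bullet> T y = x \<bullet> y"
  by (simp add: orthogonal_transformation_def)

lemma nn_integral_sphere_inner_unit:
  fixes e e' :: "real^'n::finite"
  assumes [measurable]: "h \<in> borel_measurable borel" and "norm e = 1" "norm e' = 1"
  shows "(\<integral>\<^sup>+\<xi>. h (e \<bullet> \<xi>) \<partial>sphere_measure) = (\<integral>\<^sup>+\<xi>. h (e' \<bullet> \<xi>) \<partial>sphere_measure)"
proof -
  obtain T where T: "orthogonal_transformation T" "T e' = e"
    using assms orthogonal_transformation_exists_1 by metis
  have "(\<integral>\<^sup>+\<xi>. h (e \<bullet> \<xi>) \<partial>sphere_measure) = (\<integral>\<^sup>+\<xi>. h (e \<bullet> T \<xi>) \<partial>sphere_measure)"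
    by (rule nn_integral_sphere_orthogonal[OF T(1), symmetric]) measurable
  then show ?thesis using orthogonal_transformation_inner[OF T(1), of e'] T(2) by simp
qed

lemma nn_integral_lborel_inner_unit:
  fixes e e' :: "real^'n::finite"
  assumes [measurable]: "h \<in> borel_measurable borel" "\<rho> \<in> borel_measurable borel" and "norm e = 1" "norm e' = 1"
  shows "(\<integral>\<^sup>+z. h (z \<bullet> e) * \<rho> (norm z) \<partial>lborel) = (\<integral>\<^sup>+z. h (z \<bullet> e') * \<rho> (norm z) \<partial>lborel)"
proof -
  obtain T where T: "orthogonal_transformation T" "T e' = e"
    using assms orthogonal_transformation_exists_1 by metis
  have "(\<integral>\<^sup>+z. h (z \<bullet> e) * \<rho> (norm z) \<partial>lborel) = (\<integral>\<^sup>+z. h (T z \<bullet> e) * \<rho> (norm (T z)) \<partial>lborel)"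
    by (rule nn_integral_lborel_orthogonal[OF T(1), symmetric]) measurable
  also have "\<dots> = (\<integral>\<^sup>+z. h (z \<bullet> e') * \<rho> (norm z) \<partial>lborel)"
    using orthogonal_transformation_inner[OF T(1), of _ e'] orthogonal_transformation_norm[OF T(1)] T(2)
    by simp
  finally show ?thesis .
qed

text \<open>The surface measure is known only through its invariance; averaging over \<open>z\<close> turns questions
  about the distribution of \<open>z \<bullet> \<xi>\<close> on the sphere into ones about Lebesgue measure.\<close>

lemma AE_sphere_inner_nonzero:
  fixes z :: "real^'n::finite"
  assumes z: "z \<noteq> 0"
  shows "AE \<xi> in sphere_measure. z \<bullet> \<xi> \<noteq> 0"
proof -
  define h :: "real \<Rightarrow> ennreal" where "h = indicator {0}"
  have [measurable]: "h \<in> borel_measurable borel" by (simp add: h_def)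
  define B :: "(real^'n) set" where "B = ball 0 1 - {0}"
  have [measurable]: "B \<in> sets borel" by (simp add: B_def)
  define e where "e = z /\<^sub>R norm z"
  have e: "norm e = 1" using z by (simp add: e_def)
  define c where "c = (\<integral>\<^sup>+\<xi>. h (e \<bullet> \<xi>) \<partial>sphere_measure)"
  have c: "(\<integral>\<^sup>+\<xi>. h (x \<bullet> \<xi>) \<partial>sphere_measure) = c" if "x \<noteq> 0" for x :: "real^'n"
  proof -
    have "h (x \<bullet> \<xi>) = h ((x /\<^sub>R norm x) \<bullet> \<xi>)" for \<xi> :: "real^'n"
      using that by (simp add: h_def indicator_def)
    then have "(\<integral>\<^sup>+\<xi>. h (x \<bullet> \<xi>) \<partial>sphere_measure) = (\<integral>\<^sup>+\<xi>. h ((x /\<^sub>R norm x) \<bullet> \<xi>) \<partial>sphere_measure)"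
      by presburger
    also have "\<dots> = c" unfolding c_def
      by (rule nn_integral_sphere_inner_unit) (use e that in auto)
    finally show ?thesis .
  qed
  have "(\<integral>\<^sup>+x. indicator B x * c \<partial>lborel) = (\<integral>\<^sup>+x. indicator B x * (\<integral>\<^sup>+\<xi>. h (x \<bullet> \<xi>) \<partial>sphere_measure) \<partial>lborel)"
    by (intro nn_integral_cong) (auto simp: B_def indicator_def c)
  also have "\<dots> = (\<integral>\<^sup>+x. (\<integral>\<^sup>+\<xi>. indicator B x * h (x \<bullet> \<xi>) \<partial>sphere_measure) \<partial>lborel)"
    by (intro nn_integral_cong nn_integral_cmult[symmetric]) measurable
  also have "\<dots> = (\<integral>\<^sup>+\<xi>. (\<integral>\<^sup>+x. indicator B x * h (x \<bullet> \<xi>) \<partial>lborel) \<partial>sphere_measure)"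
    by (rule lborel_sphere.Fubini'[symmetric]) measurable
  also have "\<dots> = (\<integral>\<^sup>+\<xi>. 0 \<partial>(sphere_measure :: (real^'n) measure))"
  proof (rule nn_integral_cong)
    fix \<xi> :: "real^'n" assume "\<xi> \<in> space sphere_measure"
    then have "\<xi> \<noteq> 0" by auto
    then have "{x. \<xi> \<bullet> x = 0} \<in> null_sets lebesgue"
      using negligible_hyperplane[of \<xi> 0] by (simp add: negligible_iff_null_sets)
    then have "{x. \<xi> \<bullet> x = 0} \<in> null_sets lborel"
      by (simp add: null_sets_completion_iff closed_hyperplane borel_closed)
    then have "AE x in lborel. \<not> (\<xi> \<bullet> x = 0)"
      using AE_not_in by force
    then show "(\<integral>\<^sup>+x. indicator B x * h (x \<bullet> \<xi>) \<partial>lborel) = 0"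
      by (subst nn_integral_0_iff_AE) (auto simp: h_def inner_commute)
  qed
  finally have "emeasure lborel B * c = 0" by (simp add: nn_integral_multc)
  moreover have "emeasure lborel B = emeasure lborel (ball (0::real^'n) 1)"
    unfolding B_def by (rule emeasure_Diff_null_set) auto
  then have "emeasure lborel B = ennreal (unit_ball_vol (CARD('n)))"
    using emeasure_ball[of 1 "0::real^'n"] by simp
  ultimately have "c = 0" by (simp add: less_imp_neq[OF unit_ball_vol_pos, symmetric])
  then have "(\<integral>\<^sup>+\<xi>. h (z \<bullet> \<xi>) \<partial>sphere_measure) = 0" using c[OF z] by simp
  then have "AE \<xi> in sphere_measure. h (z \<bullet> \<xi>) = 0"
    by (subst (asm) nn_integral_0_iff_AE) auto
  then show ?thesis by (rule AE_mp) (auto simp: h_def indicator_def)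
qed

text \<open>If j < |ln |t|| and |t| < 1, then |t| < exp(-j) \<le> 2^(-j), so at least |ln |t|| many
  indicators equal 1. The factor 2 makes the term j = 0 cover 1 \<le> |t| \<le> 2, where |ln |t|| <
  1.\<close>

lemma abs_ln_le_suminf:
  fixes t :: real
  assumes "\<bar>t\<bar> \<le> 2"
  shows "ennreal \<bar>ln \<bar>t\<bar>\<bar> \<le> (\<Sum>j. indicator {s. \<bar>s\<bar> \<le> 2 * (1/2) ^ j} t)"
proof (cases "t = 0")
  case False
  define N where "N = nat \<lceil>\<bar>ln \<bar>t\<bar>\<bar>\<rceil>"
  have le: "\<bar>t\<bar> \<le> 2 * (1/2) ^ j" if "j < N" for j
  proof -
    have j: "real j < \<bar>ln \<bar>t\<bar>\<bar>" using that unfolding N_def by linarith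
    show ?thesis
    proof (cases "\<bar>t\<bar> < 1")
      case True
      then have "ln \<bar>t\<bar> < - real j" using j False by simp
      then have "\<bar>t\<bar> < exp (- real j)" using False by (metis exp_less_cancel_iff exp_ln zero_less_abs_iff)
      also have "\<dots> = exp (-1) ^ j" using exp_of_nat_mult[of j "-1::real"] by simp
      also have "\<dots> \<le> (1/2) ^ j"
        using exp_ge_add_one_self[of "1::real"] by (intro power_mono) (auto simp: exp_minus field_simps)
      finally show ?thesis using zero_le_power[of "1/2::real" j] by linarith
    next
      case False
      then have "\<bar>ln \<bar>t\<bar>\<bar> \<le> ln 2" using assms by simp
      also have "\<dots> < 1" using ln_2_less_1 by simp
      finally have "j = 0" using j by simp
      then show ?thesis using assms by simp
    qed
  qed
  have "ennreal \<bar>ln \<bar>t\<bar>\<bar> \<le> ennreal (real N)"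
    unfolding N_def by (intro ennreal_leI) linarith
  also have "\<dots> = (\<Sum>j<N. indicator {s. \<bar>s\<bar> \<le> 2 * (1/2) ^ j} t)"
    using le by (simp add: ennreal_of_nat_eq_real_of_nat)
  also have "\<dots> \<le> (\<Sum>j. indicator {s. \<bar>s\<bar> \<le> 2 * (1/2) ^ j} t)"
    by (rule sum_le_suminf) auto
  finally show ?thesis .
qed simp

text \<open>The logarithm is dominated by a sum of indicators of slabs of the cube [-2, 2]^n around
  the hyperplane z_k = 0; their volumes form a geometric series.\<close>

lemma nn_integral_ln_component_finite:
  fixes k :: "'n::finite"
  shows "(\<integral>\<^sup>+z. ennreal \<bar>ln \<bar>z \<bullet> axis k 1\<bar>\<bar> * indicator {..2} (norm (z :: real^'n)) \<partial>lborel) < top"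
proof -
  define C where "C j = cbox (\<chi> i. if i = k then - (2 * (1/2) ^ j) else -2) (\<chi> i. if i = k then 2 * (1/2) ^ j else 2 :: real^'n)"
    for j :: nat
  have C: "emeasure lborel (C j) = ennreal (4 ^ CARD('n) * (1/2) ^ j)" for j
  proof -
    let ?a = "(\<chi> i. if i = k then - (2 * (1/2) ^ j) else -2) :: real^'n"
    let ?b = "(\<chi> i. if i = k then 2 * (1/2) ^ j else 2) :: real^'n"
    have ne: "cbox ?a ?b \<noteq> {}" by (auto simp: interval_ne_empty_cart)
    have "measure lborel (cbox ?a ?b) = (\<Prod>i\<in>UNIV. ?b $ i - ?a $ i)"
      by (rule content_cbox_cart[OF ne])
    also have "\<dots> = (4 * (1/2) ^ j) * (\<Prod>i\<in>UNIV - {k}. 4)"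
      by (subst prod.remove[of UNIV k]) auto
    also have "\<dots> = 4 ^ Suc (CARD('n) - 1) * (1/2) ^ j"
      by (simp add: card_Diff_singleton del: Suc_pred)
    also have "Suc (CARD('n) - 1) = CARD('n)" by simp
    finally have "measure lborel (cbox ?a ?b) = 4 ^ CARD('n) * (1/2) ^ j" .
    then show ?thesis
      using emeasure_lborel_cbox_finite[of ?a ?b]
      by (simp add: C_def emeasure_eq_ennreal_measure less_top)
  qed
  have "(\<integral>\<^sup>+z. ennreal \<bar>ln \<bar>z \<bullet> axis k 1\<bar>\<bar> * indicator {..2} (norm (z :: real^'n)) \<partial>lborel)
      \<le> (\<integral>\<^sup>+z. (\<Sum>j. indicator (C j) z) \<partial>lborel)"
  proof (rule nn_integral_mono)
    fix z :: "real^'n"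
    show "ennreal \<bar>ln \<bar>z \<bullet> axis k 1\<bar>\<bar> * indicator {..2} (norm z) \<le> (\<Sum>j. indicator (C j) z)"
    proof (cases "norm z \<le> 2")
      case True
      have comp: "\<bar>z $ i\<bar> \<le> 2" for i using component_le_norm_cart[of z i] True by simp
      have "ennreal \<bar>ln \<bar>z $ k\<bar>\<bar> \<le> (\<Sum>j. indicator {s. \<bar>s\<bar> \<le> 2 * (1/2) ^ j} (z $ k))"
        by (rule abs_ln_le_suminf[OF comp])
      also have "\<dots> \<le> (\<Sum>j. indicator (C j) z)"
      proof (intro suminf_le allI)
        fix j
        show "indicator {s. \<bar>s\<bar> \<le> 2 * (1/2) ^ j} (z $ k) \<le> (indicator (C j) z :: ennreal)"
          using comp by (auto simp: C_def mem_box_cart abs_le_iff indicator_def minus_le_iff)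
      qed auto
      finally show ?thesis using True by (simp add: inner_axis)
    qed simp
  qed
  also have "\<dots> = (\<Sum>j. emeasure lborel (C j))"
    by (subst nn_integral_suminf) (auto simp: C_def)
  also have "\<dots> = ennreal (\<Sum>j. 4 ^ CARD('n) * (1/2) ^ j)"
    unfolding C by (rule suminf_ennreal2) (auto intro!: summable_mult summable_geometric)
  also have "\<dots> < top" by simp
  finally show ?thesis .
qed

text \<open>Integrated over the ball of radius 2 as well, the sphere integral of |ln |z . \<xi>|| is
  finite by Fubini, since for each \<xi> the Lebesgue integral is the finite one for a coordinate
  axis. So it is finite for some z \<noteq> 0, and rotation and scaling carry this over to
  e.\<close>

lemma integrable_sphere_ln_inner:
  fixes e :: "real^'n::finite"
  assumes e: "norm e = 1"
  shows "integrable sphere_measure (\<lambda>\<xi>. ln \<bar>e \<bullet> \<xi>\<bar>)"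
proof -
  have fS: "emeasure sphere_measure (sphere (0::real^'n) 1) < top"
    using sphere.emeasure_finite[of "sphere (0::real^'n) 1"] unfolding infinity_ennreal_def less_top .
  obtain k :: 'n where True by auto
  define h :: "real \<Rightarrow> ennreal" where "h t = ennreal \<bar>ln \<bar>t\<bar>\<bar>" for t
  have [measurable]: "h \<in> borel_measurable borel" unfolding h_def[abs_def] by measurable
  define \<rho> :: "real \<Rightarrow> ennreal" where "\<rho> = indicator {..2}"
  have [measurable]: "\<rho> \<in> borel_measurable borel" by (simp add: \<rho>_def)
  define I where "I = (\<integral>\<^sup>+z. h (z \<bullet> axis k 1) * \<rho> (norm (z :: real^'n)) \<partial>lborel)"
  have I: "I < top" unfolding I_def h_def \<rho>_def by (rule nn_integral_ln_component_finite)
  have "(\<integral>\<^sup>+z. (\<integral>\<^sup>+\<xi>. h (z \<bullet> \<xi>) * \<rho> (norm z) \<partial>sphere_measure) \<partial>(lborel :: (real^'n) measure))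
      = (\<integral>\<^sup>+\<xi>. (\<integral>\<^sup>+z. h (z \<bullet> \<xi>) * \<rho> (norm z) \<partial>lborel) \<partial>(sphere_measure :: (real^'n) measure))"
    by (rule lborel_sphere.Fubini'[symmetric]) measurable
  also have "\<dots> = (\<integral>\<^sup>+\<xi>. I \<partial>(sphere_measure :: (real^'n) measure))"
    unfolding I_def by (intro nn_integral_cong nn_integral_lborel_inner_unit) (auto simp: norm_axis_1)
  also have "\<dots> < top"
    using I fS by (simp add: ennreal_mult_less_top)
  finally have fin: "(\<integral>\<^sup>+z. (\<integral>\<^sup>+\<xi>. h (z \<bullet> \<xi>) * \<rho> (norm z) \<partial>sphere_measure) \<partial>(lborel :: (real^'n) measure)) < top" .
  have "AE z in (lborel :: (real^'n) measure). (\<integral>\<^sup>+\<xi>. h (z \<bullet> \<xi>) * \<rho> (norm z) \<partial>sphere_measure) \<noteq> \<infinity>"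
    by (rule nn_integral_PInf_AE) (use fin in auto)
  \<comment> \<open>A nonzero z is needed for the later normalisation; the punctured ball is open
    and nonempty, hence not null.\<close>
  then have "\<exists>z::real^'n. z \<in> ball 0 2 - {0} \<and> (\<integral>\<^sup>+\<xi>. h (z \<bullet> \<xi>) * \<rho> (norm z) \<partial>sphere_measure) \<noteq> \<infinity>"
  proof (rule contrapos_pp)
    assume *: "\<not> ?thesis"
    show "\<not> (AE z in (lborel :: (real^'n) measure). (\<integral>\<^sup>+\<xi>. h (z \<bullet> \<xi>) * \<rho> (norm z) \<partial>sphere_measure) \<noteq> \<infinity>)"
    proof
      assume "AE z in (lborel :: (real^'n) measure). (\<integral>\<^sup>+\<xi>. h (z \<bullet> \<xi>) * \<rho> (norm z) \<partial>sphere_measure) \<noteq> \<infinity>"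
      then have "AE z in (lborel :: (real^'n) measure). z \<notin> ball 0 2 - {0}"
        by (rule AE_mp) (use * in auto)
      then have "ball (0::real^'n) 2 - {0} \<in> null_sets lborel"
        by (subst AE_iff_null_sets) auto
      then have "negligible (ball (0::real^'n) 2 - {0})"
        by (simp add: negligible_iff_null_sets null_sets_completionI)
      moreover have "axis k 1 \<in> ball (0::real^'n) 2 - {0}"
        by (simp add: norm_axis_1 axis_eq_0_iff)
      ultimately show False
        using open_not_negligible[OF open_delete[OF open_ball]] by blast
    qed
  qed
  then obtain z :: "real^'n" where z: "z \<noteq> 0" "norm z < 2"
    and "(\<integral>\<^sup>+\<xi>. h (z \<bullet> \<xi>) * \<rho> (norm z) \<partial>sphere_measure) \<noteq> \<infinity>" by auto
  then have fin: "(\<integral>\<^sup>+\<xi>. h (z \<bullet> \<xi>) \<partial>sphere_measure) < top"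
    by (simp add: \<rho>_def less_top)
  define e' where "e' = z /\<^sub>R norm z"
  have e': "norm e' = 1" using z by (simp add: e'_def)
  have "(\<integral>\<^sup>+\<xi>. h (e \<bullet> \<xi>) \<partial>sphere_measure) = (\<integral>\<^sup>+\<xi>. h (e' \<bullet> \<xi>) \<partial>sphere_measure)"
    by (rule nn_integral_sphere_inner_unit) (use e e' in auto)
  also have "\<dots> \<le> (\<integral>\<^sup>+\<xi>. h (z \<bullet> \<xi>) + ennreal \<bar>ln (norm z)\<bar> \<partial>sphere_measure)"
  proof (rule nn_integral_mono)
    fix \<xi> :: "real^'n"
    \<comment> \<open>Scaling shifts the logarithm by ln |z|. Where z . \<xi> = 0 the left side is
      0, because ln 0 = 0.\<close>
    have "\<bar>ln \<bar>e' \<bullet> \<xi>\<bar>\<bar> \<le> \<bar>ln \<bar>z \<bullet> \<xi>\<bar>\<bar> + \<bar>ln (norm z)\<bar>"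
    proof (cases "z \<bullet> \<xi> = 0")
      case False
      then have "ln \<bar>e' \<bullet> \<xi>\<bar> = ln \<bar>z \<bullet> \<xi>\<bar> - ln (norm z)"
        using z by (simp add: e'_def abs_mult ln_mult ln_inverse)
      then show ?thesis by linarith
    qed (simp add: e'_def)
    then show "h (e' \<bullet> \<xi>) \<le> h (z \<bullet> \<xi>) + ennreal \<bar>ln (norm z)\<bar>"
      unfolding h_def by (simp flip: ennreal_plus)
  qed
  also have "\<dots> = (\<integral>\<^sup>+\<xi>. h (z \<bullet> \<xi>) \<partial>sphere_measure) + ennreal \<bar>ln (norm z)\<bar> * emeasure (sphere_measure :: (real^'n) measure) (space sphere_measure)"
    by (subst nn_integral_add) auto
  also have "\<dots> < top"
    using fin fS by (simp add: ennreal_mult_less_top)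
  finally have "(\<integral>\<^sup>+\<xi>. h (e \<bullet> \<xi>) \<partial>sphere_measure) < top" .
  then show ?thesis
    by (intro integrableI_bounded) (auto simp: h_def)
qed

section \<open>Spherical averages of a kernel\<close>

text \<open>The reflection in the hyperplane orthogonal to v, written without normalising v so that
  it is visibly rational in v.\<close>

definition householder :: "'a::real_inner \<Rightarrow> 'a \<Rightarrow> 'a" where
  "householder v x = x - (2 * (v \<bullet> x) / (v \<bullet> v)) *\<^sub>R v"

lemma orthogonal_transformation_householder:
  assumes "v \<noteq> 0"
  shows "orthogonal_transformation (householder v)"
  unfolding orthogonal_transformation_def
proof (intro conjI allI)
  show "linear (householder v)"
    by (rule linearI) (simp_all add: householder_def inner_add_right algebra_simps add_divide_distrib scaleR_add_left)
  fix x y :: 'a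
  define p q c where "p = v \<bullet> x" and "q = v \<bullet> y" and "c = v \<bullet> v"
  have c: "c \<noteq> 0" using assms by (simp add: c_def)
  have "householder v x \<bullet> householder v y = x \<bullet> y - 2 * q / c * p - 2 * p / c * q + 2 * p / c * (2 * q / c * c)"
    unfolding householder_def inner_diff_left inner_diff_right inner_scaleR_left inner_scaleR_right
      inner_commute[of x v] p_def[symmetric] q_def[symmetric] c_def[symmetric]
    by (simp add: algebra_simps)
  then show "householder v x \<bullet> householder v y = x \<bullet> y"
    using c by simp
qed

text \<open>Vectors of equal norm are exchanged by the reflection along their difference; here these
  are z and |z| e. The key relation is v . v = -2 |z| (v . e).\<close>

lemma householder_swap:
  fixes e z :: "'a::real_inner"
  assumes "norm e = 1" "z \<noteq> norm z *\<^sub>R e"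
  shows "norm z *\<^sub>R householder (z - norm z *\<^sub>R e) e = z"
proof -
  define v where "v = z - norm z *\<^sub>R e"
  have ee: "e \<bullet> e = 1" using assms(1) by (simp add: dot_square_norm)
  have zz: "z \<bullet> z = norm z * norm z" by (simp add: dot_square_norm power2_eq_square)
  have "v \<bullet> v = - 2 * norm z * (v \<bullet> e)"
    by (simp add: v_def inner_diff_left inner_diff_right ee zz inner_commute[of e z] algebra_simps)
  moreover have "v \<bullet> v \<noteq> 0" using assms(2) by (simp add: v_def)
  ultimately have c: "norm z * (2 * (v \<bullet> e) / (v \<bullet> v)) = -1"
    by (simp add: field_simps)
  have "norm z *\<^sub>R householder v e = norm z *\<^sub>R e - (norm z * (2 * (v \<bullet> e) / (v \<bullet> v))) *\<^sub>R v"
    by (simp add: householder_def scaleR_diff_right)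
  then show ?thesis unfolding c by (simp add: v_def)
qed

lemma smooth_on_norm:
  assumes "open U" "0 \<notin> U"
  shows "smooth_on k U (norm :: real^'n::finite \<Rightarrow> real)"
proof -
  have "smooth_on k U (\<lambda>z::real^'n. (z \<bullet> z) powr (1/2))"
    using assms by (intro param_smooth_powr smooth_on_inner_self) auto
  then show ?thesis by (simp add: norm_eq_sqrt_inner[abs_def] powr_half_sqrt)
qed

lemma param_smooth_symbol:
  assumes "open U" "\<And>i. param_smooth k U P (\<lambda>z p. H z p $ i)"
  shows "param_smooth k U P (\<lambda>z p. symbol m A (H z p))"
  unfolding symbol_def using assms
  by (intro param_smooth_sum param_smooth_mult param_smooth_const param_smooth_prod_list)

text \<open>Treats |t| (a r = r, b = 0) and ln |t| (a = 1, b = ln) at once. The law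
  \<open>u_mult\<close> leaves out s = 0, where it fails for the logarithm with ln 0 = 0; almost
  every \<xi> is enough. \<open>Q_smooth\<close> is stated for compositions because Q is evaluated
  at a reflected point that depends on z.\<close>

locale sphere_kernel =
  fixes u a b :: "real \<Rightarrow> real" and Q :: "real^'n::finite \<Rightarrow> real" and e :: "real^'n"
  assumes dim: "CARD('n) \<ge> 2"
    and norm_e: "norm e = 1"
    and u_measurable [measurable]: "u \<in> borel_measurable borel"
    and u_mult: "\<And>r s. r > 0 \<Longrightarrow> s \<noteq> 0 \<Longrightarrow> u (r * s) = a r * u s + b r"
    and a_smooth: "\<And>k. smooth_on k (-{0}) (\<lambda>z::real^'n. a (norm z))"
    and b_smooth: "\<And>k. smooth_on k (-{0}) (\<lambda>z::real^'n. b (norm z))"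
    and u_integrable: "integrable sphere_measure (\<lambda>\<xi>. u (e \<bullet> \<xi>))"
    and Q_pos: "\<And>\<xi>. \<xi> \<in> sphere 0 1 \<Longrightarrow> Q \<xi> > 0"
    and Q_smooth: "\<And>k U (H :: real^'n \<Rightarrow> real^'n \<Rightarrow> real^'n). open U \<Longrightarrow>
        (\<And>i. param_smooth k U (sphere 0 1) (\<lambda>z \<eta>. H z \<eta> $ i)) \<Longrightarrow>
        param_smooth k U (sphere 0 1) (\<lambda>z \<eta>. Q (H z \<eta>))"
begin

definition F :: "real^'n \<Rightarrow> real" where
  "F z = (\<integral>\<xi>. u (z \<bullet> \<xi>) / Q \<xi> \<partial>sphere_measure)"

definition F1 :: "real^'n \<Rightarrow> real" where
  "F1 z = (\<integral>\<xi>. u (z \<bullet> \<xi>) \<partial>sphere_measure)"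

definition total :: real where
  "total = measure sphere_measure (sphere (0::real^'n) 1)"

definition mean :: real where
  "mean = (\<integral>\<xi>. u (e \<bullet> \<xi>) \<partial>sphere_measure)"

lemma total_pos: "total > 0"
proof -
  have "emeasure sphere_measure (sphere (0::real^'n) 1) = ennreal total"
    unfolding total_def by (rule sphere.emeasure_eq_measure)
  then show ?thesis using emeasure_sphere_measure_pos[OF dim] by simp
qed

lemma Q_continuous: "continuous_on (sphere 0 1) Q"
proof -
  have comp: "param_smooth 0 UNIV (sphere 0 1) (\<lambda>z \<eta>::real^'n. \<eta> $ i)" for i
    by (rule param_smooth_param) (auto intro!: continuous_intros)
  have "param_smooth 0 (UNIV :: (real^'n) set) (sphere 0 1) (\<lambda>z \<eta>. Q \<eta>)"
    by (rule Q_smooth[OF open_UNIV comp])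
  then have *: "continuous_on (UNIV \<times> sphere 0 1) (\<lambda>(z::real^'n, \<eta>). Q \<eta>)"
    by (rule param_smooth_continuous)
  have "continuous_on (sphere 0 1) (\<lambda>\<eta>. (\<lambda>(z::real^'n, \<eta>). Q \<eta>) (0, \<eta>))"
    by (rule continuous_on_compose2[OF *]) (auto intro!: continuous_intros)
  then show ?thesis by simp
qed

lemma Q_measurable [measurable]: "Q \<in> borel_measurable sphere_measure"
proof -
  have "Q \<in> borel_measurable (restrict_space borel (sphere 0 1))"
    by (rule borel_measurable_continuous_on_restrict[OF Q_continuous])
  then show ?thesis using measurable_cong_sets[OF sets_sphere_measure refl] by blast
qed

lemma inverse_Q_bounded: obtains G where "G > 0" "\<And>\<xi>. \<xi> \<in> sphere 0 1 \<Longrightarrow> \<bar>1 / Q \<xi>\<bar> \<le> G"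
proof -
  have "continuous_on (sphere 0 1) (\<lambda>\<xi>. 1 / Q \<xi>)"
    using Q_pos by (intro continuous_intros Q_continuous) (auto simp: less_imp_neq[symmetric])
  then have "bounded ((\<lambda>\<xi>. 1 / Q \<xi>) ` sphere 0 1)"
    by (intro compact_imp_bounded compact_continuous_image) auto
  then show thesis unfolding bounded_pos using that by auto
qed

lemma integrable_inverse_Q: "integrable sphere_measure (\<lambda>\<xi>. 1 / Q \<xi>)"
proof -
  obtain G where "\<And>\<xi>. \<xi> \<in> sphere 0 1 \<Longrightarrow> \<bar>1 / Q \<xi>\<bar> \<le> G" using inverse_Q_bounded by blast
  then show ?thesis by (intro sphere.integrable_const_bound[where B=G] AE_I2) auto
qed

lemma integral_inverse_Q_pos: "(\<integral>\<xi>. 1 / Q \<xi> \<partial>sphere_measure) > 0"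
proof -
  have nn: "AE \<xi> in sphere_measure. 0 \<le> 1 / Q \<xi>" using Q_pos by (intro AE_I2) (auto simp: less_imp_le)
  have "(\<integral>\<xi>. 1 / Q \<xi> \<partial>sphere_measure) \<noteq> 0"
  proof
    assume "(\<integral>\<xi>. 1 / Q \<xi> \<partial>sphere_measure) = 0"
    then have "AE \<xi> in sphere_measure. 1 / Q \<xi> = 0"
      using integral_nonneg_eq_0_iff_AE[OF integrable_inverse_Q nn] by simp
    moreover have "AE \<xi> in sphere_measure. 1 / Q \<xi> \<noteq> 0"
      using Q_pos by (intro AE_I2) (auto simp: less_imp_neq[symmetric])
    ultimately have "AE \<xi>::real^'n in sphere_measure. False" by eventually_elim simp
    then have "emeasure sphere_measure (space (sphere_measure :: (real^'n) measure)) = 0"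
      by (subst (asm) AE_iff_measurable[OF sets.top]) auto
    then show False using emeasure_sphere_measure_pos[OF dim] by simp
  qed
  moreover have "(\<integral>\<xi>. 1 / Q \<xi> \<partial>sphere_measure) \<ge> 0" by (rule integral_nonneg_AE[OF nn])
  ultimately show ?thesis by linarith
qed

lemma u_AE:
  assumes z: "z \<noteq> 0" and T: "orthogonal_transformation T" "norm z *\<^sub>R T e = z"
  shows "AE \<eta> in sphere_measure. u (z \<bullet> T \<eta>) = a (norm z) * u (e \<bullet> \<eta>) + b (norm z)"
proof -
  have eq: "z \<bullet> T \<eta> = norm z * (e \<bullet> \<eta>)" for \<eta>
    using T(2) orthogonal_transformation_inner[OF T(1), of e \<eta>] by (metis inner_scaleR_left)
  have "e \<noteq> 0" using norm_e by auto
  show ?thesis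
    by (rule AE_mp[OF AE_sphere_inner_nonzero[OF \<open>e \<noteq> 0\<close>]]) (use z in \<open>auto simp: eq u_mult\<close>)
qed

lemma rotation_to:
  fixes z :: "real^'n"
  obtains T where "orthogonal_transformation T" "norm z *\<^sub>R T e = z"
proof (cases "z = 0")
  case True
  then show ?thesis using that[OF orthogonal_transformation_id] by simp
next
  case False
  then have "norm e = norm (z /\<^sub>R norm z)" using norm_e by simp
  then obtain T where "orthogonal_transformation T" "T e = z /\<^sub>R norm z"
    using orthogonal_transformation_exists by blast
  then show ?thesis using that[of T] False by simp
qed

text \<open>A rotation taking e to z/|z| turns u (z . \<xi>) into a multiple of u (e . \<xi>) plus a
  constant, almost everywhere. The bound provides the majorant for Fubini; the last formula shows
  that \<open>F1\<close> is radial and explicit.\<close>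

lemma integrable_u_inner:
  assumes z: "z \<noteq> 0"
  shows "integrable sphere_measure (\<lambda>\<xi>. u (z \<bullet> \<xi>))"
    and "(\<integral>\<xi>. \<bar>u (z \<bullet> \<xi>)\<bar> \<partial>sphere_measure) \<le>
      \<bar>a (norm z)\<bar> * (\<integral>\<xi>. \<bar>u (e \<bullet> \<xi>)\<bar> \<partial>sphere_measure) + \<bar>b (norm z)\<bar> * total"
    and "F1 z = a (norm z) * mean + b (norm z) * total"
proof -
  obtain T where T: "orthogonal_transformation T" "norm z *\<^sub>R T e = z" by (rule rotation_to)
  have [measurable]: "T \<in> sphere_measure \<rightarrow>\<^sub>M sphere_measure"
    by (rule measurable_orthogonal_sphere_measure[OF T(1)])
  have [measurable]: "T \<in> sphere_measure \<rightarrow>\<^sub>M borel"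
    using measurable_comp[OF measurable_orthogonal_sphere_measure[OF T(1)] measurable_ident_sphere_measure]
    by (simp add: comp_def)
  have int: "integrable sphere_measure (\<lambda>\<eta>. a (norm z) * u (e \<bullet> \<eta>) + b (norm z))"
    using u_integrable by auto
  then have "integrable sphere_measure (\<lambda>\<eta>. u (z \<bullet> T \<eta>))"
    by (subst integrable_cong_AE[OF _ _ u_AE[OF z T]]) auto
  then have "integrable (distr sphere_measure sphere_measure T) (\<lambda>\<xi>. u (z \<bullet> \<xi>))"
    by (subst integrable_distr_eq) auto
  then show "integrable sphere_measure (\<lambda>\<xi>. u (z \<bullet> \<xi>))"
    by (simp add: distr_orthogonal_sphere_measure[OF T(1)])
  have "F1 z = (\<integral>\<eta>. u (z \<bullet> T \<eta>) \<partial>sphere_measure)"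
    unfolding F1_def by (rule integral_sphere_orthogonal[OF T(1), symmetric]) measurable
  also have "\<dots> = (\<integral>\<eta>. a (norm z) * u (e \<bullet> \<eta>) + b (norm z) \<partial>sphere_measure)"
    by (rule integral_cong_AE[OF _ _ u_AE[OF z T]]) auto
  also have "\<dots> = a (norm z) * mean + b (norm z) * total"
    using u_integrable by (simp add: mean_def total_def mult.commute)
  finally show "F1 z = a (norm z) * mean + b (norm z) * total" .
  have "(\<integral>\<xi>. \<bar>u (z \<bullet> \<xi>)\<bar> \<partial>sphere_measure) = (\<integral>\<eta>. \<bar>u (z \<bullet> T \<eta>)\<bar> \<partial>sphere_measure)"
    by (rule integral_sphere_orthogonal[OF T(1), symmetric]) measurable
  also have "\<dots> = (\<integral>\<eta>. \<bar>a (norm z) * u (e \<bullet> \<eta>) + b (norm z)\<bar> \<partial>sphere_measure)"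
    by (rule integral_cong_AE) (use u_AE[OF z T] in auto)
  also have "\<dots> \<le> (\<integral>\<eta>. \<bar>a (norm z)\<bar> * \<bar>u (e \<bullet> \<eta>)\<bar> + \<bar>b (norm z)\<bar> \<partial>sphere_measure)"
    using u_integrable
    by (intro integral_mono) (auto simp flip: abs_mult intro: abs_triangle_ineq)
  also have "\<dots> = \<bar>a (norm z)\<bar> * (\<integral>\<xi>. \<bar>u (e \<bullet> \<xi>)\<bar> \<partial>sphere_measure) + \<bar>b (norm z)\<bar> * total"
    using u_integrable by (simp add: total_def mult.commute)
  finally show "(\<integral>\<xi>. \<bar>u (z \<bullet> \<xi>)\<bar> \<partial>sphere_measure) \<le>
      \<bar>a (norm z)\<bar> * (\<integral>\<xi>. \<bar>u (e \<bullet> \<xi>)\<bar> \<partial>sphere_measure) + \<bar>b (norm z)\<bar> * total" .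
qed

lemma F1_smooth: "smooth_on k (-{0}) F1"
proof (rule smooth_on_cong_imp)
  show "smooth_on k (-{0}) (\<lambda>z::real^'n. mean * a (norm z) + total * b (norm z))"
    by (intro param_smooth_add param_smooth_cmult a_smooth b_smooth) auto
qed (auto simp: integrable_u_inner(3) mult.commute)

text \<open>Moving \<open>z\<close> to a fixed axis by a reflection depending smoothly on \<open>z\<close> shifts the dependence on
  \<open>z\<close> from the singular factor \<open>u\<close> to the smooth factor \<open>1 / Q\<close>.\<close>

lemma F_smooth: "smooth_on k (-{0}) F"
proof (rule smooth_on_local)
  fix z0 :: "real^'n" assume "z0 \<in> -{0}"
  then have z0: "z0 \<noteq> 0" by simp
  \<comment> \<open>The target axis e' points opposite to z0. Then z - |z| e', the vector along
    which to reflect, is nonzero for all z near z0.\<close>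
  obtain T where T: "orthogonal_transformation T" "norm (- z0) *\<^sub>R T e = - z0" by (rule rotation_to)
  define e' where "e' = T e"
  have e': "norm e' = 1" by (simp add: e'_def orthogonal_transformation_norm[OF T(1)] norm_e)
  have z0e: "z0 = - (norm z0 *\<^sub>R e')" using T(2) by (simp add: e'_def)
  \<comment> \<open>Here z . z0 > 0, while a nonnegative multiple of e' has z . z0 \<le> 0; so
    \<open>v\<close> has no zero on U.\<close>
  define U where "U = {z. z0 \<bullet> z > 0}"
  have U: "open U" unfolding U_def by (rule open_halfspace_gt)
  have Un0: "0 \<notin> U" by (simp add: U_def)
  have z0U: "z0 \<in> U" using z0 by (simp add: U_def)
  define v where "v z = z - norm z *\<^sub>R e'" for z
  have v0: "v z \<noteq> 0" if "z \<in> U" for z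
  proof
    assume "v z = 0"
    then have "z0 \<bullet> z = norm z * (z0 \<bullet> e')" unfolding v_def by (metis eq_iff_diff_eq_0 inner_scaleR_right)
    also have "z0 \<bullet> e' = - norm z0"
      by (subst z0e) (use e' in \<open>simp add: dot_square_norm\<close>)
    finally have "z0 \<bullet> z \<le> 0" by simp
    then show False using that by (simp add: U_def)
  qed
  have vs: "param_smooth k U (sphere 0 1) (\<lambda>z \<eta>. v z $ i)" for k i
  proof -
    have "smooth_on k U (\<lambda>z. z $ i - norm z * e' $ i)"
      by (intro param_smooth_diff[OF U] param_smooth_component[OF U] param_smooth_mult[OF U]
          param_smooth_const[OF U] smooth_on_norm[OF U Un0])
    then show ?thesis
      by (simp add: v_def param_smooth_of_smooth_on)
  qed
  define H where "H z = householder (v z)" for z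
  have Hs: "param_smooth k U (sphere 0 1) (\<lambda>z \<eta>. H z \<eta> $ i)" for k i
  proof -
    have "param_smooth k U (sphere 0 1) (\<lambda>z \<eta>. v z \<bullet> v z)"
      unfolding inner_vec_def using vs
      by (auto intro!: param_smooth_sum[OF U] param_smooth_mult[OF U])
    then have vv: "param_smooth k U (sphere 0 1) (\<lambda>z \<eta>. (v z \<bullet> v z) powr (-1))"
      using v0 by (intro param_smooth_powr[OF U]) auto
    have \<eta>: "param_smooth k U (sphere 0 1) (\<lambda>z \<eta>. \<eta> $ j)" for j
      by (rule param_smooth_param[OF U]) (auto intro!: continuous_intros)
    have ve: "param_smooth k U (sphere 0 1) (\<lambda>z \<eta>. v z \<bullet> \<eta>)"
      unfolding inner_vec_def using vs \<eta>
      by (auto intro!: param_smooth_sum[OF U] param_smooth_mult[OF U])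
    have "param_smooth k U (sphere 0 1) (\<lambda>z \<eta>. \<eta> $ i - 2 * ((v z \<bullet> \<eta>) * (v z \<bullet> v z) powr (-1)) * v z $ i)"
      by (intro param_smooth_diff[OF U] param_smooth_mult[OF U] param_smooth_const[OF U] vs vv ve \<eta>)
    then show ?thesis
      by (rule param_smooth_cong_imp[OF U, rotated])
        (use v0 in \<open>simp add: H_def householder_def powr_minus_divide\<close>)
  qed
  have HT: "orthogonal_transformation (H z)" if "z \<in> U" for z
    unfolding H_def using v0[OF that] by (rule orthogonal_transformation_householder)
  have He: "norm z *\<^sub>R H z e' = z" if "z \<in> U" for z
    using householder_swap[OF e', of z] v0[OF that] by (simp add: H_def v_def)
  have HS: "H z \<eta> \<in> sphere 0 1" if "z \<in> U" "\<eta> \<in> sphere 0 1" for z \<eta>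
    using that orthogonal_transformation_norm[OF HT] by auto
  have gs: "param_smooth k U (sphere 0 1) (\<lambda>z \<eta>. 1 / Q (H z \<eta>))" for k
  proof -
    have "param_smooth k U (sphere 0 1) (\<lambda>z \<eta>. Q (H z \<eta>) powr (-1))"
      using HS Q_pos by (intro param_smooth_powr[OF U] Q_smooth[OF U Hs]) blast+
    then show ?thesis
    proof (rule param_smooth_cong_imp[OF U, rotated])
      fix z \<eta> :: "real^'n" assume "z \<in> U" "\<eta> \<in> sphere 0 1"
      then have "Q (H z \<eta>) > 0" by (intro Q_pos HS)
      then show "Q (H z \<eta>) powr (-1) = 1 / Q (H z \<eta>)" by (simp add: powr_minus_divide)
    qed
  qed
  have e'_int: "integrable sphere_measure (\<lambda>\<xi>. u (e' \<bullet> \<xi>))"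
    by (rule integrable_u_inner) (use e' in auto)
  \<comment> \<open>After the substitution \<xi> = H z \<eta> the singular weight u (e' . \<eta>) is
    independent of z. The factor 1 in the second integral is the weight w of
    \<open>smooth_on_integral\<close>.\<close>
  have F_eq: "F z = a (norm z) * (\<integral>\<eta>. u (e' \<bullet> \<eta>) * (1 / Q (H z \<eta>)) \<partial>sphere_measure)
      + b (norm z) * (\<integral>\<eta>. 1 * (1 / Q (H z \<eta>)) \<partial>sphere_measure)" if z: "z \<in> U" for z
  proof -
    have zn: "z \<noteq> 0" using z Un0 by auto
    have [measurable]: "H z \<in> sphere_measure \<rightarrow>\<^sub>M sphere_measure"
      by (rule measurable_orthogonal_sphere_measure[OF HT[OF z]])
    have [measurable]: "H z \<in> sphere_measure \<rightarrow>\<^sub>M borel"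
      using measurable_comp[OF measurable_orthogonal_sphere_measure[OF HT[OF z]] measurable_ident_sphere_measure]
      by (simp add: comp_def)
    have i1: "integrable sphere_measure (\<lambda>\<eta>. u (e' \<bullet> \<eta>) * (1 / Q (H z \<eta>)))"
      by (rule param_smooth_integrable[OF gs z _ sets_sphere_measure e'_int]) simp
    have i2: "integrable sphere_measure (\<lambda>\<eta>. 1 * (1 / Q (H z \<eta>)))"
      by (rule param_smooth_integrable[OF gs z _ sets_sphere_measure]) auto
    have inner: "z \<bullet> H z \<eta> = norm z * (e' \<bullet> \<eta>)" for \<eta>
      using He[OF z] orthogonal_transformation_inner[OF HT[OF z], of e' \<eta>] by (metis inner_scaleR_left)
    have ae: "AE \<eta> in sphere_measure. u (z \<bullet> H z \<eta>) = a (norm z) * u (e' \<bullet> \<eta>) + b (norm z)"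
      by (rule AE_mp[OF AE_sphere_inner_nonzero[of e']]) (use zn e' in \<open>auto simp: inner u_mult\<close>)
    have "F z = (\<integral>\<eta>. u (z \<bullet> H z \<eta>) / Q (H z \<eta>) \<partial>sphere_measure)"
      unfolding F_def by (rule integral_sphere_orthogonal[OF HT[OF z], symmetric]) measurable
    also have "\<dots> = (\<integral>\<eta>. a (norm z) * (u (e' \<bullet> \<eta>) * (1 / Q (H z \<eta>))) + b (norm z) * (1 * (1 / Q (H z \<eta>))) \<partial>sphere_measure)"
    proof (rule integral_cong_AE)
      show "AE \<eta> in sphere_measure. u (z \<bullet> H z \<eta>) / Q (H z \<eta>) =
          a (norm z) * (u (e' \<bullet> \<eta>) * (1 / Q (H z \<eta>))) + b (norm z) * (1 * (1 / Q (H z \<eta>)))"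
        using ae by eventually_elim (simp add: add_divide_distrib)
    qed measurable
    also have "\<dots> = a (norm z) * (\<integral>\<eta>. u (e' \<bullet> \<eta>) * (1 / Q (H z \<eta>)) \<partial>sphere_measure)
      + b (norm z) * (\<integral>\<eta>. 1 * (1 / Q (H z \<eta>)) \<partial>sphere_measure)"
    proof -
      have "(\<integral>\<eta>. c * f \<eta> + d * g \<eta> \<partial>M) = c * (\<integral>\<eta>. f \<eta> \<partial>M) + d * (\<integral>\<eta>. g \<eta> \<partial>M)"
        if "integrable M f" "integrable M g" for M and f g :: "real^'n \<Rightarrow> real" and c d
        using that by simp
      from this[OF i1 i2] show ?thesis .
    qed
    finally show ?thesis .
  qed
  have "smooth_on k U F"
  proof (rule smooth_on_cong_imp[OF U F_eq[symmetric]])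
    have "U \<subseteq> - {0}" using Un0 by auto
    then have "smooth_on k U (\<lambda>z. a (norm z))" "smooth_on k U (\<lambda>z. b (norm z))"
      by (auto intro: param_smooth_subset[OF a_smooth] param_smooth_subset[OF b_smooth])
    moreover have "smooth_on k U (\<lambda>z. \<integral>\<eta>. u (e' \<bullet> \<eta>) * (1 / Q (H z \<eta>)) \<partial>sphere_measure)"
      by (rule smooth_on_integral[OF U _ sets_sphere_measure e'_int gs]) simp
    moreover have "smooth_on k U (\<lambda>z. \<integral>\<eta>. 1 * (1 / Q (H z \<eta>)) \<partial>sphere_measure)"
      by (rule smooth_on_integral[OF U _ sets_sphere_measure _ gs]) auto
    ultimately show "smooth_on k U (\<lambda>z. a (norm z) * (\<integral>\<eta>. u (e' \<bullet> \<eta>) * (1 / Q (H z \<eta>)) \<partial>sphere_measure)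
      + b (norm z) * (\<integral>\<eta>. 1 * (1 / Q (H z \<eta>)) \<partial>sphere_measure))"
      by (intro param_smooth_add[OF U] param_smooth_mult[OF U])
  qed
  then show "\<exists>V. open V \<and> z0 \<in> V \<and> smooth_on k V F" using U z0U by blast
qed

end

section \<open>Positivity\<close>

lemma continuous_bump: "continuous_on S (bump q N)"
  unfolding bump_def by (intro continuous_intros)

lemma borel_measurable_bump [measurable]: "bump q N \<in> borel_measurable borel"
  by (rule borel_measurable_continuous_onI[OF continuous_bump])

lemma continuous_bump_inner: "continuous_on UNIV (\<lambda>z::real^'n::finite. bump q N (z \<bullet> z))"
  by (rule continuous_on_compose2[OF continuous_bump[of UNIV]]) (auto intro!: continuous_intros)

lemma integral_lborel_inner_sphere:
  fixes \<xi> e :: "real^'n::finite" and u \<rho> :: "real \<Rightarrow> real"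
  assumes [measurable]: "u \<in> borel_measurable borel" "\<rho> \<in> borel_measurable borel"
    and "norm e = 1" "norm \<xi> = 1"
  shows "(\<integral>z. u (z \<bullet> \<xi>) * \<rho> (z \<bullet> z) \<partial>lborel) = (\<integral>z. u (z \<bullet> e) * \<rho> (z \<bullet> z) \<partial>lborel)"
proof -
  obtain T where T: "orthogonal_transformation T" "T e = \<xi>"
    using orthogonal_transformation_exists_1[OF assms(3,4)] by blast
  have "(\<integral>z. u (z \<bullet> \<xi>) * \<rho> (z \<bullet> z) \<partial>lborel) = (\<integral>z. u (z \<bullet> \<xi>) * \<rho> (z \<bullet> z) \<partial>distr lborel borel T)"
    by (simp add: lborel_distr_orthogonal[OF T(1)])
  also have "\<dots> = (\<integral>z. u (T z \<bullet> \<xi>) * \<rho> (T z \<bullet> T z) \<partial>lborel)"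
  proof (rule integral_distr)
    show "T \<in> lborel \<rightarrow>\<^sub>M borel" using borel_measurable_orthogonal[OF T(1)] by simp
    show "(\<lambda>z. u (z \<bullet> \<xi>) * \<rho> (z \<bullet> z)) \<in> borel_measurable borel" by measurable
  qed
  also have "\<dots> = (\<integral>z. u (z \<bullet> e) * \<rho> (z \<bullet> z) \<partial>lborel)"
    using orthogonal_transformation_inner[OF T(1)] unfolding T(2)[symmetric] by simp
  finally show ?thesis .
qed

context sphere_kernel
begin

text \<open>After Fubini the inner Lebesgue integral is the same for all \<xi> by rotation
  invariance, so it factors out of the sphere integral. The weight w is kept general, to be used
  with \<open>1 / Q\<close> and with 1.\<close>

lemma integral_average_bump:
  fixes w :: "real^'n \<Rightarrow> real"
  assumes [measurable]: "w \<in> borel_measurable sphere_measure" and w: "\<And>\<xi>. \<xi> \<in> sphere 0 1 \<Longrightarrow> \<bar>w \<xi>\<bar> \<le> G"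
  shows "(\<integral>z. (\<integral>\<xi>. u (z \<bullet> \<xi>) * w \<xi> \<partial>sphere_measure) * bump r 1 (z \<bullet> z) \<partial>lborel) =
    (\<integral>z. u (z \<bullet> e) * bump r 1 (z \<bullet> z) \<partial>lborel) * (\<integral>\<xi>. w \<xi> \<partial>sphere_measure)"
proof -
  let ?\<rho> = "\<lambda>z::real^'n. bump r 1 (z \<bullet> z)"
  define c where "c = (\<integral>\<xi>. \<bar>u (e \<bullet> \<xi>)\<bar> \<partial>sphere_measure)"
  have bound: "(\<integral>\<xi>. norm (u (z \<bullet> \<xi>) * w \<xi> * ?\<rho> z) \<partial>sphere_measure)
      \<le> G * (\<bar>a (norm z)\<bar> * c + \<bar>b (norm z)\<bar> * total) * \<bar>?\<rho> z\<bar>" for z :: "real^'n"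
  proof (cases "z = 0")
    case True
    then have "?\<rho> z = 0" by (intro bump_eq_0) auto
    then show ?thesis by simp
  next
    case False
    have G: "G \<ge> 0" using w[of e] norm_e by simp
    have int: "integrable sphere_measure (\<lambda>\<xi>. u (z \<bullet> \<xi>))" by (rule integrable_u_inner[OF False])
    have "(\<integral>\<xi>. norm (u (z \<bullet> \<xi>) * w \<xi> * ?\<rho> z) \<partial>sphere_measure)
        \<le> (\<integral>\<xi>. G * \<bar>?\<rho> z\<bar> * \<bar>u (z \<bullet> \<xi>)\<bar> \<partial>sphere_measure)"
    proof (rule integral_mono_AE')
      show "AE \<xi> in sphere_measure. norm (u (z \<bullet> \<xi>) * w \<xi> * ?\<rho> z) \<le> G * \<bar>?\<rho> z\<bar> * \<bar>u (z \<bullet> \<xi>)\<bar>"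
      proof (rule AE_I2)
        fix \<xi> :: "real^'n" assume "\<xi> \<in> space sphere_measure"
        then have "\<bar>w \<xi>\<bar> * (\<bar>?\<rho> z\<bar> * \<bar>u (z \<bullet> \<xi>)\<bar>) \<le> G * (\<bar>?\<rho> z\<bar> * \<bar>u (z \<bullet> \<xi>)\<bar>)"
          using w by (intro mult_right_mono) auto
        then show "norm (u (z \<bullet> \<xi>) * w \<xi> * ?\<rho> z) \<le> G * \<bar>?\<rho> z\<bar> * \<bar>u (z \<bullet> \<xi>)\<bar>"
          by (simp add: abs_mult mult.commute mult.left_commute)
      qed
    qed (use int G in auto)
    also have "\<dots> = G * \<bar>?\<rho> z\<bar> * (\<integral>\<xi>. \<bar>u (z \<bullet> \<xi>)\<bar> \<partial>sphere_measure)" by simp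
    also have "\<dots> \<le> G * \<bar>?\<rho> z\<bar> * (\<bar>a (norm z)\<bar> * c + \<bar>b (norm z)\<bar> * total)"
      using G unfolding c_def by (intro mult_left_mono integrable_u_inner(2)[OF False]) auto
    finally show ?thesis by (simp add: mult.commute mult.left_commute)
  qed
  \<comment> \<open>a and b may be singular at the origin, as ln is; the bump vanishes near it, so
    the majorant extends to a continuous function with compact support.\<close>
  have bound_int: "integrable lborel (\<lambda>z::real^'n. G * (\<bar>a (norm z)\<bar> * c + \<bar>b (norm z)\<bar> * total) * \<bar>?\<rho> z\<bar>)"
  proof (rule integrable_compact_support[where R=2])
    have "smooth_on 0 UNIV (\<lambda>z::real^'n. (G * (\<bar>a (norm z)\<bar> * c + \<bar>b (norm z)\<bar> * total)) * \<bar>?\<rho> z\<bar>)"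
    proof (rule smooth_on_mult_extend)
      show "smooth_on 0 (-{0}) (\<lambda>z::real^'n. G * (\<bar>a (norm z)\<bar> * c + \<bar>b (norm z)\<bar> * total))"
        using a_smooth[of 0] b_smooth[of 0] unfolding smooth_on_0 by (intro continuous_intros)
      show "smooth_on 0 UNIV (\<lambda>z::real^'n. \<bar>?\<rho> z\<bar>)"
        unfolding smooth_on_0 by (intro continuous_intros continuous_bump_inner)
    qed (auto intro!: bump_eq_0)
    then show "continuous_on UNIV (\<lambda>z::real^'n. G * (\<bar>a (norm z)\<bar> * c + \<bar>b (norm z)\<bar> * total) * \<bar>?\<rho> z\<bar>)"
      by (simp add: smooth_on_0)
  qed (auto intro!: bump_eq_0)
  have Km: "(\<lambda>(z, \<xi>). u (z \<bullet> \<xi>) * w \<xi> * ?\<rho> z) \<in> borel_measurable (lborel \<Otimes>\<^sub>M sphere_measure)"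
    unfolding split_def by measurable
  have Ki: "integrable (lborel \<Otimes>\<^sub>M sphere_measure) (\<lambda>(z, \<xi>). u (z \<bullet> \<xi>) * w \<xi> * ?\<rho> z)"
  proof (rule lborel_sphere.Fubini_integrable[OF Km])
    have m: "(\<lambda>z. \<integral>\<xi>. norm (case (z, \<xi>) of (z, \<xi>) \<Rightarrow> u (z \<bullet> \<xi>) * w \<xi> * ?\<rho> z) \<partial>sphere_measure) \<in> borel_measurable lborel"
      by (rule sphere.borel_measurable_lebesgue_integral) (use Km in \<open>simp add: split_def\<close>)
    show "integrable lborel (\<lambda>z. \<integral>\<xi>. norm (case (z, \<xi>) of (z, \<xi>) \<Rightarrow> u (z \<bullet> \<xi>) * w \<xi> * ?\<rho> z) \<partial>sphere_measure)"
    proof (rule Bochner_Integration.integrable_bound[OF bound_int m], rule AE_I2)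
      fix z :: "real^'n"
      have "0 \<le> (\<integral>\<xi>. norm (u (z \<bullet> \<xi>) * w \<xi> * ?\<rho> z) \<partial>sphere_measure)" by simp
      with bound[of z] show "norm (\<integral>\<xi>. norm (case (z, \<xi>) of (z, \<xi>) \<Rightarrow> u (z \<bullet> \<xi>) * w \<xi> * ?\<rho> z) \<partial>sphere_measure)
          \<le> norm (G * (\<bar>a (norm z)\<bar> * c + \<bar>b (norm z)\<bar> * total) * \<bar>?\<rho> z\<bar>)"
        by (simp only: prod.case real_norm_def) linarith
    qed
    show "AE z in lborel. integrable sphere_measure (\<lambda>\<xi>. case (z, \<xi>) of (z, \<xi>) \<Rightarrow> u (z \<bullet> \<xi>) * w \<xi> * ?\<rho> z)"
    proof (rule AE_I2)
      fix z :: "real^'n"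
      show "integrable sphere_measure (\<lambda>\<xi>. case (z, \<xi>) of (z, \<xi>) \<Rightarrow> u (z \<bullet> \<xi>) * w \<xi> * ?\<rho> z)"
      proof (cases "z = 0")
        case True
        then have "?\<rho> z = 0" by (intro bump_eq_0) auto
        then show ?thesis by simp
      next
        case False
        have "integrable sphere_measure (\<lambda>\<xi>. u (z \<bullet> \<xi>) * w \<xi>)"
        proof (rule Bochner_Integration.integrable_bound[of _ "\<lambda>\<xi>. G * u (z \<bullet> \<xi>)"])
          show "AE \<xi> in sphere_measure. norm (u (z \<bullet> \<xi>) * w \<xi>) \<le> norm (G * u (z \<bullet> \<xi>))"
          proof (rule AE_I2)
            fix \<xi> :: "real^'n" assume "\<xi> \<in> space sphere_measure"
            then have "\<bar>w \<xi>\<bar> * \<bar>u (z \<bullet> \<xi>)\<bar> \<le> G * \<bar>u (z \<bullet> \<xi>)\<bar>"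
              using w by (intro mult_right_mono) auto
            also have "\<dots> \<le> \<bar>G\<bar> * \<bar>u (z \<bullet> \<xi>)\<bar>" by (intro mult_right_mono) auto
            finally show "norm (u (z \<bullet> \<xi>) * w \<xi>) \<le> norm (G * u (z \<bullet> \<xi>))"
              by (simp add: abs_mult mult.commute)
          qed
        qed (use integrable_u_inner(1)[OF False] in auto)
        then show ?thesis by simp
      qed
    qed
  qed
  have "(\<integral>z. (\<integral>\<xi>. u (z \<bullet> \<xi>) * w \<xi> \<partial>sphere_measure) * ?\<rho> z \<partial>lborel)
      = (\<integral>z. (\<integral>\<xi>. u (z \<bullet> \<xi>) * w \<xi> * ?\<rho> z \<partial>sphere_measure) \<partial>lborel)"
    by simp
  also have "\<dots> = (\<integral>\<xi>. (\<integral>z. u (z \<bullet> \<xi>) * w \<xi> * ?\<rho> z \<partial>lborel) \<partial>sphere_measure)"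
    by (rule lborel_sphere.Fubini_integral[OF Ki, symmetric])
  also have "\<dots> = (\<integral>\<xi>. (\<integral>z. u (z \<bullet> e) * ?\<rho> z \<partial>lborel) * w \<xi> \<partial>sphere_measure)"
  proof (rule Bochner_Integration.integral_cong[OF refl])
    fix \<xi> :: "real^'n" assume "\<xi> \<in> space sphere_measure"
    then have \<xi>: "norm \<xi> = 1" by simp
    have "(\<integral>z. u (z \<bullet> \<xi>) * w \<xi> * ?\<rho> z \<partial>lborel) = (\<integral>z. w \<xi> * (u (z \<bullet> \<xi>) * ?\<rho> z) \<partial>lborel)"
      by (rule Bochner_Integration.integral_cong[OF refl]) simp
    also have "\<dots> = w \<xi> * (\<integral>z. u (z \<bullet> \<xi>) * ?\<rho> z \<partial>lborel)" by simp
    also have "(\<integral>z. u (z \<bullet> \<xi>) * ?\<rho> z \<partial>lborel) = (\<integral>z. u (z \<bullet> e) * ?\<rho> z \<partial>lborel)"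
      by (rule integral_lborel_inner_sphere) (use norm_e \<xi> in auto)
    finally show "(\<integral>z. u (z \<bullet> \<xi>) * w \<xi> * ?\<rho> z \<partial>lborel) = (\<integral>z. u (z \<bullet> e) * ?\<rho> z \<partial>lborel) * w \<xi>"
      by (simp add: mult.commute)
  qed
  also have "\<dots> = (\<integral>z. u (z \<bullet> e) * ?\<rho> z \<partial>lborel) * (\<integral>\<xi>. w \<xi> \<partial>sphere_measure)" by simp
  finally show ?thesis .
qed

text \<open>Both pairings are the same integral in direction e, times the mass of
  \<open>1 / Q\<close> and the mass of 1 respectively.\<close>

lemma integral_F_bump:
  "(\<integral>z. F z * bump r 1 (z \<bullet> z) \<partial>lborel) * total =
    (\<integral>\<xi>. 1 / Q \<xi> \<partial>sphere_measure) * (\<integral>z. F1 z * bump r 1 (z \<bullet> z) \<partial>lborel)"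
proof -
  obtain G where G: "\<And>\<xi>. \<xi> \<in> sphere 0 1 \<Longrightarrow> \<bar>1 / Q \<xi>\<bar> \<le> G" using inverse_Q_bounded by blast
  have "(\<integral>z. F z * bump r 1 (z \<bullet> z) \<partial>lborel) =
    (\<integral>z. u (z \<bullet> e) * bump r 1 (z \<bullet> z) \<partial>lborel) * (\<integral>\<xi>. 1 / Q \<xi> \<partial>sphere_measure)"
    using integral_average_bump[of "\<lambda>\<xi>. 1 / Q \<xi>" G r] G by (simp add: F_def)
  moreover have "(\<integral>z. F1 z * bump r 1 (z \<bullet> z) \<partial>lborel) =
    (\<integral>z. u (z \<bullet> e) * bump r 1 (z \<bullet> z) \<partial>lborel) * total"
    using integral_average_bump[of "\<lambda>\<xi>. 1" 1 r] by (simp add: F1_def total_def)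
  ultimately show ?thesis by simp
qed

lemma neg_laplacian_iter_F_neg:
  assumes neg: "\<And>z. z \<noteq> 0 \<Longrightarrow> ((\<lambda>u z. - laplacian u z) ^^ k) F1 z < 0"
  shows "\<exists>z. z \<noteq> 0 \<and> ((\<lambda>u z. - laplacian u z) ^^ k) F z < 0"
proof (rule ccontr)
  assume "\<not> ?thesis"
  then have nn: "z \<noteq> 0 \<Longrightarrow> ((\<lambda>u z. - laplacian u z) ^^ k) F z \<ge> 0" for z by force
  let ?N = "2 * k + 1"
  let ?\<phi> = "\<lambda>z::real^'n. bump 1 ?N (z \<bullet> z)"
  have \<phi>0: "?\<phi> z \<ge> 0" for z by (simp add: bump_def)
  have \<phi>z: "?\<phi> 0 = 0" by (rule bump_eq_0) auto
  obtain r where r: "\<And>f :: real^'n \<Rightarrow> real. smooth_on (2 * k) (-{0}) f \<Longrightarrow>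
    (\<integral>z. ((\<lambda>u z. - laplacian u z) ^^ k) f z * ?\<phi> z \<partial>lborel) = (\<integral>z. f z * bump r 1 (z \<bullet> z) \<partial>lborel)"
    using integral_neg_laplacian_iter_bump[of k 1] by blast
  define I1 where "I1 = (\<integral>z. ((\<lambda>u z. - laplacian u z) ^^ k) F1 z * ?\<phi> z \<partial>lborel)"
  have "0 \<le> (\<integral>z. ((\<lambda>u z. - laplacian u z) ^^ k) F z * ?\<phi> z \<partial>lborel)"
  proof (rule integral_nonneg_AE, rule AE_I2)
    fix z :: "real^'n"
    show "0 \<le> ((\<lambda>u z. - laplacian u z) ^^ k) F z * ?\<phi> z"
      using nn[of z] \<phi>0[of z] \<phi>z by (cases "z = 0") auto
  qed
  then have "0 \<le> (\<integral>z. F z * bump r 1 (z \<bullet> z) \<partial>lborel) * total"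
    unfolding r[OF F_smooth] using total_pos by (intro mult_nonneg_nonneg) auto
  also have "\<dots> = (\<integral>\<xi>. 1 / Q \<xi> \<partial>sphere_measure) * I1"
    unfolding I1_def r[OF F1_smooth] by (rule integral_F_bump)
  finally have I1: "I1 \<ge> 0" using integral_inverse_Q_pos by (simp add: zero_le_mult_iff)
  \<comment> \<open>g is nonnegative and its integral -I1 is at most 0, so it vanishes almost
    everywhere. The set g > 0 is open by continuity, hence would have to be empty.\<close>
  define g where "g z = - (((\<lambda>u z. - laplacian u z) ^^ k) F1 z * ?\<phi> z)" for z
  have g0: "g z \<ge> 0" for z
    using neg[of z] \<phi>0[of z] \<phi>z unfolding g_def by (cases "z = 0") (auto simp: mult_nonpos_nonneg)
  have "smooth_on 0 (-{0}) (((\<lambda>u z. - laplacian u z) ^^ k) F1)"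
    by (rule smooth_on_neg_laplacian_iter) (auto intro: F1_smooth)
  then have "smooth_on 0 UNIV (\<lambda>z. ((\<lambda>u z. - laplacian u z) ^^ k) F1 z * ?\<phi> z)"
    by (rule smooth_on_mult_extend) (auto simp: smooth_on_0 continuous_bump_inner intro!: bump_eq_0)
  then have gc: "continuous_on UNIV g" unfolding smooth_on_0 g_def by (rule continuous_on_minus)
  have gi: "integrable lborel g"
    by (rule integrable_compact_support[OF gc, of 2]) (auto simp: g_def intro!: bump_eq_0)
  have "(\<integral>z. g z \<partial>lborel) = - I1" by (simp add: g_def I1_def)
  moreover have "(\<integral>z. g z \<partial>lborel) \<ge> 0" by (intro integral_nonneg_AE AE_I2 g0)
  ultimately have "(\<integral>z. g z \<partial>lborel) = 0" using I1 by linarith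
  then have "AE z in lborel. g z = 0"
    using integral_nonneg_eq_0_iff_AE[OF gi] g0 by simp
  then have "AE z in lborel. z \<notin> {z. g z > 0}" by eventually_elim simp
  moreover have op: "open {z. g z > 0}"
    using open_Collect_less[of "\<lambda>_. 0" g] gc by auto
  ultimately have "{z. g z > 0} \<in> null_sets lborel"
    by (subst AE_iff_null_sets) auto
  then have "negligible {z. g z > 0}"
    by (simp add: negligible_iff_null_sets null_sets_completionI)
  \<comment> \<open>A point with 1 < z . z < 4, where the bump is positive.\<close>
  moreover have "sqrt 2 *\<^sub>R e \<in> {z. g z > 0}"
  proof -
    let ?z = "sqrt 2 *\<^sub>R e"
    have "?z \<bullet> ?z = 2" using norm_e by (simp add: dot_square_norm)
    then have "?\<phi> ?z > 0" by (simp add: bump_def)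
    moreover have "?z \<noteq> 0" using norm_e by auto
    ultimately show ?thesis using neg[of ?z] by (simp add: g_def mult_neg_pos)
  qed
  ultimately show False using open_not_negligible[OF op] by blast
qed

end

section \<open>Iterated Laplacians of powers and logarithms\<close>

lemma neg_laplacian_powr:
  fixes z :: "real^'n::finite"
  assumes "z \<noteq> 0"
  shows "- laplacian (\<lambda>z. c * (z \<bullet> z) powr p) z = c * (- 2 * p) * (2 * p - 2 + CARD('n)) * (z \<bullet> z) powr (p - 1)"
proof -
  have pos: "z \<bullet> z > 0" using assms by simp
  have D: "((\<lambda>s. d * s powr p) has_real_derivative d * p * s powr (p - 1)) (at s)" if "s > 0" for d p s :: real
    using DERIV_cmult[OF has_real_derivative_powr[OF that, of p], of d] by (simp add: mult.assoc)
  have "laplacian (\<lambda>z. c * (z \<bullet> z) powr p) z = 4 * (z \<bullet> z) * (c * p * (p - 1) * (z \<bullet> z) powr (p - 1 - 1))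
      + 2 * CARD('n) * (c * p * (z \<bullet> z) powr (p - 1))"
    by (rule laplacian_radial[where I="{0<..}" and q="\<lambda>s. c * s powr p" and q'="\<lambda>s. c * p * s powr (p - 1)"
        and q''="\<lambda>s. c * p * (p - 1) * s powr (p - 1 - 1)"])
      (use pos D[of _ c p] D[of _ "c * p" "p - 1"] in auto)
  also have "(z \<bullet> z) powr (p - 1 - 1) = (z \<bullet> z) powr (p - 1) / (z \<bullet> z)"
    using pos powr_diff[of "z \<bullet> z" "p - 1" 1] by simp
  also have "4 * (z \<bullet> z) * (c * p * (p - 1) * ((z \<bullet> z) powr (p - 1) / (z \<bullet> z))) =
      4 * (c * p * (p - 1) * (z \<bullet> z) powr (p - 1))"
    using pos by simp
  finally show ?thesis by (simp add: algebra_simps)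
qed

lemma neg_laplacian_ln:
  fixes z :: "real^'n::finite"
  assumes "z \<noteq> 0"
  shows "- laplacian (\<lambda>z. c + d * ln (z \<bullet> z)) z = - (2 * d) * (real CARD('n) - 2) * (z \<bullet> z) powr (-1)"
proof -
  have pos: "z \<bullet> z > 0" using assms by simp
  have D: "((\<lambda>s. c + d * ln s) has_real_derivative d * s powr (-1)) (at s)" if "s > 0" for s :: real
    using that by (auto intro!: derivative_eq_intros simp: powr_minus_divide)
  have D': "((\<lambda>s. d * s powr (-1)) has_real_derivative d * (-1) * s powr (-1 - 1)) (at s)" if "s > 0" for s :: real
    using DERIV_cmult[OF has_real_derivative_powr[OF that, of "-1"], of d] by (simp add: mult.assoc)
  have "laplacian (\<lambda>z. c + d * ln (z \<bullet> z)) z = 4 * (z \<bullet> z) * (d * (-1) * (z \<bullet> z) powr (-1 - 1))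
      + 2 * CARD('n) * (d * (z \<bullet> z) powr (-1))"
    by (rule laplacian_radial[where I="{0<..}" and q="\<lambda>s. c + d * ln s" and q'="\<lambda>s. d * s powr (-1)"
        and q''="\<lambda>s. d * (-1) * s powr (-1 - 1)"]) (use pos D D' in auto)
  also have "(z \<bullet> z) powr (-1 - 1) = (z \<bullet> z) powr (-1) / (z \<bullet> z)"
    using pos powr_diff[of "z \<bullet> z" "-1" 1] by simp
  finally show ?thesis using pos by (simp add: algebra_simps)
qed

text \<open>Each application multiplies c by (-2p)(2p - 2 + n) and lowers p by 1. The first factor
  is positive as p < 0, the second by the bound on j, and that bound survives lowering both j and p
  by 1.\<close>

lemma neg_laplacian_iter_powr_neg:
  fixes f :: "real^'n::finite \<Rightarrow> real" and c p :: real
  assumes "c < 0" "p < 0" "2 * real j < CARD('n) + 2 * p"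
    and "\<And>z. z \<noteq> 0 \<Longrightarrow> f z = c * (z \<bullet> z) powr p" and "z \<noteq> 0"
  shows "((\<lambda>u z. - laplacian u z) ^^ j) f z < 0"
  using assms
proof (induction j arbitrary: f c p)
  case 0
  then show ?case by (simp add: mult_neg_pos)
next
  case (Suc j)
  let ?c = "c * (- 2 * p) * (2 * p - 2 + CARD('n))"
  have "((\<lambda>u z. - laplacian u z) ^^ j) (\<lambda>z. - laplacian f z) z < 0"
  proof (rule Suc.IH)
    have "c * (- 2 * p) < 0" using Suc.prems by (intro mult_neg_pos) auto
    then show "?c < 0" using Suc.prems by (intro mult_neg_pos) auto
    show "p - 1 < 0" "2 * real j < CARD('n) + 2 * (p - 1)" using Suc.prems by auto
    show "- laplacian f z = ?c * (z \<bullet> z) powr (p - 1)" if "z \<noteq> 0" for z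
    proof -
      have "laplacian f z = laplacian (\<lambda>z. c * (z \<bullet> z) powr p) z"
        by (rule laplacian_cong[of "-{0}"]) (use that Suc.prems(4) in auto)
      then show ?thesis using neg_laplacian_powr[OF that, of c p] by simp
    qed
  qed fact
  then show ?case by (simp add: funpow_Suc_right del: funpow.simps)
qed

lemma set_integral_sphere:
  fixes f :: "real^'n::finite \<Rightarrow> real"
  shows "(LINT \<xi>:sphere 0 1|hausdorff_measure (CARD('n) - 1). f \<xi>) = (\<integral>\<xi>. f \<xi> \<partial>sphere_measure)"
  unfolding sphere_measure_def set_lebesgue_integral_def
  by (rule integral_restrict_space[symmetric]) simp

lemma mean_abs_pos:
  fixes e :: "real^'n::finite"
  assumes "CARD('n) \<ge> 2" "e \<noteq> 0" "integrable sphere_measure (\<lambda>\<xi>. \<bar>e \<bullet> \<xi>\<bar>)"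
  shows "(\<integral>\<xi>. \<bar>e \<bullet> \<xi>\<bar> \<partial>sphere_measure) > 0"
proof -
  have "(\<integral>\<xi>. \<bar>e \<bullet> \<xi>\<bar> \<partial>sphere_measure) \<noteq> 0"
  proof
    assume "(\<integral>\<xi>. \<bar>e \<bullet> \<xi>\<bar> \<partial>sphere_measure) = 0"
    then have "AE \<xi> in sphere_measure. \<bar>e \<bullet> \<xi>\<bar> = 0"
      by (subst (asm) integral_nonneg_eq_0_iff_AE[OF assms(3)]) auto
    then have "AE \<xi>::real^'n in sphere_measure. False"
      using AE_sphere_inner_nonzero[OF assms(2)] by eventually_elim simp
    then have "emeasure sphere_measure (space (sphere_measure :: (real^'n) measure)) = 0"
      by (subst (asm) AE_iff_measurable[OF sets.top]) auto
    then show False using emeasure_sphere_measure_pos[OF assms(1)] by simp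
  qed
  moreover have "(\<integral>\<xi>. \<bar>e \<bullet> \<xi>\<bar> \<partial>sphere_measure) \<ge> 0" by simp
  ultimately show ?thesis by linarith
qed

theorem theorem2p3:
  fixes m :: nat
    and A :: "'n::finite list \<Rightarrow> real"
    and L :: "(real^'n \<Rightarrow> real) \<Rightarrow> real^'n \<Rightarrow> real"
    and Q :: "real^'n \<Rightarrow> real"
  assumes "m \<ge> 1"
    and "CARD('n) > 2 * m"
    and "L = homogeneous_operator m A"
    and "Q = symbol m A"
    and "uniformly_elliptic m Q"
  shows "\<exists>y. y \<noteq> 0 \<and> john_fundamental_solution m Q 0 y > 0"
proof -
  obtain i :: 'n where True by auto
  define e :: "real^'n" where "e = axis i 1"
  have e: "norm e = 1" by (simp add: e_def norm_axis_1)
  have e0: "e \<noteq> 0" using e by auto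
  have dim: "CARD('n) \<ge> 2" using assms by simp
  obtain c where c: "c > 0" "\<And>\<xi>. Q \<xi> \<ge> c * norm \<xi> ^ (2 * m)"
    using assms(5) unfolding uniformly_elliptic_def by blast
  have Q_pos: "Q \<xi> > 0" if "\<xi> \<in> sphere 0 1" for \<xi>
    using c(2)[of \<xi>] c(1) that by simp
  have Q_smooth: "param_smooth k U (sphere 0 1) (\<lambda>z \<eta>. Q (H z \<eta>))"
    if "open U" "\<And>i. param_smooth k U (sphere 0 1) (\<lambda>z \<eta>. H z \<eta> $ i)"
    for k U and H :: "real^'n \<Rightarrow> real^'n \<Rightarrow> real^'n"
    unfolding assms(4) by (rule param_smooth_symbol[OF that])
  have norm_smooth: "smooth_on k (-{0}) (norm :: real^'n \<Rightarrow> real)" for k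
    by (rule smooth_on_norm) auto
  show ?thesis
  proof (cases "odd CARD('n)")
    case True
    \<comment> \<open>For r > 0, |r s| = r |s|.\<close>
    interpret sphere_kernel "\<lambda>t. \<bar>t\<bar>" "\<lambda>r. r" "\<lambda>r. 0" Q e
    proof unfold_locales
      show "integrable sphere_measure (\<lambda>\<xi>. \<bar>e \<bullet> \<xi>\<bar>)"
      proof (rule sphere.integrable_const_bound[where B=1])
        show "AE \<xi> in sphere_measure. norm \<bar>e \<bullet> \<xi>\<bar> \<le> 1"
        proof (rule AE_I2)
          fix \<xi> :: "real^'n" assume "\<xi> \<in> space sphere_measure"
          then show "norm \<bar>e \<bullet> \<xi>\<bar> \<le> 1" using Cauchy_Schwarz_ineq2[of e \<xi>] e by simp
        qed
      qed measurable
    qed (use dim e Q_pos Q_smooth norm_smooth in \<open>auto simp: abs_mult intro!: param_smooth_const\<close>)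
    have mean: "mean > 0" unfolding mean_def by (rule mean_abs_pos[OF dim e0 u_integrable])
    define k where "k = (CARD('n) + 1 - 2 * m) div 2"
    have k: "2 * k = CARD('n) + 1 - 2 * m" using True by (simp add: k_def)
    obtain j where j: "k = Suc j" using k assms(2) by (cases k) auto
    have "((\<lambda>u z. - laplacian u z) ^^ k) F1 z < 0" if z: "z \<noteq> 0" for z
    proof -
      \<comment> \<open>One Laplacian is split off: F1 = \<open>mean\<close> |z| has the positive
        exponent 1/2 and a positive coefficient, and this single step makes both negative, as the
        iteration requires.\<close>
      have "((\<lambda>u z. - laplacian u z) ^^ j) (\<lambda>z. - laplacian F1 z) z < 0"
      proof (rule neg_laplacian_iter_powr_neg[where p="1/2 - 1"])
        show "mean * (- 2 * (1/2)) * (2 * (1/2) - 2 + CARD('n)) < 0"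
          using mean dim by (simp add: mult_neg_pos)
        show "1/2 - 1 < (0::real)" by simp
        \<comment> \<open>The two sides differ by exactly 2m.\<close>
        show "2 * real j < CARD('n) + 2 * (1/2 - 1)" using k j assms by simp
        show "- laplacian F1 z = mean * (- 2 * (1/2)) * (2 * (1/2) - 2 + CARD('n)) * (z \<bullet> z) powr (1/2 - 1)"
          if "z \<noteq> 0" for z
        proof -
          have "laplacian F1 z = laplacian (\<lambda>z. mean * (z \<bullet> z) powr (1/2)) z"
            by (rule laplacian_cong[of "-{0}"])
              (use that in \<open>auto simp: integrable_u_inner(3) powr_half_sqrt norm_eq_sqrt_inner\<close>)
          then show ?thesis using neg_laplacian_powr[OF that, of mean "1/2"] by simp
        qed
      qed fact
      then show ?thesis by (simp add: j funpow_Suc_right del: funpow.simps)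
    qed
    then obtain y where y: "y \<noteq> 0" "((\<lambda>u z. - laplacian u z) ^^ k) F y < 0"
      using neg_laplacian_iter_F_neg by blast
    \<comment> \<open>At x = 0 the kernel contains |(0 - z) . \<xi>| = |z . \<xi>|, so the integral
      is \<open>F\<close>. The constant in front is negative and reverses the sign.\<close>
    have "john_fundamental_solution m Q 0 y =
        - 1 / (4 * (2 * pi) ^ (CARD('n) - 1)) * ((\<lambda>u z. - laplacian u z) ^^ k) F y"
      using True unfolding john_fundamental_solution_def Let_def set_integral_sphere k_def F_def[abs_def]
      by simp
    also have "\<dots> > 0" using y(2) by (intro mult_neg_neg) (auto simp: divide_neg_pos)
    finally show ?thesis using y(1) by blast
  next
    case False
    \<comment> \<open>For r > 0 and s \<noteq> 0, ln |r s| = ln |s| + ln r.\<close>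
    interpret sphere_kernel "\<lambda>t. ln \<bar>t\<bar>" "\<lambda>r. 1" ln Q e
    proof unfold_locales
      show "integrable sphere_measure (\<lambda>\<xi>. ln \<bar>e \<bullet> \<xi>\<bar>)" by (rule integrable_sphere_ln_inner[OF e])
      show "smooth_on k (-{0}) (\<lambda>z::real^'n. ln (norm z))" for k
        by (rule param_smooth_ln) (use norm_smooth in auto)
    qed (use dim e Q_pos Q_smooth in \<open>auto simp: abs_mult ln_mult intro!: param_smooth_const\<close>)
    define k where "k = (CARD('n) - 2 * m) div 2"
    have k: "2 * k = CARD('n) - 2 * m" using False by (simp add: k_def)
    obtain j where j: "k = Suc j" using k assms(2) by (cases k) auto
    have "((\<lambda>u z. - laplacian u z) ^^ k) F1 z < 0" if z: "z \<noteq> 0" for z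
    proof -
      have "((\<lambda>u z. - laplacian u z) ^^ j) (\<lambda>z. - laplacian F1 z) z < 0"
      proof (rule neg_laplacian_iter_powr_neg[where p="-1"])
        \<comment> \<open>n > 2m \<ge> 2 makes n - 2 positive; in dimension 2 the logarithm would be
          harmonic.\<close>
        show "- (2 * (total / 2)) * (real CARD('n) - 2) < 0"
          using total_pos assms(1,2) by (intro mult_neg_pos) auto
        show "-1 < (0::real)" by simp
        show "2 * real j < real CARD('n) + 2 * (-1)" using k j assms by simp
        show "- laplacian F1 z = - (2 * (total / 2)) * (real CARD('n) - 2) * (z \<bullet> z) powr (-1)"
          if "z \<noteq> 0" for z
        proof -
          \<comment> \<open>The half comes from ln |z| = ln (z . z) / 2; the constant
            \<open>mean\<close> disappears under the Laplacian.\<close>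
          have "laplacian F1 z = laplacian (\<lambda>z. mean + total / 2 * ln (z \<bullet> z)) z"
            by (rule laplacian_cong[of "-{0}"])
              (use that in \<open>auto simp: integrable_u_inner(3) ln_sqrt norm_eq_sqrt_inner\<close>)
          then show ?thesis using neg_laplacian_ln[OF that, of mean "total / 2"] by simp
        qed
      qed fact
      then show ?thesis by (simp add: j funpow_Suc_right del: funpow.simps)
    qed
    then obtain y where y: "y \<noteq> 0" "((\<lambda>u z. - laplacian u z) ^^ k) F y < 0"
      using neg_laplacian_iter_F_neg by blast
    have "john_fundamental_solution m Q 0 y =
        - 1 / (2 * pi) ^ CARD('n) * ((\<lambda>u z. - laplacian u z) ^^ k) F y"
      using False unfolding john_fundamental_solution_def Let_def set_integral_sphere k_def F_def[abs_def]
      by simp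
    also have "\<dots> > 0" using y(2) by (intro mult_neg_neg) (auto simp: divide_neg_pos)
    finally show ?thesis using y(1) by blast
  qed
qed

end
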